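(* Let $d\ge 1$, let $\Omega\subset\mathbb{R}^d$ be a bounded domain, and let $0<\lambda_1\le\lambda_2\le\cdots$ be the eigenvalues of the Dirichlet Laplacian on $\Omega$. For every integer $$k\ \ge\ \frac{(d+1)\left(1+\frac d2\right)}{1+\frac d4},$$ one has $$\frac{\overline{\lambda_k}}{\lambda_1}\ \le\ \frac{d+5}{2^{\frac2d}}\left(\frac{d+4}{(d+1)(d+2)}\right)^{1+\frac2d}k^{\frac2d}.$$
   Context: $\{\lambda_k\}_{k\ge1}$ are the eigenvalues, in nondecreasing order and repeated according to multiplicity, of $-\Delta$ on $\Omega$ with Dirichlet boundary conditions on $\partial\Omega$. $\overline{\lambda_k}:=\frac1k\sum_{\ell\le k}\lambda_\ell$ is the mean of the first $k$ eigenvalues. *)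

theory Defs
  imports "HOL-Analysis.Analysis"
begin

definition bounded_domain :: "'a::euclidean_space set \<Rightarrow> bool"
  where "bounded_domain \<Omega> \<longleftrightarrow> open \<Omega> \<and> connected \<Omega> \<and> bounded \<Omega> \<and> \<Omega> \<noteq> {}"

definition partial_deriv :: "('a::euclidean_space \<Rightarrow> real) \<Rightarrow> 'a \<Rightarrow> 'a \<Rightarrow> real"
  where "partial_deriv f b x = frechet_derivative f (at x) b"

definition grad :: "('a::euclidean_space \<Rightarrow> real) \<Rightarrow> 'a \<Rightarrow> 'a"
  where "grad f x = (\<Sum>b\<in>Basis. partial_deriv f b x *\<^sub>R b)"

primrec cont_diff :: "nat \<Rightarrow> ('a::euclidean_space \<Rightarrow> real) \<Rightarrow> bool"
  where
    "cont_diff 0 f \<longleftrightarrow> continuous_on UNIV f"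
  | "cont_diff (Suc k) f \<longleftrightarrow>
      (\<forall>x. f differentiable (at x)) \<and> (\<forall>b\<in>Basis. cont_diff k (partial_deriv f b))"

definition test_functions :: "'a::euclidean_space set \<Rightarrow> ('a \<Rightarrow> real) set"
  where "test_functions \<Omega> =
    {\<phi>. (\<forall>k. cont_diff k \<phi>) \<and> compact (closure {x. \<phi> x \<noteq> 0}) \<and> closure {x. \<phi> x \<noteq> 0} \<subseteq> \<Omega>}"

(* Elements of function spaces are represented by functions on the whole space, of which
   only the values almost everywhere on the domain matter. *)

definition L2 :: "'a::euclidean_space set \<Rightarrow> ('a \<Rightarrow> 'b::real_normed_vector) \<Rightarrow> bool"
  where "L2 \<Omega> u \<longleftrightarrow> u \<in> borel_measurable (lebesgue_on \<Omega>) \<and>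
    integrable (lebesgue_on \<Omega>) (\<lambda>x. (norm (u x))\<^sup>2)"

definition weak_gradient ::
    "'a::euclidean_space set \<Rightarrow> ('a \<Rightarrow> real) \<Rightarrow> ('a \<Rightarrow> 'a) \<Rightarrow> bool"
  where "weak_gradient \<Omega> u G \<longleftrightarrow>
    (\<forall>\<phi>\<in>test_functions \<Omega>. \<forall>b\<in>Basis.
      (LINT x|lebesgue_on \<Omega>. u x * partial_deriv \<phi> b x) =
      - (LINT x|lebesgue_on \<Omega>. (G x \<bullet> b) * \<phi> x))"

(* u lies in H^1_0, the closure of the test functions in the H^1 norm, and G is its gradient. *)
definition H10 :: "'a::euclidean_space set \<Rightarrow> ('a \<Rightarrow> real) \<Rightarrow> ('a \<Rightarrow> 'a) \<Rightarrow> bool"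
  where "H10 \<Omega> u G \<longleftrightarrow> L2 \<Omega> u \<and> L2 \<Omega> G \<and> weak_gradient \<Omega> u G \<and>
    (\<exists>\<phi>. (\<forall>n::nat. \<phi> n \<in> test_functions \<Omega>) \<and>
      (\<lambda>n. (LINT x|lebesgue_on \<Omega>. (\<phi> n x - u x)\<^sup>2)
         + (LINT x|lebesgue_on \<Omega>. (norm (grad (\<phi> n) x - G x))\<^sup>2)) \<longlonglongrightarrow> 0)"

(* The graph of - \<Delta> with Dirichlet boundary conditions as an operator in L^2: its domain
   consists of those u in H^1_0 whose distributional Laplacian belongs to L^2. *)
definition dirichlet_laplacian ::
    "'a::euclidean_space set \<Rightarrow> ('a \<Rightarrow> real) \<Rightarrow> ('a \<Rightarrow> real) \<Rightarrow> bool"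
  where "dirichlet_laplacian \<Omega> u f \<longleftrightarrow> L2 \<Omega> f \<and>
    (\<exists>G. H10 \<Omega> u G \<and>
      (\<forall>\<phi>\<in>test_functions \<Omega>.
        (LINT x|lebesgue_on \<Omega>. G x \<bullet> grad \<phi> x) = (LINT x|lebesgue_on \<Omega>. f x * \<phi> x)))"

(* The eigenspace of - \<Delta> for \<mu>, including the zero function. *)
definition eigenspace :: "'a::euclidean_space set \<Rightarrow> real \<Rightarrow> ('a \<Rightarrow> real) set"
  where "eigenspace \<Omega> \<mu> = {u. dirichlet_laplacian \<Omega> u (\<lambda>x. \<mu> * u x)}"

(* The eigenspace, with functions identified if equal almost everywhere, has a basis of m
   elements.  The case m = 0 says that \<mu> is not an eigenvalue. *)
definition has_multiplicity :: "'a::euclidean_space set \<Rightarrow> real \<Rightarrow> nat \<Rightarrow> bool"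
  where "has_multiplicity \<Omega> \<mu> m \<longleftrightarrow>
    (\<exists>u. (\<forall>i<m. u i \<in> eigenspace \<Omega> \<mu>) \<and>
      (\<forall>c::nat \<Rightarrow> real. (AE x in lebesgue_on \<Omega>. (\<Sum>i<m. c i * u i x) = 0) \<longrightarrow> (\<forall>i<m. c i = 0)) \<and>
      (\<forall>v\<in>eigenspace \<Omega> \<mu>. \<exists>c::nat \<Rightarrow> real. AE x in lebesgue_on \<Omega>. v x = (\<Sum>i<m. c i * u i x)))"

(* Enumeration starts at index 1; the value at 0 is irrelevant. *)
definition dirichlet_eigenvalues :: "'a::euclidean_space set \<Rightarrow> (nat \<Rightarrow> real) \<Rightarrow> bool"
  where "dirichlet_eigenvalues \<Omega> ev \<longleftrightarrow> mono_on {1..} ev \<and>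
    (\<forall>\<mu>. finite {k. 1 \<le> k \<and> ev k = \<mu>} \<and> has_multiplicity \<Omega> \<mu> (card {k. 1 \<le> k \<and> ev k = \<mu>}))"

definition eigenvalue_mean :: "(nat \<Rightarrow> real) \<Rightarrow> nat \<Rightarrow> real"
  where "eigenvalue_mean ev k = 1 / real k * (\<Sum>l=1..k. ev l)"

end

theory Submission
  imports Defs "HOL-Complex_Analysis.Great_Picard"
begin

text \<open>
  Two universal inequalities for the eigenvalues, both obtained by inserting a coordinate times an
  eigenfunction, projected off the lower eigenfunctions, into the Rayleigh quotient:
  Yang's inequality \<open>d \<Sum>\<^sub>i (z - \<lambda>\<^sub>i)\<^sup>2 \<le> 4 \<Sum>\<^sub>i (z - \<lambda>\<^sub>i) \<lambda>\<^sub>i\<close> (sum over \<open>\<lambda>\<^sub>i \<le> z\<close>), and the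
  inequality of Ashbaugh and Benguria \<open>\<lambda>\<^sub>2 + \<dots> + \<lambda>\<^bsub>d+1\<^esub> \<le> (d + 4) \<lambda>\<^sub>1\<close>, for which the coordinate
  axes are first rotated.  With the Riesz means \<open>R\<^sub>p(z) = \<Sum>\<^sub>i (z - \<lambda>\<^sub>i)\<^sub>+\<^sup>p\<close>, Yang's inequality says that
  \<open>R\<^sub>2(z) / z\<^bsup>2 + d/2\<^esup>\<close> is nondecreasing.  A Legendre transform turns the resulting lower bound on
  \<open>R\<^sub>1\<close> into an upper bound on the ratio of the means of the first \<open>k\<close> and the first \<open>j\<close> eigenvalues,
  which is used for \<open>j = d + 1\<close>.  The variational characterisation of the eigenvalues rests on the
  compactness of the embedding of \<open>H\<^sup>1\<^sub>0\<close> into \<open>L\<^sup>2\<close>, so that the infimum of the Rayleigh quotient on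
  an orthogonal complement is itself an eigenvalue.
\<close>

section \<open>Riesz means\<close>

text \<open>The eigenvalues are known only through the multiplicities of the eigenspaces; neither a
  min-max principle nor completeness of the eigenfunctions is at hand. What the trial functions
  require is weaker: a function orthogonal to the first \<open>n\<close> eigenfunctions has Rayleigh
  quotient at least \<open>ev (Suc n)\<close>. Compactness supplies a minimizer, the minimizer is an
  eigenfunction, and the multiplicities leave no room for one below \<open>ev (Suc n)\<close>. The
  commutator identities [-\<Delta>, x] = -2 d/dx and [d/dx, x] = 1 behind both universal
  inequalities are used in weak form, on pairs of a function and its gradient, so that second
  derivatives never occur. The choice \<open>j = d + 1\<close> is the number of eigenvalues under
  the control of the Ashbaugh-Benguria inequality: their mean is at most
  \<open>(d + 5) / (d + 1)\<close> times the first one, whence the factor \<open>d + 5\<close>. The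
  threshold for \<open>k\<close> marks the ratio \<open>k / j\<close> from which on the optimal
  parameter of the Legendre transform is at least 1.\<close>

lemma DERIV_pos_part_square:
  fixes a :: real
  shows "((\<lambda>x. (max 0 (x - a))\<^sup>2) has_real_derivative 2 * max 0 (z - a)) (at z)"
  unfolding has_field_derivative_iff
proof (rule LIM_zero_cancel, rule Lim_null_comparison)
  define u where "u = max 0 (z - a)"
  have "norm (((max 0 (x - a))\<^sup>2 - u\<^sup>2) / (x - z) - 2 * u) \<le> \<bar>x - z\<bar>" if "x \<noteq> z" for x
  proof -
    define v where "v = max 0 (x - a)"
    \<comment> \<open>The remainder of the first order expansion stays quadratic when the kink
      \<open>a\<close> lies between \<open>x\<close> and \<open>z\<close>, since both are then at
      most \<open>\<bar>x - z\<bar>\<close> away from \<open>a\<close>.\<close>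
    have "\<bar>v\<^sup>2 - u\<^sup>2 - 2 * u * (x - z)\<bar> \<le> (x - z)\<^sup>2"
    proof (cases "a \<le> x"; cases "a \<le> z")
      assume "a \<le> x" "\<not> a \<le> z"
      then have "v = x - a" "u = 0" "\<bar>x - a\<bar> \<le> \<bar>x - z\<bar>" by (auto simp: u_def v_def)
      then show ?thesis by (simp add: abs_le_square_iff)
    next
      assume *: "\<not> a \<le> x" "a \<le> z"
      have vu: "v = 0" "u = z - a" using * by (auto simp: u_def v_def)
      have "v\<^sup>2 - u\<^sup>2 - 2 * u * (x - z) = (z - x)\<^sup>2 - (a - x)\<^sup>2"
        unfolding vu by (simp add: power2_eq_square algebra_simps)
      moreover have "(a - x)\<^sup>2 \<le> (z - x)\<^sup>2" using * by (intro power_mono) auto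
      ultimately show ?thesis by (simp add: power2_commute[of x z])
    next
      assume *: "a \<le> x" "a \<le> z"
      then have vu: "v = x - a" "u = z - a" by (auto simp: u_def v_def)
      have "v\<^sup>2 - u\<^sup>2 - 2 * u * (x - z) = (x - z)\<^sup>2"
        unfolding vu by (simp add: power2_eq_square algebra_simps)
      then show ?thesis by simp
    qed (auto simp: u_def v_def)
    then have "\<bar>v\<^sup>2 - u\<^sup>2 - 2 * u * (x - z)\<bar> / \<bar>x - z\<bar> \<le> (x - z)\<^sup>2 / \<bar>x - z\<bar>"
      by (rule divide_right_mono) simp
    moreover have "(v\<^sup>2 - u\<^sup>2) / (x - z) - 2 * u = (v\<^sup>2 - u\<^sup>2 - 2 * u * (x - z)) / (x - z)"
      using that by (simp add: field_simps)
    moreover have "(x - z)\<^sup>2 / \<bar>x - z\<bar> = \<bar>x - z\<bar>"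
      using that by (simp add: power2_eq_square divide_simps)
    ultimately show ?thesis by (simp add: v_def abs_divide)
  qed
  then show "\<forall>\<^sub>F x in at z. norm (((max 0 (x - a))\<^sup>2 - (max 0 (z - a))\<^sup>2) / (x - z) - 2 * max 0 (z - a)) \<le> \<bar>x - z\<bar>"
    by (auto simp: u_def eventually_at intro: exI[of _ 1])
  show "((\<lambda>x. \<bar>x - z\<bar>) \<longlongrightarrow> 0) (at z)"
    by (intro tendsto_eq_intros refl) auto
qed

text \<open>This is the Legendre transform of a multiple of \<open>t powr (1 + d / 2)\<close>,
  evaluated by a weighted arithmetic-geometric mean inequality instead of by calculus.\<close>

lemma linear_minus_powr_le:
  fixes d t j k :: real
  assumes "0 < d" "0 < t" "0 < j" "0 < k"
  shows "k * ((d + 4) / d) * t - j * (4 / d) * t powr (1 + d / 2)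
    \<le> 2 * k * ((1 + d / 4) / (1 + d / 2)) powr (1 + 2 / d) * (k / j) powr (2 / d)"
proof -
  define p where "p = 1 + d / 2"
  define q where "q = (k / j) * ((1 + d / 4) / (1 + d / 2))"
  \<comment> \<open>\<open>T\<close> is the critical point in \<open>t\<close> of the left-hand
    side, where \<open>t powr (d / 2) = q\<close>.\<close>
  define T where "T = q powr (2 / d)"
  have p: "1 < p" using assms by (simp add: p_def)
  have q: "0 < q" using assms by (simp add: q_def)
  have T: "0 < T" using q by (simp add: T_def)
  have Tp: "T powr p = q * T"
  proof -
    have "(2 / d) * p = 1 + 2 / d" using assms by (simp add: p_def field_simps)
    then have "T powr p = q powr (1 + 2 / d)" by (simp add: T_def powr_powr)
    also have "\<dots> = q * T" using q by (simp add: T_def powr_add)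
    finally show ?thesis .
  qed
  define y where "y = (t / T) powr p"
  have y: "0 < y" using assms T by (simp add: y_def)
  \<comment> \<open>Equality holds at \<open>y = 1\<close>, that is at \<open>t = T\<close>, so the
    maximum is attained exactly.\<close>
  have "y powr (1 / p) * 1 powr (1 - 1 / p) \<le> 1 / p * y + (1 - 1 / p) * 1"
    using y p by (intro Youngs_inequality_0) auto
  moreover have "y powr (1 / p) = t / T"
    using assms T p by (simp add: y_def powr_powr)
  ultimately have "p * (t / T) \<le> y + (p - 1)"
    using p by (simp add: field_simps)
  then have "p * (t / T) * (q * T) \<le> (y + (p - 1)) * (q * T)"
    using q T by (intro mult_right_mono) auto
  moreover have "y * (q * T) = t powr p"
    using assms T Tp q by (simp add: y_def powr_divide)
  ultimately have *: "p * q * t \<le> t powr p + (p - 1) * (q * T)"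
    using T by (simp add: algebra_simps)
  have "p * q = (k / j) * (1 + d / 4)"
    using assms by (simp add: p_def q_def)
  then have "k * ((d + 4) / d) = j * (4 / d) * (p * q)"
    using assms by (simp add: field_simps)
  then have "k * ((d + 4) / d) * t = j * (4 / d) * (p * q * t)"
    by (simp only: mult.assoc)
  also have "\<dots> \<le> j * (4 / d) * (t powr p + (p - 1) * (q * T))"
    using assms * by (intro mult_left_mono) auto
  also have "\<dots> = j * (4 / d) * t powr p + 2 * j * (q * T)"
    using assms by (simp add: p_def field_simps)
  also have "2 * j * (q * T) = 2 * k * ((1 + d / 4) / (1 + d / 2)) powr (1 + 2 / d) * (k / j) powr (2 / d)"
  proof -
    define r where "r = (1 + d / 4) / (1 + d / 2)"
    have r: "0 < r" using assms by (simp add: r_def)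
    have "T = (k / j) powr (2 / d) * r powr (2 / d)"
      unfolding T_def q_def r_def[symmetric] using assms r by (simp only: powr_mult)
    moreover have "r powr (1 + 2 / d) = r * r powr (2 / d)"
      using r by (simp add: powr_add)
    ultimately show ?thesis using assms by (simp add: q_def flip: r_def)
  qed
  finally show ?thesis by (simp add: p_def)
qed

text \<open>At \<open>z = ev k\<close> the sum of the first \<open>k\<close> values is
  \<open>k * z - R1 z\<close>, so a lower bound on \<open>R1 z\<close> is wanted. Yang's inequality
  bounds \<open>z * R1 z\<close> below by \<open>(1 + d / 4) * R2 z\<close>, the monotone quotient
  carries a bound on \<open>R2\<close> from a base point \<open>z0\<close> up to \<open>z\<close>,
  and the Cauchy-Schwarz inequality for the first \<open>j\<close> terms bounds
  \<open>R2 z0\<close>.\<close>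

lemma mean_ratio_bound:
  fixes ev :: "nat \<Rightarrow> real" and d :: real
  defines "M n \<equiv> 1 / real n * (\<Sum>i=1..n. ev i)"
  assumes d: "0 < d" and mono: "mono_on {1..} ev" and pos: "0 < ev 1"
    and Yang: "\<And>m z. 1 \<le> m \<Longrightarrow> ev m \<le> z \<Longrightarrow> z \<le> ev (Suc m) \<Longrightarrow>
      d * (\<Sum>i=1..m. (z - ev i)\<^sup>2) \<le> 4 * (\<Sum>i=1..m. (z - ev i) * ev i)"
    and j: "1 \<le> j" and jk: "real j * ((1 + d / 2) / (1 + d / 4)) \<le> real k"
  shows "M k \<le> 2 * ((1 + d / 4) / (1 + d / 2)) powr (1 + 2 / d) * (real k / real j) powr (2 / d) * M j"
proof -
  have "1 \<le> (1 + d / 2) / (1 + d / 4)" using d by simp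
  then have "real j * 1 \<le> real j * ((1 + d / 2) / (1 + d / 4))" by (intro mult_left_mono) auto
  then have jk': "j \<le> k" using jk by linarith
  then have k: "1 \<le> k" using j by simp
  have evle: "ev i \<le> ev l" if "1 \<le> i" "i \<le> l" for i l
    using mono_onD[OF mono, of i l] that by simp
  \<comment> \<open>Truncation at \<open>k\<close> is harmless for \<open>z \<le> ev k\<close>: the
    later terms of the full Riesz means vanish there.\<close>
  define R1 where "R1 z = (\<Sum>i=1..k. max 0 (z - ev i))" for z
  define R2 where "R2 z = (\<Sum>i=1..k. (max 0 (z - ev i))\<^sup>2)" for z
  have R1_ge: "real n * z - (\<Sum>i=1..n. ev i) \<le> R1 z" if "n \<le> k" for n z
  proof -
    have "real n * z - (\<Sum>i=1..n. ev i) = (\<Sum>i=1..n. z - ev i)" by (simp add: sum_subtractf)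
    also have "\<dots> \<le> (\<Sum>i=1..n. max 0 (z - ev i))" by (intro sum_mono) auto
    also have "\<dots> \<le> R1 z" unfolding R1_def using that by (intro sum_mono2) auto
    finally show ?thesis .
  qed
  have R12: "(1 + d / 4) * R2 z \<le> z * R1 z" if z: "ev 1 \<le> z" "z \<le> ev k" for z
  proof -
    \<comment> \<open>Yang's inequality asks for \<open>z\<close> between \<open>ev m\<close> and
      \<open>ev (Suc m)\<close>. When \<open>m = k\<close>, the upper bound comes from
      \<open>z \<le> ev k\<close> and monotonicity.\<close>
    define m where "m = Max {i\<in>{1..k}. ev i \<le> z}"
    have ne: "{i\<in>{1..k}. ev i \<le> z} \<noteq> {}" using z k by auto
    have m: "m \<in> {i\<in>{1..k}. ev i \<le> z}" unfolding m_def by (rule Max_in[OF _ ne]) simp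
    have m_max: "i \<le> m" if "i \<in> {1..k}" "ev i \<le> z" for i
      unfolding m_def using that by (intro Max_ge) auto
    have z_le: "z \<le> ev i" if "m < i" "i \<le> k" for i
      using m_max[of i] that m by force
    have "z \<le> ev (Suc m)"
    proof (cases "m = k")
      case True then show ?thesis using z evle[of k "Suc k"] k by simp
    next
      case False then show ?thesis using m by (intro z_le) auto
    qed
    then have Y: "d * (\<Sum>i=1..m. (z - ev i)\<^sup>2) \<le> 4 * (\<Sum>i=1..m. (z - ev i) * ev i)"
      using m by (intro Yang) auto
    have pp: "max 0 (z - ev i) = z - ev i" if "i \<in> {1..m}" for i
      using that evle[of i m] m by auto
    have zero: "max 0 (z - ev i) = 0" if "i \<in> {1..k} - {1..m}" for i
      using z_le[of i] that by auto
    have "R1 z = (\<Sum>i=1..m. max 0 (z - ev i))"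
      unfolding R1_def using m zero by (intro sum.mono_neutral_right) auto
    also have "\<dots> = (\<Sum>i=1..m. z - ev i)" using pp by (intro sum.cong) auto
    finally have 1: "R1 z = (\<Sum>i=1..m. z - ev i)" .
    have "R2 z = (\<Sum>i=1..m. (max 0 (z - ev i))\<^sup>2)"
      unfolding R2_def using m zero by (intro sum.mono_neutral_right) auto
    also have "\<dots> = (\<Sum>i=1..m. (z - ev i)\<^sup>2)" using pp by (intro sum.cong) auto
    finally have 2: "R2 z = (\<Sum>i=1..m. (z - ev i)\<^sup>2)" .
    have "(\<Sum>i=1..m. (z - ev i) * ev i) = z * R1 z - R2 z"
      unfolding 1 2 sum_distrib_left sum_subtractf[symmetric]
      by (intro sum.cong) (auto simp: power2_eq_square algebra_simps)
    then show ?thesis using Y 2 by (simp add: algebra_simps)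
  qed
  have M_ev1: "ev 1 \<le> M j"
  proof -
    have "real j * ev 1 \<le> (\<Sum>i=1..j. ev i)"
      using sum_mono[of "{1..j}" "\<lambda>i. ev 1" ev] evle by simp
    then show ?thesis using j by (simp add: M_def field_simps)
  qed
  then have M: "0 < M j" using pos by simp
  have Msum: "(\<Sum>i=1..n. ev i) = real n * M n" if "1 \<le> n" for n
    using that by (simp add: M_def)
  \<comment> \<open>This base point maximises
    \<open>(z0 - M j)\<^sup>2 / z0 powr (2 + d / 2)\<close>, hence gives the strongest lower bound
    on \<open>R2\<close> at larger arguments.\<close>
  define z0 where "z0 = (d + 4) / d * M j"
  have z0: "z0 - M j = 4 / d * M j" using d by (simp add: z0_def field_simps)
  have z0_pos: "0 < z0" using d M by (simp add: z0_def)
  have Mz0: "M j \<le> z0" using z0 d M by (smt (verit) divide_pos_pos mult_pos_pos)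
  define s where "s = 2 + d / 2"
  define z where "z = ev k"
  \<comment> \<open>The witness is \<open>z / z0\<close> if \<open>z\<close> has reached the base
    point and 1 otherwise; optimising over \<open>t\<close> afterwards treats both cases at
    once.\<close>
  have "\<exists>t>0. real k * M k \<le> M j * (real k * ((d + 4) / d) * t - real j * (4 / d) * t powr (1 + d / 2))"
  proof (cases "z0 \<le> z")
    case True
    define t where "t = z / z0"
    have zpos: "0 < z" using True z0_pos by simp
    have t: "0 < t" using zpos z0_pos by (simp add: t_def)
    \<comment> \<open>The exponent \<open>s\<close> is the one for which the derivative is a
      positive multiple of \<open>x * R1 x - (1 + d / 4) * R2 x\<close>, whose sign is Yang's
      inequality.\<close>
    define G where "G x = R2 x * x powr (- s)" for x
    have "G z0 \<le> G z"
    proof (rule DERIV_nonneg_imp_nondecreasing[OF True])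
      fix x assume x: "z0 \<le> x" "x \<le> z"
      have x0: "0 < x" using x z0_pos by simp
      have R2': "(R2 has_real_derivative 2 * R1 x) (at x)"
        unfolding R2_def[abs_def] R1_def sum_distrib_left
        by (intro DERIV_sum DERIV_pos_part_square)
      have "(G has_real_derivative (2 * R1 x) * x powr (- s) + (- s * x powr (- s - 1)) * R2 x) (at x)"
        unfolding G_def[abs_def]
        by (intro DERIV_mult R2' has_real_derivative_powr x0)
      moreover have "(2 * R1 x) * x powr (- s) + (- s * x powr (- s - 1)) * R2 x =
          x powr (- s - 1) * (2 * (x * R1 x - (1 + d / 4) * R2 x))"
      proof -
        have "x powr (- s) = x powr (- s - 1) * x"
          using x0 powr_add[of x "- s - 1" 1] by simp
        then show ?thesis by (simp add: s_def algebra_simps)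
      qed
      moreover have "(1 + d / 4) * R2 x \<le> x * R1 x"
        using x M_ev1 Mz0 by (intro R12) (auto simp: z_def)
      ultimately show "\<exists>y. (G has_real_derivative y) (at x) \<and> 0 \<le> y"
        by (intro exI conjI) auto
    qed
    then have "R2 z0 * t powr s \<le> R2 z"
      using z0_pos zpos by (simp add: G_def t_def powr_minus powr_divide field_simps)
    \<comment> \<open>The first \<open>j\<close> gaps \<open>z0 - ev i\<close> have mean
      \<open>z0 - M j = 4 / d * M j\<close>; their squares are bounded below by
      Cauchy-Schwarz.\<close>
    moreover have "real j * (4 / d * M j)\<^sup>2 \<le> R2 z0"
    proof -
      have "real j * (4 / d * M j) = (\<Sum>i=1..j. z0 - ev i)"
        unfolding z0[symmetric] using Msum[OF j] by (simp add: sum_subtractf right_diff_distrib)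
      also have "\<dots> \<le> (\<Sum>i=1..j. max 0 (z0 - ev i))" by (intro sum_mono) auto
      finally have "(real j * (4 / d * M j))\<^sup>2 \<le> (\<Sum>i=1..j. max 0 (z0 - ev i))\<^sup>2"
        using d M by (intro power_mono) auto
      also have "\<dots> \<le> real j * (\<Sum>i=1..j. (max 0 (z0 - ev i))\<^sup>2)"
        using sum_squared_le_sum_of_squares[of "\<lambda>i. max 0 (z0 - ev i)" "{1..j}"]
        by (simp add: mult.commute)
      also have "\<dots> \<le> real j * R2 z0"
        unfolding R2_def using jk' by (intro mult_left_mono sum_mono2) auto
      finally have "real j * (real j * (4 / d * M j)\<^sup>2) \<le> real j * R2 z0"
        by (simp add: power2_eq_square algebra_simps)
      then show ?thesis using j by simp
    qed
    ultimately have "real j * (4 / d * M j)\<^sup>2 * t powr s \<le> R2 z"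
      by (smt (verit) mult_right_mono powr_ge_zero)
    then have "(1 + d / 4) * (real j * (4 / d * M j)\<^sup>2 * t powr s) \<le> (1 + d / 4) * R2 z"
      using d by (intro mult_left_mono) auto
    also have "\<dots> \<le> z * R1 z"
      using True M_ev1 Mz0 by (intro R12) (auto simp: z_def)
    also have "(1 + d / 4) * (real j * (4 / d * M j)\<^sup>2 * t powr s) =
        z * (real j * (4 / d) * M j * t powr (1 + d / 2))"
    proof -
      have ts: "t powr s = t * t powr (1 + d / 2)"
        using t powr_add[of t 1 "1 + d / 2"] by (simp add: s_def)
      have z0': "(1 + d / 4) * (4 / d * M j) = z0"
        using d by (simp add: z0_def field_simps)
      have zt: "z = z0 * t" using z0_pos by (simp add: t_def)
      have "(1 + d / 4) * (real j * (4 / d * M j)\<^sup>2 * t powr s) =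
          ((1 + d / 4) * (4 / d * M j)) * (real j * (4 / d * M j) * t powr s)"
        by (simp only: power2_eq_square mult_ac)
      also have "\<dots> = z * (real j * (4 / d) * M j * t powr (1 + d / 2))"
        unfolding z0' ts zt by (simp only: mult_ac)
      finally show ?thesis .
    qed
    finally have "real j * (4 / d) * M j * t powr (1 + d / 2) \<le> R1 z"
      by (rule mult_left_le_imp_le) (rule zpos)
    moreover have "R1 z = real k * z - real k * M k"
    proof -
      have "R1 z = (\<Sum>i=1..k. z - ev i)"
        unfolding R1_def z_def using evle by (intro sum.cong) (auto simp: max_def)
      then show ?thesis using Msum[OF k] by (simp add: sum_subtractf)
    qed
    moreover have "z = (d + 4) / d * M j * t" using z0_pos d M by (simp add: t_def z0_def)
    ultimately have "real k * M k \<le> M j * (real k * ((d + 4) / d) * t - real j * (4 / d) * t powr (1 + d / 2))"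
      by (simp add: algebra_simps)
    then show ?thesis using t by blast
  next
    \<comment> \<open>Below the base point the trivial bound
      \<open>R1 z \<ge> j * z - j * M j\<close> suffices. The coefficient \<open>k - j\<close> of
      \<open>z\<close> is nonnegative, so \<open>z\<close> may be raised to \<open>z0\<close>, which
      is the bound at \<open>t = 1\<close>.\<close>
    case False
    have "R1 z = real k * z - real k * M k"
    proof -
      have "R1 z = (\<Sum>i=1..k. z - ev i)"
        unfolding R1_def z_def using evle by (intro sum.cong) (auto simp: max_def)
      then show ?thesis using Msum[OF k] by (simp add: sum_subtractf)
    qed
    then have "real k * M k \<le> real k * z - (real j * z - real j * M j)"
      using R1_ge[OF jk', of z] Msum[OF j] by simp
    also have "\<dots> = (real k - real j) * z + real j * M j" by (simp add: algebra_simps)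
    also have "\<dots> \<le> (real k - real j) * z0 + real j * M j"
      using False jk' by (intro add_right_mono mult_left_mono) auto
    also have "\<dots> = real k * z0 - real j * (z0 - M j)" by (simp add: algebra_simps)
    also have "\<dots> = M j * (real k * ((d + 4) / d) * 1 - real j * (4 / d) * 1 powr (1 + d / 2))"
      unfolding z0 by (simp add: z0_def algebra_simps)
    finally show ?thesis by (intro exI[of _ 1]) simp
  qed
  then obtain t where t: "0 < t" and
    "real k * M k \<le> M j * (real k * ((d + 4) / d) * t - real j * (4 / d) * t powr (1 + d / 2))"
    by blast
  note this(2)
  also have "\<dots> \<le> M j * (2 * real k * ((1 + d / 4) / (1 + d / 2)) powr (1 + 2 / d) * (real k / real j) powr (2 / d))"
    using M d j k t by (intro mult_left_mono linear_minus_powr_le) auto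
  also have "\<dots> = real k * (2 * ((1 + d / 4) / (1 + d / 2)) powr (1 + 2 / d) * (real k / real j) powr (2 / d) * M j)"
    by simp
  finally show ?thesis using k by simp
qed

text \<open>With \<open>j = n + 1\<close>, the gap inequality bounds the sum of the first
  \<open>j\<close> values by \<open>(d + 5) * ev 1\<close>. The power of \<open>d + 1\<close> in the
  result collects the \<open>1 / (d + 1)\<close> of the mean and the
  \<open>(d + 1) powr (2 / d)\<close> under \<open>k\<close>.\<close>

lemma first_mean_ratio_bound:
  fixes ev :: "nat \<Rightarrow> real" and n k :: nat
  defines "d \<equiv> real n"
  assumes n: "1 \<le> n" and mono: "mono_on {1..} ev" and pos: "0 < ev 1"
    and Yang: "\<And>m z. 1 \<le> m \<Longrightarrow> ev m \<le> z \<Longrightarrow> z \<le> ev (Suc m) \<Longrightarrow>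
      d * (\<Sum>i=1..m. (z - ev i)\<^sup>2) \<le> 4 * (\<Sum>i=1..m. (z - ev i) * ev i)"
    and gaps: "(\<Sum>i=1..n. ev (Suc i) - ev 1) \<le> 4 * ev 1"
    and k: "(d + 1) * (1 + d / 2) / (1 + d / 4) \<le> real k"
  shows "1 / real k * (\<Sum>i=1..k. ev i) / ev 1 \<le>
    (d + 5) / 2 powr (2 / d) * ((d + 4) / ((d + 1) * (d + 2))) powr (1 + 2 / d) * real k powr (2 / d)"
proof -
  have d: "0 < d" using n by (simp add: d_def)
  have d1: "real (Suc n) = d + 1" by (simp add: d_def)
  define c where "c = 2 * ((1 + d / 4) / (1 + d / 2)) powr (1 + 2 / d) * (real k / (d + 1)) powr (2 / d)"
  have c: "0 \<le> c" by (simp add: c_def)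
  have "(\<Sum>i=1..Suc n. ev i) = ev 1 + (\<Sum>i=1..n. ev (Suc i))"
    by (simp add: sum.atLeast_Suc_atMost sum.shift_bounds_cl_Suc_ivl del: sum.cl_ivl_Suc)
  also have "\<dots> \<le> (d + 5) * ev 1"
    using gaps by (simp add: sum_subtractf d_def algebra_simps)
  finally have "1 / (d + 1) * (\<Sum>i=1..Suc n. ev i) \<le> 1 / (d + 1) * ((d + 5) * ev 1)"
    using d by (intro mult_left_mono) auto
  then have m: "c * (1 / (d + 1) * (\<Sum>i=1..Suc n. ev i)) \<le> c * (1 / (d + 1) * ((d + 5) * ev 1))"
    using c by (rule mult_left_mono)
  have "1 / real k * (\<Sum>i=1..k. ev i) \<le> c * (1 / (d + 1) * (\<Sum>i=1..Suc n. ev i))"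
    using mean_ratio_bound[OF d mono pos Yang, of "Suc n" k] k unfolding c_def d1 by simp
  also note m
  also have "c * (1 / (d + 1) * ((d + 5) * ev 1)) = c * ((d + 5) / (d + 1)) * ev 1"
    by simp
  finally have "1 / real k * (\<Sum>i=1..k. ev i) / ev 1 \<le> c * ((d + 5) / (d + 1))"
    using pos by (simp only: pos_divide_le_eq)
  also have "\<dots> = (d + 5) / 2 powr (2 / d) * ((d + 4) / ((d + 1) * (d + 2))) powr (1 + 2 / d) * real k powr (2 / d)"
  proof -
    define e where "e = 2 / d"
    define A where "A = (d + 4) / (d + 2)"
    have A: "0 < A" using d by (simp add: A_def)
    have r: "(1 + d / 4) / (1 + d / 2) = A / 2"
      using d by (simp add: A_def field_simps)
    have "c = 2 * (A powr (1 + e) / 2 powr (1 + e)) * (real k powr e / (d + 1) powr e)"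
      using d A unfolding c_def r e_def by (simp add: powr_divide)
    also have "2 powr (1 + e) = 2 * 2 powr e" by (simp add: powr_add)
    finally have c': "c = A powr (1 + e) / 2 powr e * (real k powr e / (d + 1) powr e)"
      by simp
    have "((d + 4) / ((d + 1) * (d + 2))) powr (1 + e) = (A / (d + 1)) powr (1 + e)"
      by (simp add: A_def mult.commute)
    also have "\<dots> = A powr (1 + e) / (d + 1) powr (1 + e)"
      using d A by (simp add: powr_divide)
    also have "(d + 1) powr (1 + e) = (d + 1) * (d + 1) powr e"
      using d by (simp add: powr_add)
    finally show ?thesis unfolding c' e_def[symmetric] by (simp add: mult_ac)
  qed
  finally show ?thesis .
qed

section \<open>Gradient forms with compact embedding\<close>

text \<open>For small \<open>t\<close> of the sign opposite to \<open>a\<close> the linear term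
  wins; \<open>t = - a / c\<close> with a positive \<open>c > b\<close> is small enough. It turns a
  minimum into an Euler-Lagrange equation.\<close>

lemma linear_coefficient_zero:
  fixes a b :: real
  assumes "\<And>t. 0 \<le> 2 * t * a + t\<^sup>2 * b"
  shows "a = 0"
proof (rule ccontr)
  assume a: "a \<noteq> 0"
  define c where "c = \<bar>b\<bar> + 1"
  have c: "b < c" "0 < c" by (auto simp: c_def)
  have "0 \<le> 2 * (- a / c) * a + (- a / c)\<^sup>2 * b" by (rule assms)
  also have "\<dots> \<le> 2 * (- a / c) * a + (- a / c)\<^sup>2 * c"
    using c by (intro add_left_mono mult_left_mono) auto
  also have "\<dots> = - (a\<^sup>2 / c)"
    using c by (simp add: power2_eq_square field_simps)
  also have "\<dots> < 0" using a c by simp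
  finally show False by simp
qed

lemma norm_add_scaleR_square:
  "(norm (x + t *\<^sub>R y))\<^sup>2 = (norm x)\<^sup>2 + 2 * t * (x \<bullet> y) + t\<^sup>2 * (norm y)\<^sup>2"
  for x y :: "'a::real_inner"
  unfolding power2_norm_eq_inner
  by (simp add: inner_add inner_commute[of y x] power2_eq_square algebra_simps)

text \<open>\<open>H\<close> stands for the graph of the gradient on \<open>H\<^sup>1\<^sub>0\<close>, as a subspace of a product of
  two \<open>L\<^sup>2\<close> spaces; the last assumption is the compactness of the embedding into \<open>L\<^sup>2\<close>.\<close>

locale gradient_graph =
  fixes H :: "('h::{real_inner,complete_space} \<times> 'k::{real_inner,complete_space}) set"
  assumes subspace_H: "subspace H" and closed_H: "closed H"
    and compact_embedding: "\<And>e. 0 < e \<Longrightarrow>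
      \<exists>C. finite C \<and> (\<forall>(w, r)\<in>H. (norm w)\<^sup>2 \<le> e * (norm r)\<^sup>2 + (\<Sum>c\<in>C. (w \<bullet> c)\<^sup>2))"
begin

lemma H_diff: "(w, r) \<in> H \<Longrightarrow> (w', r') \<in> H \<Longrightarrow> (w - w', r - r') \<in> H"
  using subspace_diff[OF subspace_H, of "(w, r)" "(w', r')"] by simp

lemma H_add: "(w, r) \<in> H \<Longrightarrow> (w', r') \<in> H \<Longrightarrow> (w + w', r + r') \<in> H"
  using subspace_add[OF subspace_H, of "(w, r)" "(w', r')"] by simp

lemma H_scaleR: "(w, r) \<in> H \<Longrightarrow> (c *\<^sub>R w, c *\<^sub>R r) \<in> H"
  using subspace_scale[OF subspace_H, of "(w, r)" c] by simp

lemma H_sum: "(\<And>i. i \<in> I \<Longrightarrow> (w i, r i) \<in> H) \<Longrightarrow> (\<Sum>i\<in>I. w i, \<Sum>i\<in>I. r i) \<in> H"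
  using subspace_sum[OF subspace_H, of I "\<lambda>i. (w i, r i)"] by (simp add: sum_prod)

text \<open>The parameters \<open>1 / Suc n\<close> in the compactness assumption involve only
  countably many vectors \<open>c\<close>. A diagonal subsequence makes all inner products with them
  converge, and the assumption, applied to differences of members, then controls the norm. No weak
  topology enters.\<close>

lemma bounded_imp_Cauchy_subsequence:
  assumes z: "\<And>n. (w n, r n) \<in> H" and w: "\<And>n. norm (w n) \<le> B" and r: "\<And>n. norm (r n) \<le> B"
  obtains s :: "nat \<Rightarrow> nat" where "strict_mono s" "Cauchy (w \<circ> s)"
proof -
  have B: "0 \<le> B" using w[of 0] norm_ge_zero order_trans by blast
  have "\<forall>n. \<exists>C. finite C \<and>
      (\<forall>(w, r)\<in>H. (norm w)\<^sup>2 \<le> 1 / real (Suc n) * (norm r)\<^sup>2 + (\<Sum>c\<in>C. (w \<bullet> c)\<^sup>2))"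
    by (intro allI compact_embedding) simp
  from choice[OF this] obtain C where C': "\<forall>n. finite (C n) \<and>
      (\<forall>(w, r)\<in>H. (norm w)\<^sup>2 \<le> 1 / real (Suc n) * (norm r)\<^sup>2 + (\<Sum>c\<in>C n. (w \<bullet> c)\<^sup>2))"
    by blast
  then have fin: "finite (C n)" for n by blast
  have C: "(norm w)\<^sup>2 \<le> 1 / real (Suc n) * (norm r)\<^sup>2 + (\<Sum>c\<in>C n. (w \<bullet> c)\<^sup>2)"
    if "(w, r) \<in> H" for n w r
    using C' that by blast
  \<comment> \<open>The diagonal extraction wants one bound for all functionals; dividing by
    \<open>norm c + 1\<close> provides it and is safe at \<open>c = 0\<close>.\<close>
  have "\<bar>w n \<bullet> c / (norm c + 1)\<bar> \<le> B" for n c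
  proof -
    have "\<bar>w n \<bullet> c\<bar> \<le> norm (w n) * norm c" by (rule Cauchy_Schwarz_ineq2)
    also have "\<dots> \<le> B * (norm c + 1)" using w[of n] B by (intro mult_mono) auto
    finally have "\<bar>w n \<bullet> c\<bar> \<le> B * (norm c + 1)" .
    moreover have "0 < norm c + 1" using norm_ge_zero[of c] by linarith
    ultimately show ?thesis by (simp add: abs_divide pos_divide_le_eq)
  qed
  then have bnd: "norm (w n \<bullet> c / (norm c + 1)) \<le> B" if "c \<in> (\<Union>n. C n)" for n c
    by simp
  have cnt: "countable (\<Union>n. C n)" using fin by (intro countable_UN) (auto intro: countable_finite)
  obtain s :: "nat \<Rightarrow> nat" where s: "strict_mono s"
    and l: "\<And>c. c \<in> (\<Union>n. C n) \<Longrightarrow> \<exists>l. (\<lambda>n. w (s n) \<bullet> c / (norm c + 1)) \<longlonglongrightarrow> l"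
    by (rule function_convergent_subsequence[where
          f = "\<lambda>n c. w n \<bullet> c / (norm c + 1)" and M = B, OF cnt bnd]) (assumption, rule that)
  have "\<exists>l. (\<lambda>n. w (s n) \<bullet> c) \<longlonglongrightarrow> l" if c: "c \<in> (\<Union>n. C n)" for c
  proof -
    obtain l where "(\<lambda>n. w (s n) \<bullet> c / (norm c + 1)) \<longlonglongrightarrow> l" using l[OF c] by blast
    then have "(\<lambda>n. w (s n) \<bullet> c / (norm c + 1) * (norm c + 1)) \<longlonglongrightarrow> l * (norm c + 1)"
      by (intro tendsto_intros)
    moreover have "norm c + 1 \<noteq> 0" using norm_ge_zero[of c] by linarith
    ultimately show ?thesis by auto
  qed
  then obtain l where l: "\<And>c. c \<in> (\<Union>n. C n) \<Longrightarrow> (\<lambda>n. w (s n) \<bullet> c) \<longlonglongrightarrow> l c"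
    by metis
  have "Cauchy (w \<circ> s)"
  proof (rule CauchyI)
    fix e :: real assume e: "0 < e"
    \<comment> \<open>This \<open>n\<close> pushes the gradient contribution below half of
      \<open>e\<^sup>2\<close>; the tolerance \<open>d\<close> below keeps the sum over
      \<open>C n\<close> within a quarter.\<close>
    obtain n where n: "4 * B\<^sup>2 / (e\<^sup>2 / 2) < real n"
      using reals_Archimedean2 by blast
    then have "4 * B\<^sup>2 / (e\<^sup>2 / 2) < real (Suc n)" by simp
    then have n: "1 / real (Suc n) * (2 * B)\<^sup>2 < e\<^sup>2 / 2"
      using e by (simp add: field_simps power2_eq_square)
    define d where "d = e / (2 * (real (card (C n)) + 1))"
    have d: "0 < d" using e by (simp add: d_def)
    have "eventually (\<lambda>i. \<forall>c\<in>C n. dist (w (s i) \<bullet> c) (l c) < d / 2) sequentially"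
      using d by (intro eventually_ball_finite fin ballI tendstoD l) auto
    then obtain N where N: "\<And>i c. i \<ge> N \<Longrightarrow> c \<in> C n \<Longrightarrow> \<bar>w (s i) \<bullet> c - l c\<bar> < d / 2"
      by (auto simp: eventually_sequentially dist_real_def)
    show "\<exists>M. \<forall>i\<ge>M. \<forall>j\<ge>M. norm ((w \<circ> s) i - (w \<circ> s) j) < e"
    proof (intro exI allI impI)
      fix i j assume ij: "N \<le> i" "N \<le> j"
      have "norm (r (s i) - r (s j)) \<le> 2 * B"
        using r[of "s i"] r[of "s j"] norm_triangle_ineq4[of "r (s i)" "r (s j)"] by linarith
      then have 1: "1 / real (Suc n) * (norm (r (s i) - r (s j)))\<^sup>2 \<le> 1 / real (Suc n) * (2 * B)\<^sup>2"
        by (intro mult_left_mono power_mono) auto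
      have "(\<Sum>c\<in>C n. ((w (s i) - w (s j)) \<bullet> c)\<^sup>2) \<le> (\<Sum>c\<in>C n. d\<^sup>2)"
      proof (rule sum_mono)
        fix c assume c: "c \<in> C n"
        have "\<bar>(w (s i) - w (s j)) \<bullet> c\<bar> \<le> d"
          using N[OF ij(1) c] N[OF ij(2) c] unfolding inner_diff_left by linarith
        then show "((w (s i) - w (s j)) \<bullet> c)\<^sup>2 \<le> d\<^sup>2"
          using d abs_le_square_iff[of "(w (s i) - w (s j)) \<bullet> c" d] by simp
      qed
      also have "\<dots> = card (C n) * d\<^sup>2" by simp
      also have "\<dots> \<le> (real (card (C n)) + 1)\<^sup>2 * d\<^sup>2"
        by (intro mult_right_mono) (auto simp: power2_eq_square algebra_simps)
      also have "\<dots> = (e / 2)\<^sup>2"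
      proof -
        have "(real (card (C n)) + 1) * d = e / 2"
          by (simp add: d_def field_simps add_nonneg_eq_0_iff)
        then show ?thesis by (simp only: flip: power_mult_distrib)
      qed
      finally have 2: "(\<Sum>c\<in>C n. ((w (s i) - w (s j)) \<bullet> c)\<^sup>2) \<le> (e / 2)\<^sup>2" .
      have "(norm (w (s i) - w (s j)))\<^sup>2 < e\<^sup>2 / 2 + (e / 2)\<^sup>2"
        using C[OF H_diff[OF z z], of "s i" "s j" n] 1 2 n by linarith
      also have "\<dots> \<le> e\<^sup>2" by (simp add: power2_eq_square)
      finally show "norm ((w \<circ> s) i - (w \<circ> s) j) < e"
        using e by (auto intro: power2_less_imp_less)
    qed
  qed
  with s show ?thesis by (rule that)
qed

text \<open>The direct method: a minimizing sequence has a subsequence converging in the first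
  component. The parallelogram law upgrades this to norm convergence of the second component, so
  closedness of \<open>H\<close> in norm is enough, and the first variation yields the last
  conclusion.\<close>

lemma Rayleigh_minimizer:
  assumes nz: "\<exists>(w, r)\<in>H. w \<noteq> 0"
  obtains w r where "(w, r) \<in> H" "norm w = 1"
    "\<And>w' r'. (w', r') \<in> H \<Longrightarrow> (norm r)\<^sup>2 * (norm w')\<^sup>2 \<le> (norm r')\<^sup>2"
    "\<And>w' r'. (w', r') \<in> H \<Longrightarrow> r \<bullet> r' = (norm r)\<^sup>2 * (w \<bullet> w')"
proof -
  define Q where "Q = {(norm r)\<^sup>2 | w r. (w, r) \<in> H \<and> norm w = 1}"
  define \<nu> where "\<nu> = Inf Q"
  have bdd: "bdd_below Q" by (rule bdd_belowI[of _ 0]) (auto simp: Q_def)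
  obtain w0 r0 where "(w0, r0) \<in> H" "w0 \<noteq> 0" using nz by blast
  then have ne: "Q \<noteq> {}"
    using H_scaleR[of w0 r0 "1 / norm w0"] by (auto simp: Q_def)
  have \<nu>: "\<nu> * (norm w)\<^sup>2 \<le> (norm r)\<^sup>2" if "(w, r) \<in> H" for w r
  proof (cases "w = 0")
    case False
    have "\<nu> \<le> (norm ((1 / norm w) *\<^sub>R r))\<^sup>2"
      unfolding \<nu>_def using H_scaleR[OF that, of "1 / norm w"] False
      unfolding Q_def
      by (intro cInf_lower[OF _ bdd[unfolded Q_def]] CollectI exI[of _ "(1 / norm w) *\<^sub>R w"]
        exI[of _ "(1 / norm w) *\<^sub>R r"]) auto
    then show ?thesis using False by (simp add: power_divide field_simps)
  qed simp
  have \<nu>0: "0 \<le> \<nu>" unfolding \<nu>_def by (rule cInf_greatest[OF ne]) (auto simp: Q_def)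
  have "\<exists>w r. (w, r) \<in> H \<and> norm w = 1 \<and> (norm r)\<^sup>2 < \<nu> + 1 / real (Suc n)" for n
  proof -
    have "Inf Q < \<nu> + 1 / real (Suc n)" by (simp add: \<nu>_def)
    then obtain x where "x \<in> Q" "x < \<nu> + 1 / real (Suc n)"
      using cInf_lessD[OF ne] by blast
    then show ?thesis by (auto simp: Q_def)
  qed
  then obtain w r where H: "\<And>n. (w n, r n) \<in> H" and w1: "\<And>n. norm (w n) = 1"
    and r: "\<And>n. (norm (r n))\<^sup>2 < \<nu> + 1 / real (Suc n)"
    by metis
  have "norm (r n) \<le> \<nu> + 2" for n
  proof (rule power2_le_imp_le)
    have "1 / real (Suc n) \<le> 1" by simp
    then have "(norm (r n))\<^sup>2 \<le> \<nu> + 1" using r[of n] by linarith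
    also have "\<dots> \<le> (\<nu> + 2)\<^sup>2" using \<nu>0 by (simp add: power2_eq_square algebra_simps)
    finally show "(norm (r n))\<^sup>2 \<le> (\<nu> + 2)\<^sup>2" .
  qed (use \<nu>0 in simp)
  then obtain s :: "nat \<Rightarrow> nat" where s: "strict_mono s" and Cw: "Cauchy (w \<circ> s)"
    using bounded_imp_Cauchy_subsequence[of w r "\<nu> + 2", OF H] w1 \<nu>0 by auto
  have rs: "(norm (r (s n)))\<^sup>2 \<le> \<nu> + 1 / real (Suc n)" for n
  proof -
    have "1 / real (Suc (s n)) \<le> 1 / real (Suc n)"
      using seq_suble[OF s, of n] by (intro divide_left_mono) auto
    then show ?thesis using r[of "s n"] by linarith
  qed
  \<comment> \<open>The midpoint cannot beat the infimum: \<open>r (s i) + r (s j)\<close> has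
    square norm at least \<open>\<nu>\<close> times that of \<open>w (s i) + w (s j)\<close>, which
    is nearly 4. The parallelogram law converts this into smallness of the difference.\<close>
  have par: "(norm (r (s i) - r (s j)))\<^sup>2 \<le>
      2 / real (Suc i) + 2 / real (Suc j) + \<nu> * (norm (w (s i) - w (s j)))\<^sup>2" for i j
  proof -
    have pl: "(norm (a - b))\<^sup>2 = 2 * (norm a)\<^sup>2 + 2 * (norm b)\<^sup>2 - (norm (a + b))\<^sup>2" for a b :: "'x::real_inner"
      by (simp add: power2_norm_eq_inner algebra_simps inner_commute)
    have "\<nu> * (norm (w (s i) + w (s j)))\<^sup>2 \<le> (norm (r (s i) + r (s j)))\<^sup>2"
      by (intro \<nu> H_add H)
    moreover have "(norm (w (s i) + w (s j)))\<^sup>2 = 4 - (norm (w (s i) - w (s j)))\<^sup>2"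
      using pl[of "w (s i)" "w (s j)"] by (simp add: w1)
    ultimately have "4 * \<nu> - \<nu> * (norm (w (s i) - w (s j)))\<^sup>2 \<le> (norm (r (s i) + r (s j)))\<^sup>2"
      by (simp add: algebra_simps)
    then show ?thesis using pl[of "r (s i)" "r (s j)"] rs[of i] rs[of j] by simp
  qed
  have "Cauchy (r \<circ> s)"
  proof (rule CauchyI)
    fix e :: real assume e: "0 < e"
    define d where "d = e / (2 * (\<nu> + 1))"
    have d: "0 < d" using e \<nu>0 by (simp add: d_def)
    obtain M where M: "\<And>i j. i \<ge> M \<Longrightarrow> j \<ge> M \<Longrightarrow> norm (w (s i) - w (s j)) < d"
      using CauchyD[OF Cw d] by auto
    obtain n where n: "8 / e\<^sup>2 < real n" using reals_Archimedean2 by blast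
    show "\<exists>M. \<forall>i\<ge>M. \<forall>j\<ge>M. norm ((r \<circ> s) i - (r \<circ> s) j) < e"
    proof (intro exI allI impI)
      fix i j assume ij: "max M n \<le> i" "max M n \<le> j"
      have small: "2 / real (Suc k) < e\<^sup>2 / 4" if "max M n \<le> k" for k
      proof -
        have "8 / e\<^sup>2 < real (Suc k)" using n that by linarith
        then show ?thesis using e by (simp add: field_simps)
      qed
      have "\<nu> * (norm (w (s i) - w (s j)))\<^sup>2 \<le> (\<nu> + 1)\<^sup>2 * d\<^sup>2"
      proof (rule mult_mono)
        show "\<nu> \<le> (\<nu> + 1)\<^sup>2" using \<nu>0 by (simp add: power2_eq_square algebra_simps)
        show "(norm (w (s i) - w (s j)))\<^sup>2 \<le> d\<^sup>2"
          using M[of i j] ij by (intro power_mono) auto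
      qed (use \<nu>0 in auto)
      also have "\<dots> = (e / 2)\<^sup>2"
      proof -
        have "(\<nu> + 1) * d = e / 2" using \<nu>0 by (simp add: d_def field_simps)
        then show ?thesis by (simp only: flip: power_mult_distrib)
      qed
      also have "\<dots> = e\<^sup>2 / 4" by (simp add: power2_eq_square)
      finally have "(norm (r (s i) - r (s j)))\<^sup>2 < e\<^sup>2"
        using par[of i j] small[OF ij(1)] small[OF ij(2)] zero_less_power[OF e, of 2] by linarith
      then show "norm ((r \<circ> s) i - (r \<circ> s) j) < e"
        using e by (auto intro: power2_less_imp_less)
    qed
  qed
  then obtain r' where lim_r: "(r \<circ> s) \<longlonglongrightarrow> r'"
    using Cauchy_convergent convergent_def by blast
  obtain w' where lim_w: "(w \<circ> s) \<longlonglongrightarrow> w'"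
    using Cauchy_convergent[OF Cw] convergent_def by blast
  note lim = lim_w lim_r
  have H': "(w', r') \<in> H"
    using closed_sequentially[OF closed_H _ tendsto_Pair[OF lim]] H by auto
  have w': "norm w' = 1"
    using tendsto_norm[OF lim(1)] w1 by (simp add: LIMSEQ_const_iff o_def)
  have "(norm r')\<^sup>2 \<le> \<nu>"
  proof (rule LIMSEQ_le)
    show "(\<lambda>n. (norm ((r \<circ> s) n))\<^sup>2) \<longlonglongrightarrow> (norm r')\<^sup>2"
      by (intro tendsto_intros lim)
    show "(\<lambda>n. \<nu> + 1 / real (Suc n)) \<longlonglongrightarrow> \<nu>"
      using tendsto_add[OF tendsto_const LIMSEQ_inverse_real_of_nat, of \<nu>]
      by (simp add: inverse_eq_divide)
  qed (use rs in auto)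
  then have r': "(norm r')\<^sup>2 = \<nu>" using \<nu>[OF H'] w' by simp
  show ?thesis
  proof (rule that[OF H' w'])
    fix a b assume ab: "(a, b) \<in> H"
    then show "(norm r')\<^sup>2 * (norm a)\<^sup>2 \<le> (norm b)\<^sup>2"
      using \<nu> r' by simp
    \<comment> \<open>The perturbation of the minimizer in the direction \<open>(a, b)\<close>, with
      the vanishing zeroth order term removed.\<close>
    have "0 \<le> 2 * t * (r' \<bullet> b - \<nu> * (w' \<bullet> a)) + t\<^sup>2 * ((norm b)\<^sup>2 - \<nu> * (norm a)\<^sup>2)" for t
    proof -
      have "\<nu> * (norm (w' + t *\<^sub>R a))\<^sup>2 \<le> (norm (r' + t *\<^sub>R b))\<^sup>2"
        by (intro \<nu> H_add H_scaleR ab H')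
      then have "0 \<le> 2 * t * (r' \<bullet> b - \<nu> * (w' \<bullet> a)) + t\<^sup>2 * ((norm b)\<^sup>2 - \<nu> * (norm a)\<^sup>2)
          + ((norm r')\<^sup>2 - \<nu> * (norm w')\<^sup>2)"
        by (simp add: norm_add_scaleR_square algebra_simps)
      then show ?thesis using r' w' by simp
    qed
    from linear_coefficient_zero[OF this] show "r' \<bullet> b = (norm r')\<^sup>2 * (w' \<bullet> a)"
      using r' by simp
  qed
qed

section \<open>Weak eigenpairs and the Rayleigh principle\<close>

definition eigenpair :: "real \<Rightarrow> 'h \<Rightarrow> 'k \<Rightarrow> bool"
  where "eigenpair \<mu> p q \<longleftrightarrow> (p, q) \<in> H \<and> (\<forall>(w, r)\<in>H. q \<bullet> r = \<mu> * (p \<bullet> w))"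

lemma eigenpairD:
  "eigenpair \<mu> p q \<Longrightarrow> (p, q) \<in> H"
  "eigenpair \<mu> p q \<Longrightarrow> (w, r) \<in> H \<Longrightarrow> q \<bullet> r = \<mu> * (p \<bullet> w)"
  by (auto simp: eigenpair_def)

lemma eigenpair_orthogonal:
  assumes "eigenpair \<mu> p q" "eigenpair \<mu>' p' q'" "\<mu> \<noteq> \<mu>'"
  shows "p \<bullet> p' = 0"
proof -
  have "q \<bullet> q' = \<mu> * (p \<bullet> p')" "q' \<bullet> q = \<mu>' * (p' \<bullet> p)"
    using assms eigenpairD by blast+
  then show ?thesis using assms(3) by (simp add: inner_commute)
qed

text \<open>The orthogonal complement of the \<open>p i\<close> is again a gradient graph and so has
  a minimizer. That minimizer solves the eigenvalue equation on all of \<open>H\<close>, and the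
  assumption on \<open>L\<close> then forbids an eigenvalue below \<open>L\<close>.\<close>

lemma Rayleigh_lower_bound:
  assumes eig: "\<And>i. i \<in> I \<Longrightarrow> eigenpair (ev i) (p i) (q i)" and fin: "finite I"
    and on: "\<And>i j. i \<in> I \<Longrightarrow> j \<in> I \<Longrightarrow> p i \<bullet> p j = (if i = j then 1 else 0)"
    and L: "\<And>\<mu> w r. \<mu> < L \<Longrightarrow> eigenpair \<mu> w r \<Longrightarrow> (\<And>i. i \<in> I \<Longrightarrow> w \<bullet> p i = 0) \<Longrightarrow> w = 0"
    and wr: "(w, r) \<in> H" "\<And>i. i \<in> I \<Longrightarrow> w \<bullet> p i = 0"
  shows "L * (norm w)\<^sup>2 \<le> (norm r)\<^sup>2"
proof (cases "w = 0")
  case False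
  define K where "K = H \<inter> {z. \<forall>i\<in>I. fst z \<bullet> p i = 0}"
  interpret K: gradient_graph K
  proof
    show "subspace K"
      unfolding K_def by (intro subspace_inter subspace_H) (auto simp: subspace_def inner_add_left)
    have "closed {z::'h \<times> 'k. fst z \<bullet> p i = 0}" for i
      by (intro closed_Collect_eq continuous_intros)
    then show "closed K"
      unfolding K_def Collect_ball_eq by (intro closed_Int closed_H closed_INT ballI)
    show "\<exists>C. finite C \<and> (\<forall>(w, r)\<in>K. (norm w)\<^sup>2 \<le> e * (norm r)\<^sup>2 + (\<Sum>c\<in>C. (w \<bullet> c)\<^sup>2))"
      if "0 < e" for e using compact_embedding[OF that] by (auto simp: K_def)
  qed
  have wrK: "(w, r) \<in> K" using wr by (auto simp: K_def)
  then have "\<exists>(w, r)\<in>K. w \<noteq> 0" using False by blast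
  then obtain w0 r0 where wr0: "(w0, r0) \<in> K" "norm w0 = 1"
    and min: "\<And>w' r'. (w', r') \<in> K \<Longrightarrow> (norm r0)\<^sup>2 * (norm w')\<^sup>2 \<le> (norm r')\<^sup>2"
    and EL: "\<And>w' r'. (w', r') \<in> K \<Longrightarrow> r0 \<bullet> r' = (norm r0)\<^sup>2 * (w0 \<bullet> w')"
    using K.Rayleigh_minimizer by metis
  have wr0': "(w0, r0) \<in> H" "\<And>i. i \<in> I \<Longrightarrow> w0 \<bullet> p i = 0"
    using wr0 by (auto simp: K_def)
  \<comment> \<open>An arbitrary pair is projected into \<open>K\<close>. The subtracted terms do
    not contribute, since \<open>w0\<close> is orthogonal to each \<open>p i\<close> and, by the
    equation for \<open>p i\<close>, also \<open>r0\<close> to each \<open>q i\<close>.\<close>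
  have "eigenpair ((norm r0)\<^sup>2) w0 r0"
    unfolding eigenpair_def
  proof (intro conjI ballI; clarify?)
    fix a b assume ab: "(a, b) \<in> H"
    define a' where "a' = a - (\<Sum>i\<in>I. (a \<bullet> p i) *\<^sub>R p i)"
    define b' where "b' = b - (\<Sum>i\<in>I. (a \<bullet> p i) *\<^sub>R q i)"
    have "a' \<bullet> p j = 0" if "j \<in> I" for j
    proof -
      have "(\<Sum>i\<in>I. (a \<bullet> p i) * (p i \<bullet> p j)) = (\<Sum>i\<in>I. if i = j then a \<bullet> p j else 0)"
        using that by (intro sum.cong) (auto simp: on)
      then show ?thesis
        using that fin by (simp add: a'_def inner_diff_left inner_sum_left)
    qed
    then have "(a', b') \<in> K"
      unfolding K_def a'_def b'_def
      using ab by (auto intro!: H_diff H_sum H_scaleR eigenpairD(1)[OF eig])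
    then have "r0 \<bullet> b' = (norm r0)\<^sup>2 * (w0 \<bullet> a')" by (rule EL)
    moreover have "r0 \<bullet> q i = 0" if "i \<in> I" for i
      using eigenpairD(2)[OF eig[OF that] wr0'(1)] wr0'(2)[OF that] by (simp add: inner_commute)
    ultimately show "r0 \<bullet> b = (norm r0)\<^sup>2 * (w0 \<bullet> a)"
      using wr0'(2) by (simp add: a'_def b'_def inner_diff_right inner_sum_right)
  qed (rule wr0')
  then have "L \<le> (norm r0)\<^sup>2" using L[of "(norm r0)\<^sup>2" w0 r0] wr0 wr0'(2) by fastforce
  then have "L * (norm w)\<^sup>2 \<le> (norm r0)\<^sup>2 * (norm w)\<^sup>2" by (intro mult_right_mono) auto
  also have "\<dots> \<le> (norm r)\<^sup>2" by (rule min[OF wrK])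
  finally show ?thesis .
qed simp

end

text \<open>\<open>X\<close> and \<open>Y\<close> are multiplication by a coordinate \<open>x \<bullet> e\<close> with \<open>norm e = 1\<close> on functions and on
  vector fields, \<open>V p = p e\<close>, and \<open>D q = q \<bullet> e\<close> is a directional derivative when \<open>q\<close> is a gradient.\<close>

locale coordinate_multiplication = gradient_graph H
  for H :: "('h::{real_inner,complete_space} \<times> 'k::{real_inner,complete_space}) set" +
  fixes X :: "'h \<Rightarrow> 'h" and Y :: "'k \<Rightarrow> 'k" and V :: "'h \<Rightarrow> 'k" and D :: "'k \<Rightarrow> 'h"
  assumes X_sym: "X p \<bullet> p' = p \<bullet> X p'" and Y_sym: "Y q \<bullet> q' = q \<bullet> Y q'"
    and V_isometry: "V p \<bullet> V p' = p \<bullet> p'" and YV: "Y (V p) = V (X p)"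
    and V_adjoint: "q \<bullet> V p = D q \<bullet> p"
    and H_mult: "(p, q) \<in> H \<Longrightarrow> (X p, Y q + V p) \<in> H"
    and D_skew: "(p, q) \<in> H \<Longrightarrow> (p', q') \<in> H \<Longrightarrow> D q \<bullet> p' = - (p \<bullet> D q')"
begin

lemma V_adjoint': "V p \<bullet> q = D q \<bullet> p"
  using V_adjoint by (simp add: inner_commute)

text \<open>The weak form of -\<Delta> (x p) = \<mu> x p - 2 dp/dx: the Leibniz rule is applied to
  the test pair and one term is integrated by parts.\<close>

lemma commutator:
  assumes "eigenpair \<mu> p q" "(w, r) \<in> H"
  shows "(Y q + V p) \<bullet> r = \<mu> * (X p \<bullet> w) - 2 * (D q \<bullet> w)"
proof -
  have "q \<bullet> (Y r + V w) = \<mu> * (p \<bullet> X w)"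
    using eigenpairD(2)[OF assms(1) H_mult[OF assms(2)]] .
  moreover have "D q \<bullet> w = - (D r \<bullet> p)"
    using D_skew[OF eigenpairD(1)[OF assms(1)] assms(2)] by (simp add: inner_commute[of p])
  moreover have "(Y q + V p) \<bullet> r = q \<bullet> Y r + D r \<bullet> p"
    by (simp only: inner_add_left Y_sym V_adjoint')
  moreover have "q \<bullet> (Y r + V w) = q \<bullet> Y r + D q \<bullet> w"
    by (simp only: inner_add_right V_adjoint)
  ultimately show ?thesis
    by (simp add: X_sym)
qed

text \<open>The commutator [d/dx, x] = 1 in the state \<open>p\<close>. Integration by parts
  reproduces the unknown quantity with the opposite sign, and the equation is solved for it.\<close>

lemma D_X:
  assumes "(p, q) \<in> H"
  shows "- 2 * (D q \<bullet> X p) = (norm p)\<^sup>2"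
proof -
  have "D q \<bullet> X p = - (V p \<bullet> (Y q + V p))"
    using D_skew[OF assms H_mult[OF assms]] by (simp only: V_adjoint' inner_commute[of p "D (Y q + V p)"])
  also have "V p \<bullet> (Y q + V p) = Y (V p) \<bullet> q + V p \<bullet> V p"
    by (simp only: inner_add_right Y_sym)
  also have "\<dots> = D q \<bullet> X p + (norm p)\<^sup>2"
    by (simp only: YV V_adjoint'[of "X p" q] V_isometry power2_norm_eq_inner)
  finally show ?thesis by simp
qed

text \<open>Matrix elements of [-\<Delta>, x] between two eigenfunctions. In particular
  \<open>D q\<close> is orthogonal to \<open>p\<close> itself.\<close>

lemma D_eigenpairs:
  assumes "eigenpair \<mu> p q" "eigenpair \<mu>' p' q'"
  shows "2 * (D q \<bullet> p') = (\<mu> - \<mu>') * (X p \<bullet> p')"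
proof -
  have "q' \<bullet> (Y q + V p) = \<mu>' * (p' \<bullet> X p)"
    using eigenpairD(2)[OF assms(2) H_mult[OF eigenpairD(1)[OF assms(1)]]] .
  then show ?thesis
    using commutator[OF assms(1) eigenpairD(1)[OF assms(2)]]
    by (simp add: inner_commute algebra_simps)
qed

text \<open>For the trial function \<phi> = x p minus its component along \<open>p\<close>, the
  commutator gives energy \<mu> times the square norm, plus exactly 1, so
  \<open>(L - \<mu>) * (norm \<phi>)\<^sup>2 \<le> 1\<close>. On the other hand 1 is
  \<open>- 2 * (D q \<bullet> \<phi>)\<close>, and Cauchy-Schwarz eliminates the norm of \<phi>.
  Since \<open>L\<close> has to bound the quotient of this single function only, it may be a high
  eigenvalue if the axis is chosen well.\<close>

lemma first_gap_bound:
  assumes eig: "eigenpair \<mu> p q" and p: "norm p = 1"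
    and L: "\<And>c r. (X p - (X p \<bullet> p) *\<^sub>R p, r) \<in> H \<Longrightarrow>
      L * (norm (X p - (X p \<bullet> p) *\<^sub>R p))\<^sup>2 \<le> (norm r)\<^sup>2"
  shows "L - \<mu> \<le> 4 * (norm (D q))\<^sup>2"
proof (cases "\<mu> < L")
  case True
  define c where "c = X p \<bullet> p"
  define \<phi> where "\<phi> = X p - c *\<^sub>R p"
  define g where "g = Y q + V p - c *\<^sub>R q"
  have pq: "(p, q) \<in> H" using eig by (rule eigenpairD)
  have pp: "p \<bullet> p = 1" using p by (simp add: norm_eq_1)
  have H: "(\<phi>, g) \<in> H" unfolding \<phi>_def g_def by (intro H_diff H_mult H_scaleR pq)
  have p\<phi>: "p \<bullet> \<phi> = 0" by (simp add: \<phi>_def inner_diff_right pp c_def inner_commute)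
  have Dp: "D q \<bullet> p = 0" using D_eigenpairs[OF eig eig] by simp
  have D\<phi>: "- 2 * (D q \<bullet> \<phi>) = 1"
    using D_X[OF pq] p by (simp add: \<phi>_def inner_diff_right Dp)
  have "g \<bullet> g = (Y q + V p) \<bullet> g - c * (q \<bullet> g)"
    by (subst (1) g_def) (simp add: inner_diff_left)
  also have "\<dots> = \<mu> * (X p \<bullet> \<phi>) + 1"
    using commutator[OF eig H] eigenpairD(2)[OF eig H] p\<phi> D\<phi> by simp
  also have "X p \<bullet> \<phi> = \<phi> \<bullet> \<phi>"
  proof -
    have "\<phi> \<bullet> \<phi> = X p \<bullet> \<phi> - c * (p \<bullet> \<phi>)"
      by (subst (1) \<phi>_def) (simp add: inner_diff_left)
    then show ?thesis using p\<phi> by simp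
  qed
  finally have "L * (norm \<phi>)\<^sup>2 \<le> \<mu> * (norm \<phi>)\<^sup>2 + 1"
    using L[folded c_def, folded \<phi>_def, OF H] by (simp add: power2_norm_eq_inner)
  then have gap: "(L - \<mu>) * (norm \<phi>)\<^sup>2 \<le> 1" by (simp add: algebra_simps)
  have "1 = (2 * (D q \<bullet> \<phi>))\<^sup>2"
  proof -
    have "D q \<bullet> \<phi> = - 1 / 2" using D\<phi> by simp
    then show ?thesis by simp
  qed
  also have "\<dots> \<le> 4 * ((norm (D q))\<^sup>2 * (norm \<phi>)\<^sup>2)"
    using Cauchy_Schwarz_ineq[of "D q" \<phi>] by (simp add: power2_norm_eq_inner power_mult_distrib)
  finally have "(L - \<mu>) * 1 \<le> (L - \<mu>) * (4 * ((norm (D q))\<^sup>2 * (norm \<phi>)\<^sup>2))"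
    using True by (intro mult_left_mono) auto
  also have "\<dots> = ((L - \<mu>) * (norm \<phi>)\<^sup>2) * (4 * (norm (D q))\<^sup>2)" by simp
  also have "\<dots> \<le> 1 * (4 * (norm (D q))\<^sup>2)" by (intro mult_right_mono gap) auto
  finally show ?thesis by simp
next
  case False
  then have "L - \<mu> \<le> 0" by simp
  also have "0 \<le> 4 * (norm (D q))\<^sup>2" by simp
  finally show ?thesis .
qed

text \<open>Each \<open>p i\<close> gives a trial function \<open>\<phi> i\<close>, the part of x
  times \<open>p i\<close> orthogonal to all the \<open>p j\<close>. Its gap estimate is weighted
  with \<open>z - ev i\<close> and summed; with these weights the double sums over the coordinate
  matrix elements \<open>A i j\<close> cancel exactly.\<close>

lemma Yang_inequality:
  assumes eig: "\<And>i. i \<in> I \<Longrightarrow> eigenpair (ev i) (p i) (q i)" and fin: "finite I"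
    and on: "\<And>i j. i \<in> I \<Longrightarrow> j \<in> I \<Longrightarrow> p i \<bullet> p j = (if i = j then 1 else 0)"
    and z: "\<And>i. i \<in> I \<Longrightarrow> ev i \<le> z"
    and L: "\<And>w r. (w, r) \<in> H \<Longrightarrow> (\<And>i. i \<in> I \<Longrightarrow> w \<bullet> p i = 0) \<Longrightarrow> z * (norm w)\<^sup>2 \<le> (norm r)\<^sup>2"
  shows "(\<Sum>i\<in>I. (z - ev i)\<^sup>2) \<le> 4 * (\<Sum>i\<in>I. (z - ev i) * (norm (D (q i)))\<^sup>2)"
proof -
  define A where "A i j = X (p i) \<bullet> p j" for i j
  define B where "B i j = D (q i) \<bullet> p j" for i j
  define \<phi> where "\<phi> i = X (p i) - (\<Sum>j\<in>I. A i j *\<^sub>R p j)" for i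
  define g where "g i = Y (q i) + V (p i) - (\<Sum>j\<in>I. A i j *\<^sub>R q j)" for i
  \<comment> \<open>As \<open>\<phi> i\<close> is orthogonal to the \<open>p j\<close>, only this
    part of the derivative pairs with it. Using it in Cauchy-Schwarz gains the term with the
    \<open>B i j\<close>, without which the double sums would not cancel.\<close>
  define \<psi> where "\<psi> i = D (q i) - (\<Sum>j\<in>I. B i j *\<^sub>R p j)" for i
  \<comment> \<open>\<open>W i\<close> is the excess of the energy of \<open>\<phi> i\<close> over
    \<open>ev i\<close> times its square norm, and also
    \<open>- 2 * (D (q i) \<bullet> \<phi> i)\<close>.\<close>
  define W where "W i = 1 + (\<Sum>j\<in>I. (ev i - ev j) * (A i j)\<^sup>2)" for i
  have A_sym: "A i j = A j i" for i j
    by (metis A_def X_sym inner_commute)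
  have AB: "2 * B i j = (ev i - ev j) * A i j" if "i \<in> I" "j \<in> I" for i j
    unfolding A_def B_def using D_eigenpairs[OF eig[OF that(1)] eig[OF that(2)]] .
  have pH: "(p i, q i) \<in> H" if "i \<in> I" for i
    using eig[OF that] by (rule eigenpairD)
  have ortho: "(x - (\<Sum>j\<in>I. (x \<bullet> p j) *\<^sub>R p j)) \<bullet> p j = 0" if "j \<in> I" for x j
  proof -
    have "(\<Sum>i\<in>I. (x \<bullet> p i) * (p i \<bullet> p j)) = (\<Sum>i\<in>I. if i = j then x \<bullet> p j else 0)"
      using that by (intro sum.cong) (auto simp: on)
    then show ?thesis
      using that fin by (simp add: inner_diff_left inner_sum_left)
  qed
  have \<phi>p: "\<phi> i \<bullet> p j = 0" if "j \<in> I" for i j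
    unfolding \<phi>_def A_def using that by (rule ortho)
  have \<psi>p: "\<psi> i \<bullet> p j = 0" if "j \<in> I" for i j
    unfolding \<psi>_def B_def using that by (rule ortho)
  have key: "(z - ev i) * W i \<le> 4 * ((norm (D (q i)))\<^sup>2 - (\<Sum>j\<in>I. (B i j)\<^sup>2))" if i: "i \<in> I" for i
  proof -
    have H: "(\<phi> i, g i) \<in> H"
      unfolding \<phi>_def g_def by (intro H_diff H_mult H_sum H_scaleR pH i)
    have W: "- 2 * (D (q i) \<bullet> \<phi> i) = W i"
    proof -
      have "- 2 * (D (q i) \<bullet> \<phi> i) = 1 + (\<Sum>j\<in>I. A i j * (2 * B i j))"
        using D_X[OF pH[OF i]] on[OF i i]
        by (simp add: \<phi>_def inner_diff_right inner_sum_right B_def norm_eq_1 sum_distrib_left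
          power2_norm_eq_inner mult.left_commute)
      also have "(\<Sum>j\<in>I. A i j * (2 * B i j)) = (\<Sum>j\<in>I. (ev i - ev j) * (A i j)\<^sup>2)"
        using AB[OF i] by (intro sum.cong) (auto simp: power2_eq_square)
      finally show ?thesis by (simp add: W_def)
    qed
    have X\<phi>: "X (p i) \<bullet> \<phi> i = \<phi> i \<bullet> \<phi> i"
    proof -
      have "\<phi> i \<bullet> \<phi> i = X (p i) \<bullet> \<phi> i - (\<Sum>j\<in>I. A i j * (p j \<bullet> \<phi> i))"
        by (subst (1) \<phi>_def) (simp add: inner_diff_left inner_sum_left)
      then show ?thesis using \<phi>p by (simp add: inner_commute)
    qed
    have "g i \<bullet> g i = (Y (q i) + V (p i)) \<bullet> g i - (\<Sum>j\<in>I. A i j * (q j \<bullet> g i))"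
      by (subst (1) g_def) (simp add: inner_diff_left inner_sum_left)
    also have "(\<Sum>j\<in>I. A i j * (q j \<bullet> g i)) = 0"
      using eigenpairD(2)[OF eig H] \<phi>p by (intro sum.neutral) (auto simp: inner_commute)
    also have "(Y (q i) + V (p i)) \<bullet> g i = ev i * (\<phi> i \<bullet> \<phi> i) + W i"
      using commutator[OF eig[OF i] H] W X\<phi> by simp
    finally have "z * (norm (\<phi> i))\<^sup>2 \<le> ev i * (norm (\<phi> i))\<^sup>2 + W i"
      using L[OF H \<phi>p] by (simp add: power2_norm_eq_inner)
    then have gap: "(z - ev i) * (norm (\<phi> i))\<^sup>2 \<le> W i" by (simp add: algebra_simps)
    have W0: "0 \<le> W i"
      using gap z[OF i] by (smt (verit) mult_nonneg_nonneg zero_le_power2)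
    have \<psi>\<psi>: "(norm (\<psi> i))\<^sup>2 = (norm (D (q i)))\<^sup>2 - (\<Sum>j\<in>I. (B i j)\<^sup>2)"
    proof -
      have Bp: "p j \<bullet> D (q i) = B i j" for j by (simp add: B_def inner_commute)
      have "\<psi> i \<bullet> \<psi> i = \<psi> i \<bullet> D (q i) - (\<Sum>j\<in>I. B i j * (\<psi> i \<bullet> p j))"
        by (subst (2) \<psi>_def) (simp add: inner_diff_right inner_sum_right)
      also have "\<dots> = \<psi> i \<bullet> D (q i)" using \<psi>p by simp
      also have "\<dots> = D (q i) \<bullet> D (q i) - (\<Sum>j\<in>I. (B i j)\<^sup>2)"
        using Bp by (simp add: \<psi>_def inner_diff_left inner_sum_left power2_eq_square)
      finally show ?thesis by (simp add: power2_norm_eq_inner)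
    qed
    have "D (q i) \<bullet> \<phi> i = \<psi> i \<bullet> \<phi> i"
      using \<phi>p by (simp add: \<psi>_def inner_diff_left inner_sum_left inner_commute[of "p _" "\<phi> i"])
    then have "W i = - 2 * (\<psi> i \<bullet> \<phi> i)" using W by simp
    then have "(W i)\<^sup>2 = 4 * (\<psi> i \<bullet> \<phi> i)\<^sup>2" by (simp add: power_mult_distrib)
    also have "\<dots> \<le> 4 * ((norm (\<psi> i))\<^sup>2 * (norm (\<phi> i))\<^sup>2)"
      using Cauchy_Schwarz_ineq[of "\<psi> i" "\<phi> i"] by (simp add: power2_norm_eq_inner)
    finally have "(z - ev i) * (W i)\<^sup>2 \<le> (z - ev i) * (4 * ((norm (\<psi> i))\<^sup>2 * (norm (\<phi> i))\<^sup>2))"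
      using z[OF i] by (intro mult_left_mono) auto
    also have "\<dots> = (z - ev i) * (norm (\<phi> i))\<^sup>2 * (4 * (norm (\<psi> i))\<^sup>2)" by simp
    also have "\<dots> \<le> W i * (4 * (norm (\<psi> i))\<^sup>2)"
      by (intro mult_right_mono gap) auto
    finally have "W i * ((z - ev i) * W i) \<le> W i * (4 * (norm (\<psi> i))\<^sup>2)"
      by (simp add: power2_eq_square algebra_simps)
    \<comment> \<open>Division by \<open>W i\<close>; if it vanishes, the claim is trivial.\<close>
    then have "(z - ev i) * W i \<le> 4 * (norm (\<psi> i))\<^sup>2"
      using W0 by (cases "W i = 0") auto
    then show ?thesis by (simp add: \<psi>\<psi>)
  qed
  define S where "S = (\<Sum>i\<in>I. \<Sum>j\<in>I. (z - ev i) * (ev i - ev j)\<^sup>2 * (A i j)\<^sup>2)"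
  have "(\<Sum>i\<in>I. (z - ev i) * ((z - ev i) * W i)) \<le>
      (\<Sum>i\<in>I. (z - ev i) * (4 * ((norm (D (q i)))\<^sup>2 - (\<Sum>j\<in>I. (B i j)\<^sup>2))))"
    using key z by (intro sum_mono mult_left_mono) auto
  moreover have "(\<Sum>i\<in>I. (z - ev i) * ((z - ev i) * W i)) = (\<Sum>i\<in>I. (z - ev i)\<^sup>2) +
      (\<Sum>i\<in>I. \<Sum>j\<in>I. (z - ev i)\<^sup>2 * (ev i - ev j) * (A i j)\<^sup>2)"
  proof -
    have "(z - ev i) * ((z - ev i) * W i) =
        (z - ev i)\<^sup>2 + (\<Sum>j\<in>I. (z - ev i)\<^sup>2 * (ev i - ev j) * (A i j)\<^sup>2)" for i
      by (simp add: W_def power2_eq_square distrib_left sum_distrib_left mult.assoc)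
    then show ?thesis by (simp add: sum.distrib)
  qed
  moreover have "(\<Sum>i\<in>I. (z - ev i) * (4 * ((norm (D (q i)))\<^sup>2 - (\<Sum>j\<in>I. (B i j)\<^sup>2)))) =
      4 * (\<Sum>i\<in>I. (z - ev i) * (norm (D (q i)))\<^sup>2) - S"
  proof -
    have "(z - ev i) * (4 * (\<Sum>j\<in>I. (B i j)\<^sup>2)) = (\<Sum>j\<in>I. (z - ev i) * (ev i - ev j)\<^sup>2 * (A i j)\<^sup>2)"
      if "i \<in> I" for i
    proof -
      have "4 * (\<Sum>j\<in>I. (B i j)\<^sup>2) = (\<Sum>j\<in>I. (2 * B i j)\<^sup>2)"
        by (simp add: sum_distrib_left power_mult_distrib)
      also have "\<dots> = (\<Sum>j\<in>I. (ev i - ev j)\<^sup>2 * (A i j)\<^sup>2)"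
        using AB[OF that] by (intro sum.cong) (auto simp: power_mult_distrib)
      finally show ?thesis by (simp add: sum_distrib_left mult.assoc)
    qed
    then show ?thesis
      unfolding S_def by (simp add: right_diff_distrib sum_subtractf sum_distrib_left mult.left_commute)
  qed
  \<comment> \<open>\<open>A\<close> is symmetric, so both sums may be symmetrised in
    \<open>i\<close> and \<open>j\<close>. With a = \<open>z - ev i\<close> and b =
    \<open>z - ev j\<close>, the summands cancel because (a^2 - b^2) (b - a) = - (a + b) (a -
    b)^2.\<close>
  moreover have "(\<Sum>i\<in>I. \<Sum>j\<in>I. (z - ev i)\<^sup>2 * (ev i - ev j) * (A i j)\<^sup>2) = - S"
  proof -
    define T where "T = (\<Sum>i\<in>I. \<Sum>j\<in>I. (z - ev i)\<^sup>2 * (ev i - ev j) * (A i j)\<^sup>2)"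
    have T': "T = (\<Sum>i\<in>I. \<Sum>j\<in>I. (z - ev j)\<^sup>2 * (ev j - ev i) * (A i j)\<^sup>2)"
      unfolding T_def by (subst sum.swap) (simp add: A_sym)
    have S': "S = (\<Sum>i\<in>I. \<Sum>j\<in>I. (z - ev j) * (ev i - ev j)\<^sup>2 * (A i j)\<^sup>2)"
      unfolding S_def by (subst sum.swap) (simp add: A_sym power2_commute[of "ev _" "ev _"])
    have "T + T + (S + S) = 0"
    proof -
      have "T + T + (S + S) = (\<Sum>i\<in>I. \<Sum>j\<in>I.
        (z - ev i)\<^sup>2 * (ev i - ev j) * (A i j)\<^sup>2 + (z - ev j)\<^sup>2 * (ev j - ev i) * (A i j)\<^sup>2
        + ((z - ev i) * (ev i - ev j)\<^sup>2 * (A i j)\<^sup>2 + (z - ev j) * (ev i - ev j)\<^sup>2 * (A i j)\<^sup>2))"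
        unfolding sum.distrib T'[symmetric] S'[symmetric] T_def[symmetric] S_def[symmetric] ..
      also have "\<dots> = 0"
        by (intro sum.neutral ballI) (simp add: power2_eq_square algebra_simps)
      finally show ?thesis .
    qed
    then show ?thesis by (simp add: T_def)
  qed
  ultimately show ?thesis by linarith
qed

end

section \<open>The Hilbert space of square integrable functions\<close>

definition square_integrable :: "('a::euclidean_space \<Rightarrow> 'b::euclidean_space) \<Rightarrow> bool"
  where "square_integrable f \<longleftrightarrow>
    f \<in> borel_measurable lebesgue \<and> integrable lebesgue (\<lambda>x. (norm (f x))\<^sup>2)"

lemma square_integrable_bound:
  assumes "g \<in> borel_measurable lebesgue" "square_integrable f"
    and "AE x in lebesgue. norm (g x) \<le> C * norm (f x)"
  shows "square_integrable g"
proof -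
  have "integrable lebesgue (\<lambda>x. C\<^sup>2 * (norm (f x))\<^sup>2)"
    using assms(2) by (auto simp: square_integrable_def)
  then have "integrable lebesgue (\<lambda>x. (norm (g x))\<^sup>2)"
  proof (rule Bochner_Integration.integrable_bound)
    show "AE x in lebesgue. norm ((norm (g x))\<^sup>2) \<le> norm (C\<^sup>2 * (norm (f x))\<^sup>2)"
      using assms(3)
      by eventually_elim (auto simp flip: power_mult_distrib intro!: power_mono)
  qed (use assms in measurable)
  then show ?thesis using assms by (simp add: square_integrable_def)
qed

lemma square_integrable_zero [simp]: "square_integrable (\<lambda>x. 0)"
  by (simp add: square_integrable_def)

lemma square_integrable_scaleR:
  assumes "square_integrable f" shows "square_integrable (\<lambda>x. c *\<^sub>R f x)"
  using assms by (auto simp: square_integrable_def power_mult_distrib)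

lemma square_integrable_add:
  assumes "square_integrable f" "square_integrable g"
  shows "square_integrable (\<lambda>x. f x + g x)"
proof -
  have "integrable lebesgue (\<lambda>x. 2 * (norm (f x))\<^sup>2 + 2 * (norm (g x))\<^sup>2)"
    using assms by (auto simp: square_integrable_def)
  then have "integrable lebesgue (\<lambda>x. (norm (f x + g x))\<^sup>2)"
  proof (rule Bochner_Integration.integrable_bound)
    have "(norm (f x + g x))\<^sup>2 \<le> 2 * (norm (f x))\<^sup>2 + 2 * (norm (g x))\<^sup>2" for x
    proof -
      have "(norm (f x + g x))\<^sup>2 \<le> (norm (f x) + norm (g x))\<^sup>2"
        by (simp add: norm_triangle_ineq power_mono)
      then show ?thesis
        using sum_squares_bound[of "norm (f x)" "norm (g x)"] by (simp add: power2_sum)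
    qed
    then show "AE x in lebesgue. norm ((norm (f x + g x))\<^sup>2) \<le> norm (2 * (norm (f x))\<^sup>2 + 2 * (norm (g x))\<^sup>2)"
      by auto
  qed (use assms in \<open>auto simp: square_integrable_def\<close>)
  then show ?thesis using assms by (auto simp: square_integrable_def)
qed

lemma square_integrable_uminus:
  "square_integrable f \<Longrightarrow> square_integrable (\<lambda>x. - f x)"
  using square_integrable_scaleR[of f "-1"] by simp

lemma square_integrable_diff:
  "square_integrable f \<Longrightarrow> square_integrable g \<Longrightarrow> square_integrable (\<lambda>x. f x - g x)"
  using square_integrable_add[of f "\<lambda>x. - g x"] by (simp add: square_integrable_uminus)

lemma square_integrable_inner:
  assumes "square_integrable f" "square_integrable g"
  shows "integrable lebesgue (\<lambda>x. f x \<bullet> g x)"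
proof -
  have "integrable lebesgue (\<lambda>x. (norm (f x))\<^sup>2 + (norm (g x))\<^sup>2)"
    using assms by (auto simp: square_integrable_def)
  then show ?thesis
  proof (rule Bochner_Integration.integrable_bound)
    have "\<bar>f x \<bullet> g x\<bar> \<le> (norm (f x))\<^sup>2 + (norm (g x))\<^sup>2" for x
      using Cauchy_Schwarz_ineq2[of "f x" "g x"] sum_squares_bound[of "norm (f x)" "norm (g x)"]
        mult_nonneg_nonneg[of "norm (f x)" "norm (g x)"] norm_ge_zero[of "f x"] norm_ge_zero[of "g x"]
      by linarith
    then show "AE x in lebesgue. norm (f x \<bullet> g x) \<le> norm ((norm (f x))\<^sup>2 + (norm (g x))\<^sup>2)"
      by auto
  qed (use assms in \<open>auto simp: square_integrable_def\<close>)
qed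

\<comment> \<open>A type cannot depend on \<Omega>, so the classes consist of functions on the whole
  space, and functions on \<Omega> enter through extension by zero. The relation is partial: it is
  reflexive exactly on the square integrable functions.\<close>
quotient_type (overloaded) ('a, 'b) l2 = "'a::euclidean_space \<Rightarrow> 'b::euclidean_space" /
  partial: "\<lambda>f g. square_integrable f \<and> square_integrable g \<and> (AE x in lebesgue. f x = g x)"
proof (rule part_equivpI)
  show "\<exists>f::'a \<Rightarrow> 'b. square_integrable f \<and> square_integrable f \<and> (AE x in lebesgue. f x = f x)"
    by (intro exI[of _ "\<lambda>x. 0"]) auto
  show "symp (\<lambda>(f::'a \<Rightarrow> 'b) g. square_integrable f \<and> square_integrable g \<and> (AE x in lebesgue. f x = g x))"
    by (auto intro!: sympI elim: eventually_mono)
  show "transp (\<lambda>(f::'a \<Rightarrow> 'b) g. square_integrable f \<and> square_integrable g \<and> (AE x in lebesgue. f x = g x))"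
    by (intro transpI) (auto elim: eventually_elim2)
qed

instantiation l2 :: (euclidean_space, euclidean_space) real_vector
begin

lift_definition zero_l2 :: "('a, 'b) l2" is "\<lambda>x. 0" by simp

lift_definition plus_l2 :: "('a, 'b) l2 \<Rightarrow> ('a, 'b) l2 \<Rightarrow> ('a, 'b) l2"
  is "\<lambda>f g x. f x + g x"
  by (auto intro: square_integrable_add elim: eventually_elim2)

lift_definition scaleR_l2 :: "real \<Rightarrow> ('a, 'b) l2 \<Rightarrow> ('a, 'b) l2"
  is "\<lambda>c f x. c *\<^sub>R f x"
  by (auto intro: square_integrable_scaleR elim: eventually_mono)

lift_definition uminus_l2 :: "('a, 'b) l2 \<Rightarrow> ('a, 'b) l2"
  is "\<lambda>f x. - f x"
  by (auto intro: square_integrable_uminus elim: eventually_mono)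

lift_definition minus_l2 :: "('a, 'b) l2 \<Rightarrow> ('a, 'b) l2 \<Rightarrow> ('a, 'b) l2"
  is "\<lambda>f g x. f x - g x"
  by (auto intro: square_integrable_diff elim: eventually_elim2)

instance
proof
  fix a b c :: "('a, 'b) l2" and r s :: real
  show "a + b + c = a + (b + c)"
    by transfer (auto intro!: square_integrable_add simp: add_ac)
  show "a + b = b + a"
    by transfer (auto intro!: square_integrable_add simp: add_ac)
  show "0 + a = a"
    by transfer auto
  show "- a + a = 0"
    by transfer (auto intro!: square_integrable_add square_integrable_uminus)
  show "a - b = a + - b"
    by transfer (auto intro!: square_integrable_diff square_integrable_add square_integrable_uminus)
  show "r *\<^sub>R (a + b) = r *\<^sub>R a + r *\<^sub>R b"
    by transfer (auto intro!: square_integrable_add square_integrable_scaleR simp: algebra_simps)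
  show "(r + s) *\<^sub>R a = r *\<^sub>R a + s *\<^sub>R a"
    by transfer (auto intro!: square_integrable_add square_integrable_scaleR simp: algebra_simps)
  show "r *\<^sub>R s *\<^sub>R a = (r * s) *\<^sub>R a"
    by transfer (auto intro!: square_integrable_scaleR)
  show "1 *\<^sub>R a = a"
    by transfer auto
qed

end

instantiation l2 :: (euclidean_space, euclidean_space) real_inner
begin

lift_definition inner_l2 :: "('a, 'b) l2 \<Rightarrow> ('a, 'b) l2 \<Rightarrow> real"
  is "\<lambda>f g. LINT x|lebesgue. f x \<bullet> g x"
proof -
  fix f f' g g' :: "'a \<Rightarrow> 'b"
  assume "square_integrable f \<and> square_integrable f' \<and> (AE x in lebesgue. f x = f' x)"
   "square_integrable g \<and> square_integrable g' \<and> (AE x in lebesgue. g x = g' x)"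
  then show "(LINT x|lebesgue. f x \<bullet> g x) = (LINT x|lebesgue. f' x \<bullet> g' x)"
    by (intro integral_cong_AE) (auto simp: square_integrable_def elim: eventually_elim2)
qed

definition norm_l2 :: "('a, 'b) l2 \<Rightarrow> real" where "norm_l2 f = sqrt (f \<bullet> f)"
definition sgn_l2 :: "('a, 'b) l2 \<Rightarrow> ('a, 'b) l2" where "sgn_l2 f = f /\<^sub>R norm f"
definition dist_l2 :: "('a, 'b) l2 \<Rightarrow> ('a, 'b) l2 \<Rightarrow> real" where "dist_l2 f g = norm (f - g)"
definition uniformity_l2 :: "(('a, 'b) l2 \<times> ('a, 'b) l2) filter" where
  "uniformity_l2 = (INF e\<in>{0 <..}. principal {(x, y). dist x y < e})"
definition open_l2 :: "('a, 'b) l2 set \<Rightarrow> bool" where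
  "open_l2 U = (\<forall>x\<in>U. eventually (\<lambda>(x', y). x' = x \<longrightarrow> y \<in> U) uniformity)"

instance
proof
  fix a b c :: "('a, 'b) l2" and r :: real and U :: "('a, 'b) l2 set"
  show "dist a b = norm (a - b)" by (simp add: dist_l2_def)
  show "sgn a = a /\<^sub>R norm a" by (simp add: sgn_l2_def)
  show "(uniformity :: (('a, 'b) l2 \<times> ('a, 'b) l2) filter) = (INF e\<in>{0 <..}. principal {(x, y). dist x y < e})"
    by (simp add: uniformity_l2_def)
  show "open U = (\<forall>x\<in>U. eventually (\<lambda>(x', y). x' = x \<longrightarrow> y \<in> U) uniformity)"
    by (simp add: open_l2_def)
  show "a \<bullet> b = b \<bullet> a"
    by transfer (auto simp: inner_commute)
  show "(a + b) \<bullet> c = a \<bullet> c + b \<bullet> c"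
    by transfer (auto simp: inner_add_left square_integrable_inner)
  show "(r *\<^sub>R a) \<bullet> b = r * (a \<bullet> b)"
    by transfer auto
  show "0 \<le> a \<bullet> a"
    by transfer auto
  show "a \<bullet> a = 0 \<longleftrightarrow> a = 0"
  proof transfer
    fix f :: "'a \<Rightarrow> 'b"
    assume f: "square_integrable f \<and> square_integrable f \<and> (AE x in lebesgue. f x = f x)"
    then have "(LINT x|lebesgue. f x \<bullet> f x) = 0 \<longleftrightarrow> (AE x in lebesgue. f x \<bullet> f x = 0)"
      by (intro integral_nonneg_eq_0_iff_AE square_integrable_inner) auto
    with f show "(LINT x|lebesgue. f x \<bullet> f x) = 0 \<longleftrightarrow>
      square_integrable f \<and> square_integrable (\<lambda>x. 0::'b) \<and> (AE x in lebesgue. f x = 0)"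
      by auto
  qed
  show "norm a = sqrt (a \<bullet> a)" by (simp add: norm_l2_def)
qed

end


lemma square_integrable_rep [simp]: "square_integrable (rep_l2 p)"
  using Quotient3_rep_reflp[OF Quotient3_l2, of p] by simp

lemma abs_rep_l2 [simp]: "abs_l2 (rep_l2 p) = p"
  by (rule Quotient3_abs_rep[OF Quotient3_l2])

lemma abs_l2_eq_iff:
  assumes "square_integrable f" "square_integrable g"
  shows "abs_l2 f = abs_l2 g \<longleftrightarrow> (AE x in lebesgue. f x = g x)"
  using Quotient3_rel[OF Quotient3_l2, of f g] assms by auto

lemma rep_abs_l2:
  assumes "square_integrable f"
  shows "AE x in lebesgue. rep_l2 (abs_l2 f) x = f x"
  using abs_l2_eq_iff[of "rep_l2 (abs_l2 f)" f] assms by simp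

lemma l2_cases [cases type: l2]:
  obtains f where "square_integrable f" "p = abs_l2 f"
  by (metis abs_rep_l2 square_integrable_rep)

lemma inner_abs_l2:
  "square_integrable f \<Longrightarrow> square_integrable g \<Longrightarrow>
    abs_l2 f \<bullet> abs_l2 g = (LINT x|lebesgue. f x \<bullet> g x)"
  by (intro inner_l2.abs_eq) auto

lemma norm_abs_l2:
  "square_integrable f \<Longrightarrow> (norm (abs_l2 f))\<^sup>2 = (LINT x|lebesgue. (norm (f x))\<^sup>2)"
  by (simp add: power2_norm_eq_inner inner_abs_l2)

lemma abs_l2_add:
  "square_integrable f \<Longrightarrow> square_integrable g \<Longrightarrow> abs_l2 f + abs_l2 g = abs_l2 (\<lambda>x. f x + g x)"
  by (intro plus_l2.abs_eq) auto

lemma abs_l2_diff: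
  "square_integrable f \<Longrightarrow> square_integrable g \<Longrightarrow> abs_l2 f - abs_l2 g = abs_l2 (\<lambda>x. f x - g x)"
  by (intro minus_l2.abs_eq) auto

lemma abs_l2_scaleR:
  "square_integrable f \<Longrightarrow> c *\<^sub>R abs_l2 f = abs_l2 (\<lambda>x. c *\<^sub>R f x)"
  by (intro scaleR_l2.abs_eq) auto

lemma abs_l2_zero: "abs_l2 (\<lambda>x. 0) = 0"
  by (simp add: zero_l2_def)

lemma abs_l2_sum:
  assumes "\<And>i. i \<in> I \<Longrightarrow> square_integrable (f i)"
  shows "square_integrable (\<lambda>x. \<Sum>i\<in>I. f i x) \<and> (\<Sum>i\<in>I. abs_l2 (f i)) = abs_l2 (\<lambda>x. \<Sum>i\<in>I. f i x)"
  using assms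
  by (induction I rule: infinite_finite_induct)
     (auto simp: abs_l2_zero abs_l2_add square_integrable_add)

text \<open>A geometric rate makes the increments summable at almost every point; the pointwise
  limit is then identified as the norm limit by Fatou's lemma.\<close>

lemma l2_Riesz_Fischer:
  fixes X :: "nat \<Rightarrow> ('a::euclidean_space, 'b::euclidean_space) l2"
  assumes dX: "\<And>m n. n \<le> m \<Longrightarrow> norm (X m - X n) \<le> (1/2) ^ n"
  shows "convergent X"
proof -
  define f where "f n = rep_l2 (X n)" for n
  have sq: "square_integrable (f n)" and Xf: "X n = abs_l2 (f n)" for n
    by (auto simp: f_def)
  have [measurable]: "f n \<in> borel_measurable lebesgue" for n
    using sq[of n] by (simp add: square_integrable_def)
  have nX: "(\<integral>\<^sup>+x. ennreal ((norm (f m x - f n x))\<^sup>2) \<partial>lebesgue) \<le> ennreal (((1/2) ^ n)\<^sup>2)"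
    if "n \<le> m" for m n
  proof -
    have "(\<integral>\<^sup>+x. ennreal ((norm (f m x - f n x))\<^sup>2) \<partial>lebesgue) = ennreal ((norm (X m - X n))\<^sup>2)"
      unfolding Xf abs_l2_diff[OF sq sq] norm_abs_l2[OF square_integrable_diff[OF sq sq]]
      using square_integrable_diff[OF sq sq, of m n]
      by (intro nn_integral_eq_integral) (auto simp: square_integrable_def)
    also have "\<dots> \<le> ennreal (((1/2) ^ n)\<^sup>2)"
      using dX[OF that] by (intro ennreal_leI power_mono) auto
    finally show ?thesis .
  qed
  \<comment> \<open>The integral of \<open>D n\<close> is at most \<open>(1/4) ^ n\<close>, which
    leaves room for the weight \<open>2 ^ n\<close>. The weight is what later turns summable squares
    into summable norms.\<close>
  define D where "D n x = (norm (f (Suc n) x - f n x))\<^sup>2" for n x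
  have [measurable]: "D n \<in> borel_measurable lebesgue" for n
    unfolding D_def by measurable
  have "(\<integral>\<^sup>+x. (\<Sum>n. ennreal (2 ^ n * D n x)) \<partial>lebesgue) = (\<Sum>n. \<integral>\<^sup>+x. ennreal (2 ^ n * D n x) \<partial>lebesgue)"
    by (intro nn_integral_suminf) auto
  also have "\<dots> \<le> (\<Sum>n. ennreal ((1/2) ^ n))"
  proof (intro suminf_le)
    fix n
    have "(\<integral>\<^sup>+x. ennreal (2 ^ n * D n x) \<partial>lebesgue) = ennreal (2 ^ n) * (\<integral>\<^sup>+x. ennreal (D n x) \<partial>lebesgue)"
      by (subst nn_integral_cmult[symmetric]) (auto simp: ennreal_mult D_def)
    also have "\<dots> \<le> ennreal (2 ^ n) * ennreal (((1/2) ^ n)\<^sup>2)"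
      using nX[of n "Suc n"] unfolding D_def by (intro mult_left_mono) auto
    also have "\<dots> = ennreal ((1/2) ^ n)"
      by (subst ennreal_mult[symmetric]) (auto simp: power2_eq_square simp flip: power_mult_distrib)
    finally show "(\<integral>\<^sup>+x. ennreal (2 ^ n * D n x) \<partial>lebesgue) \<le> ennreal ((1/2) ^ n)" .
  qed auto
  also have "\<dots> < \<infinity>"
    by (subst suminf_ennreal2) (auto intro: summable_geometric)
  finally have "AE x in lebesgue. (\<Sum>n. ennreal (2 ^ n * D n x)) \<noteq> \<infinity>"
    by (intro nn_integral_PInf_AE) auto
  then have conv: "AE x in lebesgue. convergent (\<lambda>n. f n x)"
  proof eventually_elim
    case (elim x)
    then have s1: "summable (\<lambda>n. 2 ^ n * D n x)"
      by (intro summable_suminf_not_top) (auto simp: D_def)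
    have "summable (\<lambda>n. norm (f (Suc n) x - f n x))"
    proof (rule summable_comparison_test')
      show "summable (\<lambda>n. 2 ^ n * D n x + (1/2) ^ n)"
        using s1 by (intro summable_add) (auto intro: summable_geometric)
      fix n
      define t where "t = norm (f (Suc n) x - f n x)"
      \<comment> \<open>An increment is bounded by its weighted square plus a term of a geometric
        series.\<close>
      have "2 ^ n * t \<le> (2 ^ n * t)\<^sup>2 + 1"
        using sum_squares_bound[of "2 ^ n * t" 1] by (smt (verit) power2_eq_square one_power2 mult_1_right zero_le_square)
      then have "2 ^ n * t \<le> 2 ^ n * (2 ^ n * t\<^sup>2 + (1/2) ^ n)"
        by (simp add: power2_eq_square algebra_simps power_one_over)
      then have "t \<le> 2 ^ n * t\<^sup>2 + (1/2) ^ n"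
        by (rule mult_left_le_imp_le) simp
      then show "norm (norm (f (Suc n) x - f n x)) \<le> 2 ^ n * D n x + (1/2) ^ n"
        by (simp add: t_def D_def)
    qed
    then have "summable (\<lambda>n. f (Suc n) x - f n x)"
      by (rule summable_norm_cancel)
    then have "convergent (\<lambda>n. \<Sum>i<n. f (Suc i) x - f i x)"
      by (simp add: summable_iff_convergent)
    then have "convergent (\<lambda>n. f n x - f 0 x)"
      by (simp add: sum_lessThan_telescope[of "\<lambda>i. f i x"])
    then show ?case
      using convergent_add[OF _ convergent_const[of "f 0 x"]] by force
  qed
  define F where "F x = lim (\<lambda>n. f n x)" for x
  have [measurable]: "F \<in> borel_measurable lebesgue"
    unfolding F_def by measurable
  have FX: "(\<integral>\<^sup>+x. ennreal ((norm (F x - f n x))\<^sup>2) \<partial>lebesgue) \<le> ennreal (((1/2) ^ n)\<^sup>2)" for n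
  proof -
    \<comment> \<open>Fatou's lemma in \<open>m\<close>, with \<open>n\<close> fixed.\<close>
    have "(\<integral>\<^sup>+x. ennreal ((norm (F x - f n x))\<^sup>2) \<partial>lebesgue)
      = (\<integral>\<^sup>+x. liminf (\<lambda>m. ennreal ((norm (f m x - f n x))\<^sup>2)) \<partial>lebesgue)"
    proof (rule nn_integral_cong_AE)
      show "AE x in lebesgue. ennreal ((norm (F x - f n x))\<^sup>2) = liminf (\<lambda>m. ennreal ((norm (f m x - f n x))\<^sup>2))"
        using conv
      proof eventually_elim
        case (elim x)
        then have "(\<lambda>m. f m x) \<longlonglongrightarrow> F x"
          by (simp add: F_def convergent_LIMSEQ_iff)
        then have "(\<lambda>m. ennreal ((norm (f m x - f n x))\<^sup>2)) \<longlonglongrightarrow> ennreal ((norm (F x - f n x))\<^sup>2)"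
          by (intro tendsto_intros)
        then show ?case
          by (intro lim_imp_Liminf[symmetric]) simp_all
      qed
    qed
    also have "\<dots> \<le> liminf (\<lambda>m. \<integral>\<^sup>+x. ennreal ((norm (f m x - f n x))\<^sup>2) \<partial>lebesgue)"
      by (intro nn_integral_liminf) auto
    also have "\<dots> \<le> liminf (\<lambda>m. ennreal (((1/2) ^ n)\<^sup>2))"
      by (intro Liminf_mono eventually_sequentiallyI[of n] nX)
    also have "\<dots> = ennreal (((1/2) ^ n)\<^sup>2)"
      by (simp add: Liminf_const)
    finally show ?thesis .
  qed
  have sqd: "square_integrable (\<lambda>x. F x - f n x)" for n
    unfolding square_integrable_def
  proof
    show "integrable lebesgue (\<lambda>x. (norm (F x - f n x))\<^sup>2)"
      using le_less_trans[OF FX[of n] ennreal_less_top] by (intro integrableI_bounded) auto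
  qed auto
  have sqF: "square_integrable F"
    using square_integrable_add[OF sqd[of 0] sq[of 0]] by simp
  have "norm (X n - abs_l2 F) \<le> (1/2) ^ n" for n
  proof -
    have "ennreal ((norm (abs_l2 F - X n))\<^sup>2) \<le> ennreal (((1/2) ^ n)\<^sup>2)"
      using FX[of n] unfolding Xf abs_l2_diff[OF sqF sq] norm_abs_l2[OF sqd]
      by (subst nn_integral_eq_integral[symmetric]) (use sqd[of n] in \<open>auto simp: square_integrable_def\<close>)
    then have "(norm (abs_l2 F - X n))\<^sup>2 \<le> ((1/2) ^ n)\<^sup>2"
      by (subst (asm) ennreal_le_iff) auto
    then show ?thesis
      by (subst norm_minus_commute) (auto dest: power2_le_imp_le)
  qed
  then have "(\<lambda>n. X n - abs_l2 F) \<longlonglongrightarrow> 0"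
    by (intro Lim_null_comparison[OF always_eventually LIMSEQ_realpow_zero[of "1/2"]]) auto
  then show ?thesis
    using LIM_zero_cancel convergent_def by blast
qed

instance l2 :: (euclidean_space, euclidean_space) complete_space
proof
  fix X :: "nat \<Rightarrow> ('a, 'b) l2"
  assume X: "Cauchy X"
  have "\<exists>N. \<forall>m\<ge>N. \<forall>n\<ge>N. norm (X m - X n) < (1/2) ^ j" for j
    using CauchyD[OF X, of "(1/2) ^ j"] by simp
  then obtain N where N: "\<And>j m n. m \<ge> N j \<Longrightarrow> n \<ge> N j \<Longrightarrow> norm (X m - X n) < (1/2) ^ j"
    by metis
  \<comment> \<open>The sum makes \<open>r n\<close> at least \<open>N n\<close>, and the summand
    \<open>n\<close> makes \<open>r\<close> strictly increasing.\<close>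
  define r where "r n = n + (\<Sum>i\<le>n. N i)" for n
  have r: "strict_mono r"
    unfolding strict_mono_Suc_iff by (auto simp: r_def)
  have rN: "N n \<le> r m" if "n \<le> m" for m n
    using member_le_sum[of n "{..m}" N] that by (auto simp: r_def)
  have "convergent (X \<circ> r)"
    using N rN by (intro l2_Riesz_Fischer) (auto intro!: less_imp_le)
  then obtain l where "(X \<circ> r) \<longlonglongrightarrow> l"
    by (auto simp: convergent_def)
  then show "convergent X"
    using Cauchy_converges_subseq[OF X r] by (auto simp: convergent_def)
qed

section \<open>Operators that act pointwise\<close>

text \<open>Measurability is demanded along each measurable \<open>f\<close>, which replaces a joint
  measurability condition on \<open>T\<close>.\<close>

definition bounded_pointwise :: "('a::euclidean_space \<Rightarrow> 'b::euclidean_space \<Rightarrow> 'c::euclidean_space) \<Rightarrow> bool"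
  where "bounded_pointwise T \<longleftrightarrow> (\<forall>x. linear (T x)) \<and> (\<exists>K. \<forall>x v. norm (T x v) \<le> K * norm v) \<and>
    (\<forall>f\<in>borel_measurable lebesgue. (\<lambda>x. T x (f x)) \<in> borel_measurable lebesgue)"

definition pointwise_op ::
    "('a::euclidean_space \<Rightarrow> 'b::euclidean_space \<Rightarrow> 'c::euclidean_space) \<Rightarrow> ('a, 'b) l2 \<Rightarrow> ('a, 'c) l2"
  where "pointwise_op T p = abs_l2 (\<lambda>x. T x (rep_l2 p x))"

lemma square_integrable_pointwise:
  assumes "bounded_pointwise T" "square_integrable f"
  shows "square_integrable (\<lambda>x. T x (f x))"
proof -
  obtain K where "\<And>x v. norm (T x v) \<le> K * norm v"
    using assms by (auto simp: bounded_pointwise_def)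
  then show ?thesis
    using assms by (intro square_integrable_bound[OF _ assms(2), of _ K])
      (auto simp: bounded_pointwise_def square_integrable_def)
qed

text \<open>The operator was defined through an arbitrary representative; a different one changes
  the image only on a null set.\<close>

lemma pointwise_op_abs:
  assumes "bounded_pointwise T" "square_integrable f"
  shows "pointwise_op T (abs_l2 f) = abs_l2 (\<lambda>x. T x (f x))"
  unfolding pointwise_op_def using rep_abs_l2[OF assms(2)] assms
  by (subst abs_l2_eq_iff) (auto intro: square_integrable_pointwise elim!: eventually_mono)

lemma bounded_linear_pointwise_op:
  assumes T: "bounded_pointwise T"
  shows "bounded_linear (pointwise_op T)"
proof -
  obtain K where K: "\<And>x v. norm (T x v) \<le> K * norm v"
    using assms by (auto simp: bounded_pointwise_def)
  have lin: "linear (T x)" for x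
    using assms by (auto simp: bounded_pointwise_def)
  note sq = square_integrable_pointwise[OF T]
  show ?thesis
  proof (rule bounded_linear_intro[where K = "\<bar>K\<bar>"])
    fix p q :: "('a, 'b) l2" and c :: real
    show "pointwise_op T (p + q) = pointwise_op T p + pointwise_op T q"
      by (cases p; cases q)
        (simp add: abs_l2_add pointwise_op_abs[OF T] sq square_integrable_add linear_add[OF lin])
    show "pointwise_op T (c *\<^sub>R p) = c *\<^sub>R pointwise_op T p"
      by (cases p)
        (simp add: abs_l2_scaleR pointwise_op_abs[OF T] sq square_integrable_scaleR linear_scale[OF lin])
    show "norm (pointwise_op T p) \<le> norm p * \<bar>K\<bar>"
    proof (cases p)
      case (1 f)
      have "(norm (T x (f x)))\<^sup>2 \<le> K\<^sup>2 * (norm (f x))\<^sup>2" for x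
        using power_mono[OF K norm_ge_zero, of x "f x" 2] by (simp add: power_mult_distrib)
      then have "(LINT x|lebesgue. (norm (T x (f x)))\<^sup>2) \<le> (LINT x|lebesgue. K\<^sup>2 * (norm (f x))\<^sup>2)"
        using 1 sq[of f] by (intro integral_mono) (auto simp: square_integrable_def)
      then have "(norm (pointwise_op T p))\<^sup>2 \<le> (norm p * \<bar>K\<bar>)\<^sup>2"
        using 1 by (simp add: pointwise_op_abs[OF T] norm_abs_l2 sq power_mult_distrib mult.commute)
      then show ?thesis
        by (rule power2_le_imp_le) simp
    qed
  qed
qed

lemma pointwise_op_adjoint:
  assumes T: "bounded_pointwise T" and S: "bounded_pointwise S"
    and "\<And>x v w. T x v \<bullet> w = v \<bullet> S x w"
  shows "pointwise_op T p \<bullet> q = p \<bullet> pointwise_op S q"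
  by (cases p; cases q)
    (simp add: pointwise_op_abs[OF T] pointwise_op_abs[OF S] inner_abs_l2
      square_integrable_pointwise[OF T] square_integrable_pointwise[OF S] assms(3))

section \<open>Test functions\<close>

lemma cont_diff_Suc_imp: "cont_diff (Suc k) f \<Longrightarrow> cont_diff k f"
proof (induction k arbitrary: f)
  case 0
  then show ?case
    by (auto intro!: continuous_at_imp_continuous_on differentiable_imp_continuous_within)
qed auto

lemma partial_deriv_eq: "(f has_derivative f') (at x) \<Longrightarrow> partial_deriv f b x = f' b"
  by (simp add: partial_deriv_def frechet_derivative_at[symmetric])

lemma has_derivative_partial_deriv:
  "f differentiable (at x) \<Longrightarrow> (f has_derivative (\<lambda>h. frechet_derivative f (at x) h)) (at x)"
  using frechet_derivative_works by blast

lemma partial_deriv_add: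
  assumes "f differentiable (at x)" "g differentiable (at x)"
  shows "partial_deriv (\<lambda>x. f x + g x) b x = partial_deriv f b x + partial_deriv g b x"
  using partial_deriv_eq[OF has_derivative_add[OF has_derivative_partial_deriv[OF assms(1)]
    has_derivative_partial_deriv[OF assms(2)]]] by (simp add: partial_deriv_def)

lemma partial_deriv_mult:
  assumes "f differentiable (at x)" "g differentiable (at x)"
  shows "partial_deriv (\<lambda>x. f x * g x) b x = f x * partial_deriv g b x + partial_deriv f b x * g x"
  using partial_deriv_eq[OF has_derivative_mult[OF has_derivative_partial_deriv[OF assms(1)]
    has_derivative_partial_deriv[OF assms(2)]]] by (simp add: partial_deriv_def)

lemma cont_diff_const: "cont_diff k (\<lambda>x. c)"
proof (induction k arbitrary: c)
  case (Suc k)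
  have "partial_deriv (\<lambda>x. c) b = (\<lambda>x. 0)" for b :: 'a
    by (rule ext) (simp add: partial_deriv_eq[OF has_derivative_const])
  then show ?case using Suc by simp
qed simp

lemma cont_diff_add: "cont_diff k f \<Longrightarrow> cont_diff k g \<Longrightarrow> cont_diff k (\<lambda>x. f x + g x)"
proof (induction k arbitrary: f g)
  case 0
  then show ?case by (auto intro: continuous_intros)
next
  case (Suc k)
  have "partial_deriv (\<lambda>x. f x + g x) b = (\<lambda>x. partial_deriv f b x + partial_deriv g b x)" for b
    using Suc.prems by (intro ext partial_deriv_add) auto
  then show ?case using Suc by (auto intro: derivative_intros)
qed

lemma cont_diff_mult: "cont_diff k f \<Longrightarrow> cont_diff k g \<Longrightarrow> cont_diff k (\<lambda>x. f x * g x)"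
proof (induction k arbitrary: f g)
  case 0
  then show ?case by (auto intro: continuous_intros)
next
  case (Suc k)
  have "partial_deriv (\<lambda>x. f x * g x) b = (\<lambda>x. f x * partial_deriv g b x + partial_deriv f b x * g x)" for b
    using Suc.prems by (intro ext partial_deriv_mult) auto
  moreover have "cont_diff k (\<lambda>x. f x * partial_deriv g b x + partial_deriv f b x * g x)" if "b \<in> Basis" for b
    using Suc.prems that cont_diff_Suc_imp[of k f] cont_diff_Suc_imp[of k g]
    by (intro cont_diff_add Suc.IH) auto
  ultimately show ?case using Suc.prems by (auto intro: derivative_intros)
qed

lemma partial_deriv_inner: "partial_deriv (\<lambda>x. x \<bullet> e) b x = b \<bullet> e"
  by (rule partial_deriv_eq) (auto intro!: derivative_eq_intros)

lemma cont_diff_inner: "cont_diff k (\<lambda>x. x \<bullet> e)"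
proof (cases k)
  case 0
  then show ?thesis by (auto intro: continuous_intros)
next
  case (Suc k')
  have "partial_deriv (\<lambda>x. x \<bullet> e) b = (\<lambda>x. b \<bullet> e)" for b
    by (intro ext partial_deriv_inner)
  then show ?thesis unfolding Suc by (auto intro: derivative_intros cont_diff_const)
qed

lemma has_derivative_grad:
  assumes "f differentiable (at x)"
  shows "(f has_derivative (\<lambda>h. grad f x \<bullet> h)) (at x)"
proof -
  let ?f' = "frechet_derivative f (at x)"
  have f': "(f has_derivative ?f') (at x)"
    using assms by (rule has_derivative_partial_deriv)
  have "?f' h = grad f x \<bullet> h" for h
  proof -
    have "?f' h = ?f' (\<Sum>b\<in>Basis. (h \<bullet> b) *\<^sub>R b)" by (simp add: euclidean_representation)
    also have "\<dots> = (\<Sum>b\<in>Basis. (h \<bullet> b) * ?f' b)"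
      using has_derivative_linear[OF f'] by (simp add: linear_sum linear_cmul)
    also have "\<dots> = grad f x \<bullet> h"
      by (simp add: grad_def inner_sum_left partial_deriv_def inner_commute[of h] mult.commute)
    finally show ?thesis .
  qed
  then have "?f' = (\<lambda>h. grad f x \<bullet> h)" by (rule ext)
  then show ?thesis using f' by simp
qed

lemma grad_eq:
  assumes "(f has_derivative (\<lambda>h. v \<bullet> h)) (at x)"
  shows "grad f x = v"
  by (simp add: grad_def partial_deriv_eq[OF assms] euclidean_representation)

lemma grad_add:
  "f differentiable (at x) \<Longrightarrow> g differentiable (at x) \<Longrightarrow>
    grad (\<lambda>x. f x + g x) x = grad f x + grad g x"
  by (simp add: grad_def partial_deriv_add scaleR_left_distrib sum.distrib)

lemma grad_mult:
  "f differentiable (at x) \<Longrightarrow> g differentiable (at x) \<Longrightarrow>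
    grad (\<lambda>x. f x * g x) x = f x *\<^sub>R grad g x + g x *\<^sub>R grad f x"
  by (simp add: grad_def partial_deriv_mult scaleR_left_distrib sum.distrib scaleR_sum_right mult.commute)

lemma grad_inner: "grad (\<lambda>x. x \<bullet> e) x = e"
  unfolding grad_def partial_deriv_inner by (simp add: inner_commute[of _ e] euclidean_representation)

lemma grad_const: "grad (\<lambda>x. c) x = 0"
  by (rule grad_eq) simp

lemma grad_inner_Basis: "b \<in> Basis \<Longrightarrow> grad f x \<bullet> b = partial_deriv f b x"
  by (simp add: grad_def inner_sum_left inner_Basis if_distrib cong: if_cong)

text \<open>The support of \<psi> lies in the union of two compact supports. Two functions are
  allowed so that sums are covered; for products both are the same.\<close>

lemma test_functionsI:
  assumes "\<phi>1 \<in> test_functions \<Omega>" "\<phi>2 \<in> test_functions \<Omega>" "\<And>k. cont_diff k \<psi>"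
    and "\<And>x. \<phi>1 x = 0 \<Longrightarrow> \<phi>2 x = 0 \<Longrightarrow> \<psi> x = 0"
  shows "\<psi> \<in> test_functions \<Omega>"
proof -
  have sub: "closure {x. \<psi> x \<noteq> 0} \<subseteq> closure {x. \<phi>1 x \<noteq> 0} \<union> closure {x. \<phi>2 x \<noteq> 0}"
    using assms(4) by (subst closure_Un[symmetric]) (intro closure_mono, auto)
  moreover have "compact (closure {x. \<phi>1 x \<noteq> 0} \<union> closure {x. \<phi>2 x \<noteq> 0})"
    using assms by (intro compact_Un) (auto simp: test_functions_def)
  ultimately have "compact (closure {x. \<psi> x \<noteq> 0})"
    by (metis closed_closure compact_Int_closed inf.absorb_iff2)
  then show ?thesis using assms sub by (auto simp: test_functions_def)
qed

lemma test_functions_zero: "(\<lambda>x. 0) \<in> test_functions \<Omega>"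
  by (simp add: test_functions_def cont_diff_const)

lemma test_functions_add:
  assumes "\<phi> \<in> test_functions \<Omega>" "\<psi> \<in> test_functions \<Omega>"
  shows "(\<lambda>x. \<phi> x + \<psi> x) \<in> test_functions \<Omega>"
  using assms by (intro test_functionsI[OF assms] cont_diff_add) (auto simp: test_functions_def)

lemma test_functions_mult:
  assumes "\<phi> \<in> test_functions \<Omega>" "\<And>k. cont_diff k f"
  shows "(\<lambda>x. f x * \<phi> x) \<in> test_functions \<Omega>"
  using assms by (intro test_functionsI[OF assms(1,1)] cont_diff_mult) (auto simp: test_functions_def)

lemma test_function_differentiable: "\<phi> \<in> test_functions \<Omega> \<Longrightarrow> \<phi> differentiable (at x)"
  by (auto simp: test_functions_def dest: spec[of _ "Suc 0"])

lemma test_function_continuous: "\<phi> \<in> test_functions \<Omega> \<Longrightarrow> continuous_on UNIV \<phi>"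
  by (auto simp: test_functions_def dest: spec[of _ 0])

lemma grad_test_function_continuous:
  assumes "\<phi> \<in> test_functions \<Omega>"
  shows "continuous_on UNIV (grad \<phi>)"
proof -
  have "cont_diff (Suc 0) \<phi>" using assms unfolding test_functions_def by blast
  then have "continuous_on UNIV (partial_deriv \<phi> b)" if "b \<in> Basis" for b
    using that by simp
  then show ?thesis unfolding grad_def[abs_def] by (intro continuous_intros)
qed

text \<open>In contrast to \<open>test_functions\<close>, no domain and no smoothness is involved,
  so the class is stable under translations and contains the gradients of test functions.\<close>

definition compactly_supported :: "('a::euclidean_space \<Rightarrow> 'b::euclidean_space) \<Rightarrow> bool"
  where "compactly_supported f \<longleftrightarrow> continuous_on UNIV f \<and> (\<exists>R. \<forall>x. R < norm x \<longrightarrow> f x = 0)"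

lemma test_function_zero_outside:
  assumes \<phi>: "\<phi> \<in> test_functions \<Omega>" and x: "x \<notin> \<Omega>"
  shows "\<phi> x = 0" "grad \<phi> x = 0"
proof -
  have x': "x \<in> - closure {x. \<phi> x \<noteq> 0}" using assms by (auto simp: test_functions_def)
  then show "\<phi> x = 0" using closure_subset[of "{x. \<phi> x \<noteq> 0}"] by auto
  have "((\<lambda>x. 0) has_derivative (\<lambda>h. 0 \<bullet> h)) (at x)" by simp
  then have "(\<phi> has_derivative (\<lambda>h. 0 \<bullet> h)) (at x)"
    by (rule has_derivative_transform_within_open[OF _ _ x'])
      (use closure_subset[of "{x. \<phi> x \<noteq> 0}"] in auto)
  then show "grad \<phi> x = 0" by (rule grad_eq)
qed

lemma test_function_compactly_supported:
  assumes "\<phi> \<in> test_functions \<Omega>"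
  shows "compactly_supported \<phi>" "compactly_supported (grad \<phi>)"
proof -
  let ?K = "closure {x. \<phi> x \<noteq> 0}"
  \<comment> \<open>A test function of \<Omega> is one of its own support, so it and its gradient
    vanish off a compact set and not merely off \<Omega>.\<close>
  have "\<phi> \<in> test_functions ?K" using assms by (auto simp: test_functions_def)
  note z = test_function_zero_outside[OF this]
  have "bounded ?K" using assms by (auto simp: test_functions_def dest: compact_imp_bounded)
  then obtain R where "\<forall>x\<in>?K. norm x \<le> R" by (auto simp: bounded_iff)
  then have "R < norm x \<Longrightarrow> x \<notin> ?K" for x by force
  then show "compactly_supported \<phi>" "compactly_supported (grad \<phi>)"
    using z test_function_continuous[OF assms] grad_test_function_continuous[OF assms]
    unfolding compactly_supported_def by blast+
qed

lemma compactly_supported_bounded: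
  assumes "compactly_supported f"
  obtains C where "0 \<le> C" "\<And>x. norm (f x) \<le> C"
proof -
  obtain R where R: "\<And>x. R < norm x \<Longrightarrow> f x = 0" and c: "continuous_on UNIV f"
    using assms by (auto simp: compactly_supported_def)
  have "compact (f ` cball 0 R)"
    using c by (intro compact_continuous_image continuous_on_subset[OF c]) auto
  then have "bounded (f ` cball 0 R)" by (rule compact_imp_bounded)
  then obtain C where "\<forall>y\<in>f ` cball 0 R. norm y \<le> C"
    unfolding bounded_iff by blast
  then have C: "norm (f x) \<le> C" if "x \<in> cball 0 R" for x
    using that by blast
  show ?thesis
  proof (rule that[of "max 0 C"])
    show "norm (f x) \<le> max 0 C" for x
      using R[of x] C[of x] by (cases "R < norm x") auto
  qed simp
qed

lemma compactly_supported_measurable [measurable_dest]: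
  "compactly_supported f \<Longrightarrow> f \<in> borel_measurable borel"
  by (auto simp: compactly_supported_def intro: borel_measurable_continuous_onI)

lemma compactly_supported_integrable:
  fixes f :: "'a::euclidean_space \<Rightarrow> 'b::euclidean_space"
  assumes "compactly_supported f"
  shows "integrable lborel f"
proof -
  obtain R where R: "\<And>x. R < norm x \<Longrightarrow> f x = 0" and c: "continuous_on UNIV f"
    using assms by (auto simp: compactly_supported_def)
  have "integrable lborel (\<lambda>x. indicator (cball 0 R) x *\<^sub>R f x)"
    by (intro borel_integrable_compact continuous_on_subset[OF c]) auto
  also have "(\<lambda>x. indicator (cball 0 R) x *\<^sub>R f x) = f"
    using R by (auto simp: fun_eq_iff indicator_def)
  finally show ?thesis .
qed

lemma compactly_supported_norm_square:
  "compactly_supported f \<Longrightarrow> compactly_supported (\<lambda>x. (norm (f x))\<^sup>2)"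
  by (auto simp: compactly_supported_def intro!: continuous_intros)

lemma compactly_supported_add:
  assumes "compactly_supported f" "compactly_supported g"
  shows "compactly_supported (\<lambda>x. f x + g x)"
proof -
  obtain R R' where "\<And>x. R < norm x \<Longrightarrow> f x = 0" "\<And>x. R' < norm x \<Longrightarrow> g x = 0"
    using assms by (auto simp: compactly_supported_def)
  then have "\<forall>x. max R R' < norm x \<longrightarrow> f x + g x = 0" by auto
  then show ?thesis using assms unfolding compactly_supported_def by (blast intro: continuous_intros)
qed

lemma compactly_supported_translate:
  assumes "compactly_supported f"
  shows "compactly_supported (\<lambda>x. f (x + h))"
proof -
  obtain R where R: "\<And>x. R < norm x \<Longrightarrow> f x = 0" and c: "continuous_on UNIV f"
    using assms by (auto simp: compactly_supported_def)
  have "f (x + h) = 0" if "R + norm h < norm x" for x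
    using that norm_triangle_ineq4[of "x + h" h] by (intro R) simp
  moreover have "continuous_on UNIV (\<lambda>x. f (x + h))"
    by (intro continuous_on_compose2[OF c] continuous_intros) auto
  ultimately show ?thesis unfolding compactly_supported_def by blast
qed

lemma compactly_supported_scaleR:
  "compactly_supported f \<Longrightarrow> compactly_supported (\<lambda>x. c *\<^sub>R f x)"
  by (auto simp: compactly_supported_def intro: continuous_intros)

lemma compactly_supported_diff:
  assumes "compactly_supported f" "compactly_supported g"
  shows "compactly_supported (\<lambda>x. f x - g x)"
  using compactly_supported_add[OF assms(1) compactly_supported_scaleR[OF assms(2), of "-1"]] by simp

lemma compactly_supported_square_integrable:
  assumes "compactly_supported f"
  shows "square_integrable f"
  unfolding square_integrable_def
proof
  show "f \<in> borel_measurable lebesgue"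
    using compactly_supported_measurable[OF assms] by (intro measurable_completion) simp
  have "integrable lborel (\<lambda>x. (norm (f x))\<^sup>2)"
    by (intro compactly_supported_integrable compactly_supported_norm_square assms)
  then show "integrable lebesgue (\<lambda>x. (norm (f x))\<^sup>2)"
    by (subst integrable_completion) auto
qed

lemma norm_abs_l2_compactly_supported:
  assumes "compactly_supported f"
  shows "(norm (abs_l2 f))\<^sup>2 = (LINT x|lborel. (norm (f x))\<^sup>2)"
  using norm_abs_l2[OF compactly_supported_square_integrable[OF assms]]
    compactly_supported_measurable[OF compactly_supported_norm_square[OF assms]]
  by (simp add: integral_completion)

lemma lborel_integral_translate:
  fixes f :: "'a::euclidean_space \<Rightarrow> 'b::euclidean_space"
  assumes "f \<in> borel_measurable borel"
  shows "(LINT x|lborel. f (x + h)) = (LINT x|lborel. f x)"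
proof -
  have "(LINT x|lborel. f x) = (LINT x|distr lborel borel ((+) h). f x)"
    by (simp add: lborel_distr_plus)
  also have "\<dots> = (LINT x|lborel. f (x + h))"
    using assms by (subst integral_distr) (auto simp: add.commute)
  finally show ?thesis ..
qed

lemma lborel_nn_integral_translate:
  fixes f :: "'a::euclidean_space \<Rightarrow> ennreal"
  assumes "f \<in> borel_measurable borel"
  shows "(\<integral>\<^sup>+x. f (x + h) \<partial>lborel) = (\<integral>\<^sup>+x. f x \<partial>lborel)"
proof -
  have "(\<integral>\<^sup>+x. f x \<partial>lborel) = (\<integral>\<^sup>+x. f x \<partial>distr lborel borel ((+) h))"
    by (simp add: lborel_distr_plus)
  also have "\<dots> = (\<integral>\<^sup>+x. f (x + h) \<partial>lborel)"
    using assms by (subst nn_integral_distr) (auto simp: add.commute)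
  finally show ?thesis ..
qed

lemma test_function_Lipschitz:
  assumes "\<phi> \<in> test_functions \<Omega>"
  obtains L where "0 \<le> L" "\<And>x y. \<bar>\<phi> x - \<phi> y\<bar> \<le> L * norm (x - y)"
proof -
  obtain L where L: "0 \<le> L" "\<And>x. norm (grad \<phi> x) \<le> L"
    using compactly_supported_bounded[OF test_function_compactly_supported(2)[OF assms]] by blast
  show ?thesis
  proof (rule that[OF L(1)])
    fix x y :: 'a
    have "norm (\<phi> x - \<phi> y) \<le> L * norm (x - y)"
    proof (rule differentiable_bound[of UNIV])
      show "(\<phi> has_derivative (\<lambda>h. grad \<phi> x \<bullet> h)) (at x within UNIV)" for x
        using has_derivative_grad[OF test_function_differentiable[OF assms]] by simp
      show "onorm (\<lambda>h. grad \<phi> x \<bullet> h) \<le> L" for x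
      proof (rule onorm_le)
        fix h
        have "norm (grad \<phi> x \<bullet> h) \<le> norm (grad \<phi> x) * norm h"
          by (simp add: Cauchy_Schwarz_ineq2)
        also have "\<dots> \<le> L * norm h" by (intro mult_right_mono L) auto
        finally show "norm (grad \<phi> x \<bullet> h) \<le> L * norm h" .
      qed
    qed auto
    then show "\<bar>\<phi> x - \<phi> y\<bar> \<le> L * norm (x - y)" by simp
  qed
qed

section \<open>Difference quotients and translation estimates\<close>

context
  fixes \<Omega> :: "'a::euclidean_space set" and \<phi> :: "'a \<Rightarrow> real" and h :: 'a
    and \<delta> :: "nat \<Rightarrow> 'a \<Rightarrow> real"
  assumes \<phi>: "\<phi> \<in> test_functions \<Omega>"
  defines "\<delta> n x \<equiv> real (Suc n) * (\<phi> (x + (1 / real (Suc n)) *\<^sub>R h) - \<phi> x)"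
begin

lemma difference_quotient_LIMSEQ: "(\<lambda>n. \<delta> n x) \<longlonglongrightarrow> grad \<phi> x \<bullet> h"
proof -
  have 1: "((\<lambda>t. x + t *\<^sub>R h) has_derivative (\<lambda>s. s *\<^sub>R h)) (at 0)"
    by (auto intro!: derivative_eq_intros)
  have 2: "(\<phi> has_derivative (\<lambda>h. grad \<phi> x \<bullet> h)) (at (x + 0 *\<^sub>R h))"
    using has_derivative_grad[OF test_function_differentiable[OF \<phi>]] by simp
  note has_derivative_compose[OF 1 2]
  moreover have "(\<lambda>s. grad \<phi> x \<bullet> (s *\<^sub>R h)) = (*) (grad \<phi> x \<bullet> h)"
    by (simp add: fun_eq_iff)
  ultimately have "((\<lambda>t. \<phi> (x + t *\<^sub>R h)) has_real_derivative (grad \<phi> x \<bullet> h)) (at 0)"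
    by (simp add: has_field_derivative_def)
  then have "((\<lambda>t. (\<phi> (x + t *\<^sub>R h) - \<phi> x) / t) \<longlongrightarrow> grad \<phi> x \<bullet> h) (at 0)"
    by (simp add: has_field_derivative_iff)
  then have "(\<lambda>n. (\<phi> (x + (1 / real (Suc n)) *\<^sub>R h) - \<phi> x) / (1 / real (Suc n))) \<longlonglongrightarrow> grad \<phi> x \<bullet> h"
    by (rule filterlim_compose)
      (use LIMSEQ_inverse_real_of_nat in \<open>simp add: filterlim_at inverse_eq_divide del: of_nat_Suc\<close>)
  then show ?thesis by (simp add: \<delta>_def mult.commute)
qed

text \<open>Supplies the dominating function for passing to the limit under the integral: the step
  never exceeds \<open>h\<close>, so all quotients vanish outside one ball, and the Lipschitz
  constant bounds them inside.\<close>

lemma difference_quotient_bound: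
  obtains C R where "\<And>n x. \<bar>\<delta> n x\<bar> \<le> C * indicator (cball 0 R) x" "0 \<le> C"
proof -
  obtain L where L: "0 \<le> L" "\<And>x y. \<bar>\<phi> x - \<phi> y\<bar> \<le> L * norm (x - y)"
    using test_function_Lipschitz[OF \<phi>] by blast
  obtain R where R: "\<And>x. R < norm x \<Longrightarrow> \<phi> x = 0"
    using test_function_compactly_supported(1)[OF \<phi>] by (auto simp: compactly_supported_def)
  show ?thesis
  proof (rule that[of "L * norm h" "R + norm h"])
    fix n x
    define t where "t = 1 / real (Suc n)"
    have t: "0 < t" "t \<le> 1" by (auto simp: t_def)
    have "\<bar>\<delta> n x\<bar> = \<bar>\<phi> (x + t *\<^sub>R h) - \<phi> x\<bar> / t"
      using t by (simp add: \<delta>_def t_def abs_mult)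
    also have "\<dots> \<le> L * norm (x + t *\<^sub>R h - x) / t"
      using t L(2)[of "x + t *\<^sub>R h" x] by (intro divide_right_mono) auto
    also have "\<dots> = L * norm h" using t by simp
    finally have 1: "\<bar>\<delta> n x\<bar> \<le> L * norm h" .
    have "\<delta> n x = 0" if x: "R + norm h < norm x"
    proof -
      have "norm (t *\<^sub>R h) \<le> norm h"
        using t mult_right_mono[of t 1 "norm h"] by simp
      moreover have "norm x \<le> norm (x + t *\<^sub>R h) + norm (t *\<^sub>R h)"
        using norm_triangle_ineq4[of "x + t *\<^sub>R h" "t *\<^sub>R h"] by simp
      moreover have "0 \<le> norm h" by simp
      ultimately have "R < norm (x + t *\<^sub>R h)" "R < norm x"
        using x by linarith+
      then show ?thesis by (simp add: \<delta>_def R flip: t_def del: of_nat_Suc)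
    qed
    with 1 show "\<bar>\<delta> n x\<bar> \<le> L * norm h * indicator (cball 0 (R + norm h)) x"
      by (auto simp: indicator_def)
  qed (use L in simp)
qed

lemma difference_quotient_measurable: "\<delta> n \<in> borel_measurable borel"
  using compactly_supported_measurable[OF test_function_compactly_supported(1)[OF \<phi>]]
  unfolding \<delta>_def by measurable

lemma grad_measurable: "(\<lambda>x. grad \<phi> x \<bullet> h) \<in> borel_measurable borel"
  using compactly_supported_measurable[OF test_function_compactly_supported(2)[OF \<phi>]] by measurable

lemma integral_difference_quotient:
  "(\<lambda>n. LINT x|lborel. \<delta> n x) \<longlonglongrightarrow> (LINT x|lborel. grad \<phi> x \<bullet> h)"
  "(\<lambda>n. LINT x|lborel. (\<delta> n x)\<^sup>2) \<longlonglongrightarrow> (LINT x|lborel. (grad \<phi> x \<bullet> h)\<^sup>2)"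
proof -
  obtain C R where C: "\<And>n x. \<bar>\<delta> n x\<bar> \<le> C * indicator (cball 0 R) x" "0 \<le> C"
    using difference_quotient_bound by blast
  have int: "integrable lborel (\<lambda>x. c * indicator (cball (0::'a) R) x)" for c :: real
    using emeasure_bounded_finite[of "cball 0 R"]
    by (intro integrable_mult_right integrable_real_indicator) auto
  note meas [measurable] = difference_quotient_measurable grad_measurable
  show "(\<lambda>n. LINT x|lborel. \<delta> n x) \<longlonglongrightarrow> (LINT x|lborel. grad \<phi> x \<bullet> h)"
    by (rule integral_dominated_convergence[OF _ _ int[of C]])
      (auto simp: difference_quotient_LIMSEQ C)
  have C2: "(\<delta> n x)\<^sup>2 \<le> C\<^sup>2 * indicator (cball 0 R) x" for n x
    using power_mono[OF C(1)[of n x] abs_ge_zero, of 2]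
    by (auto simp: power_mult_distrib indicator_def)
  show "(\<lambda>n. LINT x|lborel. (\<delta> n x)\<^sup>2) \<longlonglongrightarrow> (LINT x|lborel. (grad \<phi> x \<bullet> h)\<^sup>2)"
    by (rule integral_dominated_convergence[OF _ _ int[of "C\<^sup>2"]])
      (auto intro!: tendsto_intros difference_quotient_LIMSEQ C2)
qed

text \<open>Translation invariance gives every difference quotient integral zero, and this survives
  the limit. It serves as the divergence theorem, with no boundary and no iterated
  integrals.\<close>

lemma integral_grad_eq_zero: "(LINT x|lborel. grad \<phi> x \<bullet> h) = 0"
proof -
  note cs = test_function_compactly_supported(1)[OF \<phi>]
  have "(LINT x|lborel. \<delta> n x) = 0" for n
  proof -
    have "(LINT x|lborel. \<delta> n x) = real (Suc n) *
        ((LINT x|lborel. \<phi> (x + (1 / real (Suc n)) *\<^sub>R h)) - (LINT x|lborel. \<phi> x))"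
      unfolding \<delta>_def
      by (subst integral_mult_right_zero, subst Bochner_Integration.integral_diff)
        (auto intro!: compactly_supported_integrable compactly_supported_translate cs)
    also have "\<dots> = 0"
      by (subst lborel_integral_translate) (auto intro: compactly_supported_measurable cs)
    finally show ?thesis .
  qed
  then show ?thesis
    using LIMSEQ_unique[OF integral_difference_quotient(1)] by simp
qed

text \<open>The increment over \<open>h\<close> telescopes into \<open>Suc n\<close> increments over
  \<open>h / Suc n\<close>, all of the same L2 norm by translation invariance. The triangle
  inequality bounds it by the norm of the difference quotient, which tends to that of the
  directional derivative.\<close>

lemma integral_translate_diff_square:
  "(LINT x|lborel. (\<phi> (x + h) - \<phi> x)\<^sup>2) \<le> (norm h)\<^sup>2 * (LINT x|lborel. (norm (grad \<phi> x))\<^sup>2)"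
proof -
  note cs = test_function_compactly_supported[OF \<phi>]
  define N where "N k = (LINT x|lborel. (\<phi> (x + k) - \<phi> x)\<^sup>2)" for k
  have csk: "compactly_supported (\<lambda>x. \<phi> (x + k))" for k
    by (intro compactly_supported_translate cs)
  define a where "a k = abs_l2 (\<lambda>x. \<phi> (x + k))" for k
  have a: "norm (a (k + l) - a k) = sqrt (N l)" for k l
  proof -
    have "(norm (a (k + l) - a k))\<^sup>2 = (LINT x|lborel. (\<phi> (x + (k + l)) - \<phi> (x + k))\<^sup>2)"
      unfolding a_def abs_l2_diff[OF csk[THEN compactly_supported_square_integrable]
          csk[THEN compactly_supported_square_integrable]]
      using norm_abs_l2_compactly_supported[OF compactly_supported_diff[OF csk csk]] by simp
    also have "\<dots> = (LINT x|lborel. (\<lambda>y. (\<phi> (y + l) - \<phi> y)\<^sup>2) (x + k))"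
      by (simp add: add_ac)
    also have "\<dots> = N l"
      unfolding N_def
      by (rule lborel_integral_translate)
        (intro borel_measurable_power borel_measurable_diff compactly_supported_measurable cs csk)
    finally show ?thesis by (metis norm_ge_zero real_sqrt_unique)
  qed
  have "N h \<le> (LINT x|lborel. (\<delta> n x)\<^sup>2)" for n
  proof -
    define l where "l = (1 / real (Suc n)) *\<^sub>R h"
    have "a h - a 0 = (\<Sum>i<Suc n. a (real (Suc i) *\<^sub>R l) - a (real i *\<^sub>R l))"
      by (subst sum_lessThan_telescope[of "\<lambda>i. a (real i *\<^sub>R l)"]) (simp add: l_def)
    also have "norm \<dots> \<le> (\<Sum>i<Suc n. norm (a (real (Suc i) *\<^sub>R l) - a (real i *\<^sub>R l)))"
      by (rule norm_sum)
    also have "\<dots> = (\<Sum>i<Suc n. sqrt (N l))"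
      using a[of "real _ *\<^sub>R l" l] by (intro sum.cong) (auto simp: algebra_simps)
    finally have "sqrt (N h) \<le> real (Suc n) * sqrt (N l)"
      using a[of 0 h] by simp
    then have "(sqrt (N h))\<^sup>2 \<le> (real (Suc n) * sqrt (N l))\<^sup>2"
      by (rule power_mono) (simp add: N_def)
    moreover have "0 \<le> N k" for k by (simp add: N_def)
    ultimately have "N h \<le> (real (Suc n))\<^sup>2 * N l" by (simp add: power_mult_distrib)
    also have "\<dots> = (LINT x|lborel. (\<delta> n x)\<^sup>2)"
      by (simp add: N_def \<delta>_def l_def power_mult_distrib del: of_nat_Suc)
    finally show ?thesis .
  qed
  then have "N h \<le> (LINT x|lborel. (grad \<phi> x \<bullet> h)\<^sup>2)"
    by (intro LIMSEQ_le_const[OF integral_difference_quotient(2)]) auto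
  also have "\<dots> \<le> (LINT x|lborel. (norm h)\<^sup>2 * (norm (grad \<phi> x))\<^sup>2)"
  proof (rule integral_mono')
    show "integrable lborel (\<lambda>x. (norm h)\<^sup>2 * (norm (grad \<phi> x))\<^sup>2)"
      by (intro integrable_mult_right compactly_supported_integrable compactly_supported_norm_square cs)
    show "(grad \<phi> x \<bullet> h)\<^sup>2 \<le> (norm h)\<^sup>2 * (norm (grad \<phi> x))\<^sup>2" for x
      using Cauchy_Schwarz_ineq[of "grad \<phi> x" h] by (simp add: power2_norm_eq_inner mult.commute)
  qed auto
  finally show ?thesis by (simp add: N_def)
qed

end

text \<open>The product is again a test function, so the integral of its derivative vanishes; the
  product rule does the rest.\<close>

lemma integration_by_parts:
  assumes "\<phi> \<in> test_functions \<Omega>" "\<psi> \<in> test_functions \<Omega>"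
  shows "(LINT x|lborel. (grad \<phi> x \<bullet> h) * \<psi> x) = - (LINT x|lborel. \<phi> x * (grad \<psi> x \<bullet> h))"
proof -
  have t: "(\<lambda>x. \<phi> x * \<psi> x) \<in> test_functions \<Omega>"
    using assms by (intro test_functions_mult) (auto simp: test_functions_def)
  have cs: "compactly_supported (\<lambda>x. (grad f x \<bullet> h) * g x)"
    if "f \<in> test_functions \<Omega>" "g \<in> test_functions \<Omega>" for f g
    using test_function_compactly_supported(2)[OF that(1)] test_function_compactly_supported(1)[OF that(2)]
    unfolding compactly_supported_def by (auto intro!: continuous_intros)
  have cs': "compactly_supported (\<lambda>x. g x * (grad f x \<bullet> h))"
    if "f \<in> test_functions \<Omega>" "g \<in> test_functions \<Omega>" for f g
    using cs[OF that] by (simp add: mult.commute)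
  have "(LINT x|lborel. (grad \<phi> x \<bullet> h) * \<psi> x) + (LINT x|lborel. (grad \<psi> x \<bullet> h) * \<phi> x)
      = (LINT x|lborel. grad (\<lambda>x. \<phi> x * \<psi> x) x \<bullet> h)"
    using assms
    by (subst Bochner_Integration.integral_add[symmetric])
      (auto intro!: compactly_supported_integrable cs cs'
        simp: grad_mult[OF test_function_differentiable test_function_differentiable] inner_add_left algebra_simps)
  also have "\<dots> = 0" by (rule integral_grad_eq_zero[OF t])
  finally show ?thesis by (simp add: mult.commute)
qed

text \<open>Averaging \<open>\<phi>\<close> over the balls of radius \<open>s\<close> of a finite cover of \<open>\<Omega>\<close> costs at most the
  mean square increment of \<open>\<phi>\<close> over distances less than \<open>2 * s\<close>, which the gradient controls.\<close>

lemma local_average_bound: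
  fixes \<phi> :: "'a::euclidean_space \<Rightarrow> real" and x c :: 'a and s :: real
  defines "v \<equiv> measure lborel (ball c s)"
  assumes \<phi>: "compactly_supported \<phi>" and x: "x \<in> ball c s"
  shows "ennreal ((\<phi> x)\<^sup>2) \<le>
      ennreal (2 / v) * (\<integral>\<^sup>+h. indicator (ball 0 (2 * s)) h * ennreal ((\<phi> (x + h) - \<phi> x)\<^sup>2) \<partial>lborel)
      + ennreal (2 * ((LINT y|lborel. \<phi> y * indicator (ball c s) y) / v)\<^sup>2)"
proof -
  define B where "B = ball c s"
  have s: "0 < s" using x by (metis ball_empty empty_iff not_le)
  have fin: "emeasure lborel B < \<infinity>" unfolding B_def by (intro emeasure_bounded_finite) auto
  have v: "0 < v" unfolding v_def using content_ball_pos[OF s, of c] by simp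
  note [measurable] = compactly_supported_measurable[OF \<phi>]
  have [measurable]: "B \<in> sets borel" by (simp add: B_def)
  obtain C where C: "0 \<le> C" "\<And>x. norm (\<phi> x) \<le> C" using compactly_supported_bounded[OF \<phi>] by blast
  have iB: "integrable lborel (\<lambda>y. c * indicator B y)" for c :: real
    using fin by (intro integrable_mult_right integrable_real_indicator) auto
  have int1: "integrable lborel (\<lambda>y. indicator B y * \<phi> y)"
    by (rule Bochner_Integration.integrable_bound[OF iB[of C]])
      (use C in \<open>auto simp: indicator_def\<close>)
  have int2: "integrable lborel (\<lambda>y. indicator B y * (\<phi> y - \<phi> x)\<^sup>2)"
  proof (rule Bochner_Integration.integrable_bound[OF iB[of "(2 * C)\<^sup>2"]])
    have "\<bar>\<phi> y - \<phi> x\<bar> \<le> 2 * C" for y using C(2)[of x] C(2)[of y] by simp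
    then have "(\<phi> y - \<phi> x)\<^sup>2 \<le> (2 * C)\<^sup>2" for y
      using C(1) by (metis abs_ge_zero power2_abs power_mono)
    then show "AE y in lborel. norm (indicator B y * (\<phi> y - \<phi> x)\<^sup>2) \<le> norm ((2 * C)\<^sup>2 * indicator B y)"
      by (auto simp: indicator_def)
  qed measurable
  define m where "m = (LINT y|lborel. indicator B y * \<phi> y) / v"
  define J where "J = (LINT y|lborel. indicator B y * (\<phi> y - \<phi> x)\<^sup>2)"
  have vB: "measure lborel B = v" by (simp add: v_def B_def)
  \<comment> \<open>Nonnegativity of the variance of \<phi> on \<open>B\<close>, expanded around the
    value at \<open>x\<close>: the squared distance of that value from the mean is at most the
    average of the squared increments.\<close>
  have "0 \<le> (LINT y|lborel. indicator B y * (\<phi> y - m)\<^sup>2)"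
    by (intro integral_nonneg_AE) auto
  also have "\<dots> = (LINT y|lborel. indicator B y * (\<phi> y - \<phi> x)\<^sup>2 + 2 * (\<phi> x - m) * (indicator B y * \<phi> y)
      + (m\<^sup>2 - (\<phi> x)\<^sup>2) * indicator B y)"
    by (intro Bochner_Integration.integral_cong) (auto simp: power2_eq_square algebra_simps)
  also have "\<dots> = J + 2 * (\<phi> x - m) * (m * v) + (m\<^sup>2 - (\<phi> x)\<^sup>2) * v"
    using int1 int2 iB[of 1] v
    by (simp add: J_def m_def vB)
  also have "\<dots> = J - v * (\<phi> x - m)\<^sup>2" by (simp add: power2_eq_square algebra_simps)
  finally have "(\<phi> x - m)\<^sup>2 \<le> J / v" using v by (simp add: field_simps)
  moreover have "(\<phi> x)\<^sup>2 \<le> 2 * (\<phi> x - m)\<^sup>2 + 2 * m\<^sup>2"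
    using sum_squares_bound[of "\<phi> x - m" m] zero_le_power2[of "\<phi> x - 2 * m"]
    by (simp add: power2_eq_square algebra_simps)
  ultimately have "(\<phi> x)\<^sup>2 \<le> 2 / v * J + 2 * m\<^sup>2" by simp
  moreover have J0: "0 \<le> J" unfolding J_def by (intro integral_nonneg_AE) auto
  ultimately have \<phi>J: "ennreal ((\<phi> x)\<^sup>2) \<le> ennreal (2 / v) * ennreal J + ennreal (2 * m\<^sup>2)"
    using v by (simp add: ennreal_mult'[symmetric] ennreal_plus[symmetric] ennreal_leI del: ennreal_plus)
  have "ennreal J = (\<integral>\<^sup>+y. ennreal (indicator B y * (\<phi> y - \<phi> x)\<^sup>2) \<partial>lborel)"
    unfolding J_def by (intro nn_integral_eq_integral[symmetric] int2) auto
  also have "\<dots> = (\<integral>\<^sup>+h. ennreal (indicator B (h + x) * (\<phi> (h + x) - \<phi> x)\<^sup>2) \<partial>lborel)"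
    by (rule lborel_nn_integral_translate[symmetric]) measurable
  \<comment> \<open>Substituting \<open>y = x + h\<close>: two points of a ball of radius
    \<open>s\<close> are less than \<open>2 * s\<close> apart, so the center drops out.\<close>
  also have "\<dots> \<le> (\<integral>\<^sup>+h. indicator (ball 0 (2 * s)) h * ennreal ((\<phi> (x + h) - \<phi> x)\<^sup>2) \<partial>lborel)"
  proof (rule nn_integral_mono)
    fix h
    have "h \<in> ball 0 (2 * s)" if "h + x \<in> B"
    proof -
      have "norm h \<le> dist c (h + x) + dist c x"
        by (metis add_diff_cancel_right' dist_norm dist_triangle3 norm_minus_commute dist_commute)
      then show ?thesis using that x by (simp add: B_def)
    qed
    then show "ennreal (indicator B (h + x) * (\<phi> (h + x) - \<phi> x)\<^sup>2)
        \<le> indicator (ball 0 (2 * s)) h * ennreal ((\<phi> (x + h) - \<phi> x)\<^sup>2)"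
      by (auto simp: indicator_def add.commute)
  qed
  finally have "ennreal (2 / v) * ennreal J + ennreal (2 * m\<^sup>2) \<le>
      ennreal (2 / v) * (\<integral>\<^sup>+h. indicator (ball 0 (2 * s)) h * ennreal ((\<phi> (x + h) - \<phi> x)\<^sup>2) \<partial>lborel)
      + ennreal (2 * m\<^sup>2)"
    by (intro add_right_mono mult_left_mono) auto
  from order_trans[OF \<phi>J this] show ?thesis
    by (simp add: m_def B_def mult.commute[of "\<phi> _" "indicator _ _"])
qed

text \<open>The compact embedding in quantitative form: up to a small multiple of the gradient norm,
  finitely many functionals, the means over the balls of a cover, determine the L2 norm. Since
  \<open>C\<close> does not depend on \<phi>, the inequality passes to limits of test
  functions.\<close>

lemma Rellich_inequality:
  fixes \<Omega> :: "'a::euclidean_space set"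
  assumes "bounded \<Omega>" "0 < e"
  obtains C :: "('a, real) l2 set" where "finite C"
    "\<And>\<phi>. \<phi> \<in> test_functions \<Omega> \<Longrightarrow>
      (norm (abs_l2 \<phi>))\<^sup>2 \<le> e * (norm (abs_l2 (grad \<phi>)))\<^sup>2 + (\<Sum>c\<in>C. (abs_l2 \<phi> \<bullet> c)\<^sup>2)"
proof -
  \<comment> \<open>The gradient term arises with the factor
    \<open>2 / v * (2 * s)^2 * (2 ^ DIM('a) * v)\<close>, where the last factor is the volume of a
    ball of radius \<open>2 * s\<close>. This \<open>s\<close> makes the product equal to
    \<open>e\<close>.\<close>
  define s where "s = sqrt (e / 2 ^ (DIM('a) + 3))"
  have s: "0 < s" using assms by (simp add: s_def)
  define v where "v = measure lborel (ball (0::'a) s)"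
  have vc: "measure lborel (ball c s) = v" for c :: 'a
    using content_ball_conv_unit_ball[of s c] content_ball_conv_unit_ball[of s "0::'a"] s
    by (simp add: v_def)
  have v: "0 < v" unfolding v_def using content_ball_pos[OF s] by simp
  have v2: "measure lborel (ball (0::'a) (2 * s)) = 2 ^ DIM('a) * v"
    using content_ball_conv_unit_ball[of s "0::'a"] content_ball_conv_unit_ball[of "2 * s" "0::'a"] s
    by (simp add: v_def power_mult_distrib)
  have cpt: "compact (closure \<Omega>)" using assms by simp
  have "closure \<Omega> \<subseteq> (\<Union>c\<in>closure \<Omega>. ball c s)" using s by auto
  then obtain F where F: "finite F" "closure \<Omega> \<subseteq> (\<Union>c\<in>F. ball c s)"
    using compactE_image[OF cpt, of "closure \<Omega>" "\<lambda>c. ball c s"] by (metis open_ball)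
  have Bf: "emeasure lborel (ball c r) < \<infinity>" for c :: 'a and r
    by (intro emeasure_bounded_finite) auto
  have sqB: "square_integrable (\<lambda>x. indicat_real (ball c s) x)" for c :: 'a
  proof -
    have "ball c s \<in> sets lebesgue" by simp
    moreover have "emeasure lebesgue (ball c s) < \<infinity>" using Bf[of c s] by simp
    ultimately have "integrable lebesgue (indicat_real (ball c s))"
      by (rule integrable_real_indicator)
    moreover have "(\<lambda>x. (norm (indicat_real (ball c s) x))\<^sup>2) = indicat_real (ball c s)"
      by (auto simp: fun_eq_iff indicator_def)
    ultimately show ?thesis
      unfolding square_integrable_def by (auto intro: borel_measurable_integrable)
  qed
  define b where "b c = abs_l2 (\<lambda>x. indicat_real (ball c s) x)" for c :: 'a
  \<comment> \<open>The factor \<open>card F\<close> makes each single term over \<open>C\<close>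
    large enough to bound \<open>card F\<close> times its counterpart over \<open>F\<close>. Summing
    then requires no injectivity of the map from centers to functionals.\<close>
  define C where "C = (\<lambda>c. sqrt (real (card F) * (2 / v)) *\<^sub>R b c) ` F"
  show ?thesis
  proof (rule that[of C])
    fix \<phi> assume \<phi>: "\<phi> \<in> test_functions \<Omega>"
    note cs = test_function_compactly_supported[OF \<phi>]
    note [measurable] = compactly_supported_measurable[OF cs(1)]
    define m where "m c = abs_l2 \<phi> \<bullet> b c" for c
    have [measurable]: "Measurable.pred borel (\<lambda>x. x \<in> ball (c::'a) r)" for c r
      by (simp add: pred_def)
    have meas: "(\<lambda>y. \<phi> y * indicator (ball c s) y) \<in> borel_measurable borel" for c
      by measurable
    have m: "m c = (LINT y|lborel. \<phi> y * indicator (ball c s) y)" for c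
      unfolding m_def b_def inner_abs_l2[OF compactly_supported_square_integrable[OF cs(1)] sqB]
      using meas[of c] by (simp add: integral_completion)
    define I where "I x = (\<integral>\<^sup>+h. indicator (ball 0 (2 * s)) h * ennreal ((\<phi> (x + h) - \<phi> x)\<^sup>2) \<partial>lborel)" for x
    have [measurable]: "I \<in> borel_measurable borel"
      unfolding I_def by measurable
    define E where "E = (LINT x|lborel. (norm (grad \<phi> x))\<^sup>2)"
    have pointwise: "ennreal ((\<phi> x)\<^sup>2) \<le> ennreal (2 / v) * I x
        + (\<Sum>c\<in>F. ennreal (2 * (m c / v)\<^sup>2) * indicator (ball c s) x)" for x
    proof (cases "x \<in> \<Omega>")
      case True
      then obtain c where c: "c \<in> F" "x \<in> ball c s"
        using F(2) closure_subset by blast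
      have "ennreal ((\<phi> x)\<^sup>2) \<le> ennreal (2 / v) * I x + ennreal (2 * (m c / v)\<^sup>2) * indicator (ball c s) x"
        using local_average_bound[OF cs(1) c(2)] c(2) by (simp add: I_def m vc)
      also have "\<dots> \<le> ennreal (2 / v) * I x + (\<Sum>c\<in>F. ennreal (2 * (m c / v)\<^sup>2) * indicator (ball c s) x)"
        using F(1) c(1) by (intro add_left_mono member_le_sum) auto
      finally show ?thesis .
    qed (simp add: test_function_zero_outside[OF \<phi>])
    have I_le: "(\<integral>\<^sup>+x. I x \<partial>lborel) \<le> ennreal ((2 * s)\<^sup>2 * E * (2 ^ DIM('a) * v))"
    proof -
      \<comment> \<open>With the order of integration exchanged, the inner integral is the mean
        square increment for a fixed \<open>h\<close>, to which the translation estimate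
        applies.\<close>
      have "(\<integral>\<^sup>+x. I x \<partial>lborel) =
          (\<integral>\<^sup>+h. \<integral>\<^sup>+x. indicator (ball 0 (2 * s)) h * ennreal ((\<phi> (x + h) - \<phi> x)\<^sup>2) \<partial>lborel \<partial>lborel)"
        unfolding I_def by (rule lborel_pair.Fubini') measurable
      also have "\<dots> \<le> (\<integral>\<^sup>+h. ennreal ((2 * s)\<^sup>2 * E) * indicator (ball (0::'a) (2 * s)) h \<partial>lborel)"
      proof (rule nn_integral_mono)
        fix h :: 'a
        have "(\<integral>\<^sup>+x. ennreal ((\<phi> (x + h) - \<phi> x)\<^sup>2) \<partial>lborel) \<le> ennreal ((2 * s)\<^sup>2 * E)" if h: "h \<in> ball 0 (2 * s)"
        proof -
          have "compactly_supported (\<lambda>x. (norm (\<phi> (x + h) - \<phi> x))\<^sup>2)"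
            by (intro compactly_supported_norm_square compactly_supported_diff compactly_supported_translate cs)
          then have "(\<integral>\<^sup>+x. ennreal ((\<phi> (x + h) - \<phi> x)\<^sup>2) \<partial>lborel) = ennreal (LINT x|lborel. (\<phi> (x + h) - \<phi> x)\<^sup>2)"
            by (intro nn_integral_eq_integral) (auto dest: compactly_supported_integrable)
          also have "(LINT x|lborel. (\<phi> (x + h) - \<phi> x)\<^sup>2) \<le> (norm h)\<^sup>2 * E"
            unfolding E_def by (rule integral_translate_diff_square[OF \<phi>])
          also have "\<dots> \<le> (2 * s)\<^sup>2 * E"
            using h by (intro mult_right_mono power_mono) (auto simp: E_def)
          finally show ?thesis by (simp add: ennreal_leI)
        qed
        then show "(\<integral>\<^sup>+x. indicator (ball 0 (2 * s)) h * ennreal ((\<phi> (x + h) - \<phi> x)\<^sup>2) \<partial>lborel)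
            \<le> ennreal ((2 * s)\<^sup>2 * E) * indicator (ball (0::'a) (2 * s)) h"
          by (auto simp: indicator_def)
      qed
      also have "\<dots> = ennreal ((2 * s)\<^sup>2 * E) * ennreal (2 ^ DIM('a) * v)"
        using Bf[of 0 "2 * s"] v2 emeasure_eq_ennreal_measure[of lborel "ball (0::'a) (2 * s)"]
        by (subst nn_integral_cmult_indicator) auto
      also have "\<dots> = ennreal ((2 * s)\<^sup>2 * E * (2 ^ DIM('a) * v))"
        using v by (simp add: ennreal_mult'' E_def)
      finally show ?thesis .
    qed
    have "ennreal ((norm (abs_l2 \<phi>))\<^sup>2) = (\<integral>\<^sup>+x. ennreal ((\<phi> x)\<^sup>2) \<partial>lborel)"
      unfolding norm_abs_l2_compactly_supported[OF cs(1)]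
      using compactly_supported_integrable[OF compactly_supported_norm_square[OF cs(1)]]
      by (subst nn_integral_eq_integral) auto
    also have "\<dots> \<le> (\<integral>\<^sup>+x. ennreal (2 / v) * I x
        + (\<Sum>c\<in>F. ennreal (2 * (m c / v)\<^sup>2) * indicator (ball c s) x) \<partial>lborel)"
      by (intro nn_integral_mono pointwise)
    also have "\<dots> = ennreal (2 / v) * (\<integral>\<^sup>+x. I x \<partial>lborel) + (\<Sum>c\<in>F. ennreal (2 * (m c / v)\<^sup>2) * emeasure lborel (ball c s))"
      by (subst nn_integral_add) (auto simp: nn_integral_cmult nn_integral_sum nn_integral_cmult_indicator)
    also have "(\<Sum>c\<in>F. ennreal (2 * (m c / v)\<^sup>2) * emeasure lborel (ball c s)) = ennreal (\<Sum>c\<in>F. 2 / v * (m c)\<^sup>2)"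
    proof -
      have "ennreal (2 * (m c / v)\<^sup>2) * emeasure lborel (ball c s) = ennreal (2 / v * (m c)\<^sup>2)" for c
      proof -
        have "emeasure lborel (ball c s) = ennreal v"
          using Bf[of c s] vc[of c] emeasure_eq_ennreal_measure[of lborel "ball c s"] by simp
        then show ?thesis
          using v by (simp add: ennreal_mult'[symmetric] power2_eq_square field_simps)
      qed
      then show ?thesis using v by (simp add: sum_ennreal)
    qed
    also have "ennreal (2 / v) * (\<integral>\<^sup>+x. I x \<partial>lborel) + ennreal (\<Sum>c\<in>F. 2 / v * (m c)\<^sup>2) \<le>
        ennreal (2 / v) * ennreal ((2 * s)\<^sup>2 * E * (2 ^ DIM('a) * v)) + ennreal (\<Sum>c\<in>F. 2 / v * (m c)\<^sup>2)"
      by (intro add_right_mono mult_left_mono I_le) auto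
    also have "ennreal (2 / v) * ennreal ((2 * s)\<^sup>2 * E * (2 ^ DIM('a) * v)) = ennreal (e * E)"
    proof -
      have "2 / v * ((2 * s)\<^sup>2 * E * (2 ^ DIM('a) * v)) = (2 ^ (DIM('a) + 3) * s\<^sup>2) * E"
        using v by (simp add: power_add power_mult_distrib)
      also have "2 ^ (DIM('a) + 3) * s\<^sup>2 = e"
        using assms by (simp add: s_def)
      finally have eq: "2 / v * ((2 * s)\<^sup>2 * E * (2 ^ DIM('a) * v)) = e * E" .
      have "0 \<le> 2 / v" using v by simp
      from ennreal_mult'[OF this] show ?thesis by (metis eq)
    qed
    finally have "ennreal ((norm (abs_l2 \<phi>))\<^sup>2) \<le> ennreal (e * E) + ennreal (\<Sum>c\<in>F. 2 / v * (m c)\<^sup>2)" .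
    moreover have "0 \<le> e * E" using assms by (simp add: E_def)
    moreover have s0: "0 \<le> (\<Sum>c\<in>F. 2 / v * (m c)\<^sup>2)" using v by (intro sum_nonneg) auto
    ultimately have "(norm (abs_l2 \<phi>))\<^sup>2 \<le> e * E + (\<Sum>c\<in>F. 2 / v * (m c)\<^sup>2)"
      by (simp add: ennreal_plus[symmetric] ennreal_le_iff del: ennreal_plus)
    also have "e * E = e * (norm (abs_l2 (grad \<phi>)))\<^sup>2"
      by (simp add: E_def norm_abs_l2_compactly_supported[OF cs(2)])
    also have "(\<Sum>c\<in>F. 2 / v * (m c)\<^sup>2) \<le> (\<Sum>c\<in>C. (abs_l2 \<phi> \<bullet> c)\<^sup>2)"
    proof (cases "F = {}")
      case False
      then have n: "0 < real (card F)" using F by (simp add: card_gt_0_iff)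
      have "real (card F) * (2 / v * (m c)\<^sup>2) \<le> (\<Sum>c\<in>C. (abs_l2 \<phi> \<bullet> c)\<^sup>2)" if c: "c \<in> F" for c
      proof -
        have "real (card F) * (2 / v * (m c)\<^sup>2) = (abs_l2 \<phi> \<bullet> (sqrt (real (card F) * (2 / v)) *\<^sub>R b c))\<^sup>2"
          using v by (simp add: m_def power_mult_distrib)
        also have "\<dots> \<le> (\<Sum>c\<in>C. (abs_l2 \<phi> \<bullet> c)\<^sup>2)"
          using F(1) c by (intro member_le_sum) (auto simp: C_def)
        finally show ?thesis .
      qed
      then have "(\<Sum>c\<in>F. real (card F) * (2 / v * (m c)\<^sup>2)) \<le> (\<Sum>c\<in>F. \<Sum>c\<in>C. (abs_l2 \<phi> \<bullet> c)\<^sup>2)"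
        by (rule sum_mono)
      then have "real (card F) * (\<Sum>c\<in>F. 2 / v * (m c)\<^sup>2) \<le> real (card F) * (\<Sum>c\<in>C. (abs_l2 \<phi> \<bullet> c)\<^sup>2)"
        by (simp only: sum_distrib_left sum_constant)
      then show ?thesis using n by simp
    qed (simp add: sum_nonneg)
    finally show "(norm (abs_l2 \<phi>))\<^sup>2 \<le> e * (norm (abs_l2 (grad \<phi>)))\<^sup>2 + (\<Sum>c\<in>C. (abs_l2 \<phi> \<bullet> c)\<^sup>2)"
      by simp
  qed (use F in \<open>simp add: C_def\<close>)
qed

section \<open>The closure of the test functions\<close>

lemma subspace_closure:
  fixes S :: "'a::real_normed_vector set"
  assumes "subspace S"
  shows "subspace (closure S)"
proof (rule subspaceI)
  show "0 \<in> closure S" using subspace_0[OF assms] closure_subset by blast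
  show "x + y \<in> closure S" if xy: "x \<in> closure S" "y \<in> closure S" for x y
  proof -
    obtain f g where "\<forall>n. f n \<in> S" "f \<longlonglongrightarrow> x" "\<forall>n. g n \<in> S" "g \<longlonglongrightarrow> y"
      using xy unfolding closure_sequential by blast
    then show ?thesis
      unfolding closure_sequential
      by (intro exI[of _ "\<lambda>n. f n + g n"]) (auto intro: subspace_add[OF assms] tendsto_add)
  qed
  show "c *\<^sub>R x \<in> closure S" if x: "x \<in> closure S" for c x
  proof -
    obtain f where "\<forall>n. f n \<in> S" "f \<longlonglongrightarrow> x"
      using x unfolding closure_sequential by blast
    then show ?thesis
      unfolding closure_sequential
      by (intro exI[of _ "\<lambda>n. c *\<^sub>R f n"]) (auto intro: subspace_scale[OF assms] tendsto_intros)
  qed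
qed

text \<open>Gram-Schmidt in the span of \<open>a\<close>. The result is numbered by any set of the
  right size, since the eigenfunctions of one eigenvalue will be numbered by the positions at which
  it occurs in the sequence.\<close>

lemma orthonormal_family_of_basis:
  fixes a :: "nat \<Rightarrow> 'h::real_inner"
  assumes indep: "\<And>c. (\<Sum>i<m. c i *\<^sub>R a i) = 0 \<Longrightarrow> \<forall>i<m. c i = 0"
    and I: "finite I" "card I = m"
  shows "\<exists>b. (\<forall>i\<in>I. b i \<in> span (a ` {..<m})) \<and>
    (\<forall>i\<in>I. \<forall>j\<in>I. b i \<bullet> b j = (if i = j then 1 else 0)) \<and>
    (\<forall>w\<in>span (a ` {..<m}). (\<forall>i\<in>I. w \<bullet> b i = 0) \<longrightarrow> w = 0)"
proof -
  let ?B = "a ` {..<m}"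
  have inj: "inj_on a {..<m}"
  proof (rule inj_onI, rule ccontr)
    fix i j assume ij: "i \<in> {..<m}" "j \<in> {..<m}" "a i = a j" "i \<noteq> j"
    \<comment> \<open>Two equal vectors at different indices would satisfy the relation with
      coefficients 1 and -1.\<close>
    define c where "c k = (if k = i then 1 else 0) - (if k = j then 1 else 0::real)" for k
    have "(\<Sum>k<m. c k *\<^sub>R a k) = a i - a j"
      using ij(1,2) by (simp add: c_def scaleR_left_diff_distrib sum_subtractf if_distrib[of "\<lambda>r. r *\<^sub>R _"] cong: if_cong)
    then have "c i = 0" using indep[of c] ij by simp
    then show False using ij by (simp add: c_def)
  qed
  have "independent ?B"
  proof (rule independent_if_scalars_zero)
    fix f x assume f: "(\<Sum>x\<in>?B. f x *\<^sub>R x) = 0" and x: "x \<in> ?B"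
    have "(\<Sum>i<m. f (a i) *\<^sub>R a i) = 0" using f by (simp add: sum.reindex[OF inj])
    then show "f x = 0" using indep[of "\<lambda>i. f (a i)"] x by auto
  qed simp
  then have dB: "dim ?B = m" using card_image[OF inj] by (simp add: dim_eq_card_independent)
  obtain C where C: "finite C" "span C = span ?B" "pairwise orthogonal C"
    using basis_orthogonal[of ?B] by auto
  define C' where "C' = C - {0}"
  have C': "finite C'" "0 \<notin> C'" "pairwise orthogonal C'" "span C' = span ?B"
    using C span_delete_0[of C] by (auto simp: C'_def pairwise_def)
  have "card C' = dim C'"
    using pairwise_orthogonal_independent[OF C'(3,2)] by (simp add: dim_eq_card_independent)
  also have "\<dots> = m" using C'(4) dB by (metis dim_span)
  finally obtain f where f: "bij_betw f I C'"
    using finite_same_card_bij[of I C'] I C' by auto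
  have fC: "f i \<in> C'" if "i \<in> I" for i using f that by (auto simp: bij_betw_def)
  have fnz: "f i \<noteq> 0" if "i \<in> I" for i using fC[OF that] C' by auto
  define b where "b i = f i /\<^sub>R norm (f i)" for i
  show ?thesis
  proof (intro exI[of _ b] conjI ballI impI)
    fix i assume i: "i \<in> I"
    have "f i \<in> span ?B" using fC[OF i] C'(4) span_base by blast
    then show "b i \<in> span ?B" unfolding b_def by (rule span_scale)
    fix j assume j: "j \<in> I"
    show "b i \<bullet> b j = (if i = j then 1 else 0)"
    proof (cases "i = j")
      case True
      then show ?thesis using fnz[OF i] by (simp add: b_def dot_square_norm power2_eq_square)
    next
      case False
      then have "f i \<noteq> f j" using f i j by (auto simp: bij_betw_def inj_on_def)
      then have "f i \<bullet> f j = 0"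
        using C'(3) fC[OF i] fC[OF j] by (auto simp: pairwise_def orthogonal_def)
      then show ?thesis using False by (simp add: b_def)
    qed
  next
    fix w assume w: "w \<in> span ?B" and ortho: "\<forall>i\<in>I. w \<bullet> b i = 0"
    have "orthogonal w y" if "y \<in> C'" for y
    proof -
      have "y \<in> f ` I" using f that by (simp add: bij_betw_def)
      then obtain i where i: "i \<in> I" "y = f i" by blast
      then show ?thesis using bspec[OF ortho i(1)] fnz[OF i(1)] by (simp add: b_def orthogonal_def)
    qed
    then have "orthogonal w w" using orthogonal_to_span[of w C' w] w C'(4) by blast
    then show "w = 0" by (simp add: orthogonal_def)
  qed
qed

text \<open>The pairs \<open>(u, G)\<close> with \<open>H10 \<Omega> u G\<close>, extended by zero outside \<open>\<Omega>\<close>.\<close>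

definition H10_graph :: "'a::euclidean_space set \<Rightarrow> (('a, real) l2 \<times> ('a, 'a) l2) set"
  where "H10_graph \<Omega> = closure ((\<lambda>\<phi>. (abs_l2 \<phi>, abs_l2 (grad \<phi>))) ` test_functions \<Omega>)"

text \<open>The density argument: identities and non-strict inequalities between continuous
  expressions pass from test functions to all of H^1_0.\<close>

lemma H10_graph_induct:
  assumes "z \<in> H10_graph \<Omega>" "closed {z. P z}"
    and "\<And>\<phi>. \<phi> \<in> test_functions \<Omega> \<Longrightarrow> P (abs_l2 \<phi>, abs_l2 (grad \<phi>))"
  shows "P z"
proof -
  have "H10_graph \<Omega> \<subseteq> {z. P z}"
    unfolding H10_graph_def using assms by (intro closure_minimal) auto
  then show ?thesis using assms(1) by auto
qed

lemma test_function_in_H10_graph: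
  "\<phi> \<in> test_functions \<Omega> \<Longrightarrow> (abs_l2 \<phi>, abs_l2 (grad \<phi>)) \<in> H10_graph \<Omega>"
  unfolding H10_graph_def by (intro closure_subset[THEN subsetD] image_eqI[OF refl])

lemmas test_function_square_integrable =
  test_function_compactly_supported(1)[THEN compactly_supported_square_integrable]
  test_function_compactly_supported(2)[THEN compactly_supported_square_integrable]

lemma grad_test_add:
  assumes "\<phi> \<in> test_functions \<Omega>" "\<psi> \<in> test_functions \<Omega>"
  shows "grad (\<lambda>x. \<phi> x + \<psi> x) = (\<lambda>x. grad \<phi> x + grad \<psi> x)"
  using assms by (intro ext grad_add test_function_differentiable)

lemma grad_test_scale:
  assumes "\<phi> \<in> test_functions \<Omega>"
  shows "grad (\<lambda>x. c * \<phi> x) = (\<lambda>x. c *\<^sub>R grad \<phi> x)"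
  using grad_mult[of "\<lambda>x. c" _ \<phi>] test_function_differentiable[OF assms]
  by (simp add: fun_eq_iff grad_const)

lemma subspace_H10_graph: "subspace (H10_graph \<Omega>)"
  unfolding H10_graph_def
proof (intro subspace_closure subspaceI; clarify?)
  let ?S = "(\<lambda>\<phi>. (abs_l2 \<phi>, abs_l2 (grad \<phi>))) ` test_functions \<Omega>"
  have "(abs_l2 (\<lambda>x. 0), abs_l2 (grad (\<lambda>x. 0))) \<in> ?S"
    by (rule imageI) (rule test_functions_zero)
  then show "0 \<in> ?S" by (simp add: grad_const[abs_def] abs_l2_zero zero_prod_def)
next
  fix \<phi> \<psi> assume t: "\<phi> \<in> test_functions \<Omega>" "\<psi> \<in> test_functions \<Omega>"
  show "(abs_l2 \<phi>, abs_l2 (grad \<phi>)) + (abs_l2 \<psi>, abs_l2 (grad \<psi>))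
      \<in> (\<lambda>\<phi>. (abs_l2 \<phi>, abs_l2 (grad \<phi>))) ` test_functions \<Omega>"
    using t by (intro image_eqI[OF _ test_functions_add[OF t]])
      (simp add: grad_test_add[OF t] abs_l2_add t[THEN test_function_square_integrable(1)]
        t[THEN test_function_square_integrable(2)])
next
  fix c :: real and \<phi> assume t: "\<phi> \<in> test_functions \<Omega>"
  show "c *\<^sub>R (abs_l2 \<phi>, abs_l2 (grad \<phi>))
      \<in> (\<lambda>\<phi>. (abs_l2 \<phi>, abs_l2 (grad \<phi>))) ` test_functions \<Omega>"
    using t by (intro image_eqI[OF _ test_functions_mult[OF t cont_diff_const[of _ c]]])
      (simp add: grad_test_scale[OF t] abs_l2_scaleR test_function_square_integrable[OF t])
qed

lemma gradient_graph_H10_graph: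
  assumes "bounded \<Omega>"
  shows "gradient_graph (H10_graph \<Omega>)"
proof
  show "subspace (H10_graph \<Omega>)" by (rule subspace_H10_graph)
  show "closed (H10_graph \<Omega>)" by (simp add: H10_graph_def)
  fix e :: real assume "0 < e"
  then obtain C where C: "finite C" and test: "\<And>\<phi>. \<phi> \<in> test_functions \<Omega> \<Longrightarrow>
      (norm (abs_l2 \<phi>))\<^sup>2 \<le> e * (norm (abs_l2 (grad \<phi>)))\<^sup>2 + (\<Sum>c\<in>C. (abs_l2 \<phi> \<bullet> c)\<^sup>2)"
    using Rellich_inequality[OF assms] by blast
  have "(norm (fst z))\<^sup>2 \<le> e * (norm (snd z))\<^sup>2 + (\<Sum>c\<in>C. (fst z \<bullet> c)\<^sup>2)" if "z \<in> H10_graph \<Omega>" for z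
    using that
  proof (rule H10_graph_induct)
    show "closed {z. (norm (fst z))\<^sup>2 \<le> e * (norm (snd z))\<^sup>2 + (\<Sum>c\<in>C. (fst z \<bullet> c)\<^sup>2)}"
      by (intro closed_Collect_le continuous_intros)
  qed (simp add: test)
  with C show "\<exists>C. finite C \<and> (\<forall>(w, r)\<in>H10_graph \<Omega>. (norm w)\<^sup>2 \<le> e * (norm r)\<^sup>2 + (\<Sum>c\<in>C. (w \<bullet> c)\<^sup>2))"
    by (intro exI[of _ C]) force
qed

text \<open>The coordinate is cut off outside \<open>\<Omega>\<close> to make multiplication by it bounded.\<close>

definition coordinate_op :: "'a set \<Rightarrow> 'a \<Rightarrow> ('a::euclidean_space, 'b::euclidean_space) l2 \<Rightarrow> ('a, 'b) l2"
  where "coordinate_op \<Omega> e = pointwise_op (\<lambda>x v. (indicator \<Omega> x * (x \<bullet> e)) *\<^sub>R v)"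

definition vector_op :: "'a \<Rightarrow> ('a::euclidean_space, real) l2 \<Rightarrow> ('a, 'a) l2"
  where "vector_op e = pointwise_op (\<lambda>x v. v *\<^sub>R e)"

definition component_op :: "'a \<Rightarrow> ('a::euclidean_space, 'a) l2 \<Rightarrow> ('a, real) l2"
  where "component_op e = pointwise_op (\<lambda>x v. v \<bullet> e)"

lemma bounded_pointwise_coordinate:
  fixes \<Omega> :: "'a::euclidean_space set"
  assumes "open \<Omega>" "bounded \<Omega>"
  shows "bounded_pointwise (\<lambda>x v. (indicator \<Omega> x * (x \<bullet> e)) *\<^sub>R v :: 'b::euclidean_space)"
  unfolding bounded_pointwise_def
proof (intro conjI allI ballI)
  obtain R where R: "\<And>x. x \<in> \<Omega> \<Longrightarrow> norm x \<le> R"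
    using assms by (auto simp: bounded_iff)
  have "norm ((indicator \<Omega> x * (x \<bullet> e)) *\<^sub>R v) \<le> (\<bar>R\<bar> * norm e) * norm v" for x and v :: 'b
  proof -
    have "\<bar>indicator \<Omega> x * (x \<bullet> e)\<bar> \<le> \<bar>R\<bar> * norm e"
    proof (cases "x \<in> \<Omega>")
      case True
      have "\<bar>x \<bullet> e\<bar> \<le> norm x * norm e" by (rule Cauchy_Schwarz_ineq2)
      also have "\<dots> \<le> \<bar>R\<bar> * norm e" using R[OF True] by (intro mult_right_mono) auto
      finally show ?thesis using True by simp
    qed simp
    then show ?thesis by (simp add: mult_right_mono)
  qed
  then show "\<exists>K. \<forall>x (v::'b). norm ((indicator \<Omega> x * (x \<bullet> e)) *\<^sub>R v) \<le> K * norm v"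
    by blast
  fix f :: "'a \<Rightarrow> 'b" assume f: "f \<in> borel_measurable lebesgue"
  have "\<Omega> \<in> sets lebesgue" using assms by (simp add: borel_open sets_completionI_sets)
  moreover have "(\<lambda>x. x \<bullet> e) \<in> borel_measurable lebesgue"
    by (intro measurable_completion) simp
  ultimately show "(\<lambda>x. (indicator \<Omega> x * (x \<bullet> e)) *\<^sub>R f x) \<in> borel_measurable lebesgue"
    using f by (intro borel_measurable_scaleR borel_measurable_times borel_measurable_indicator)
qed (auto intro!: linearI simp: algebra_simps)

lemma bounded_pointwise_vector: "bounded_pointwise (\<lambda>x v. v *\<^sub>R e)"
  unfolding bounded_pointwise_def
  by (auto intro!: linearI exI[of _ "norm e"] simp: algebra_simps)

lemma bounded_pointwise_component: "bounded_pointwise (\<lambda>x v. v \<bullet> e)"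
  unfolding bounded_pointwise_def
  by (auto intro!: linearI exI[of _ "norm e"] simp: inner_add_left Cauchy_Schwarz_ineq2 mult.commute[of "norm e"])

lemma bounded_linear_coordinate_op:
  "open \<Omega> \<Longrightarrow> bounded \<Omega> \<Longrightarrow> bounded_linear (coordinate_op \<Omega> e)"
  unfolding coordinate_op_def by (intro bounded_linear_pointwise_op bounded_pointwise_coordinate)

lemma bounded_linear_vector_op: "bounded_linear (vector_op e)"
  unfolding vector_op_def by (intro bounded_linear_pointwise_op bounded_pointwise_vector)

lemma bounded_linear_component_op: "bounded_linear (component_op e)"
  unfolding component_op_def by (intro bounded_linear_pointwise_op bounded_pointwise_component)

text \<open>On test functions the two conditions on the graph are the Leibniz rule and integration
  by parts. All four operators are bounded, so the conditions are closed and density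
  applies.\<close>

lemma coordinate_multiplication_H10_graph:
  assumes \<Omega>: "open \<Omega>" "bounded \<Omega>" and e: "norm e = 1"
  shows "coordinate_multiplication (H10_graph \<Omega>) (coordinate_op \<Omega> e) (coordinate_op \<Omega> e)
    (vector_op e) (component_op e)"
proof -
  interpret gradient_graph "H10_graph \<Omega>" using \<Omega>(2) by (rule gradient_graph_H10_graph)
  note bp = bounded_pointwise_coordinate[OF \<Omega>] bounded_pointwise_vector bounded_pointwise_component
  note sq = bp[THEN square_integrable_pointwise]
  note defs = coordinate_op_def vector_op_def component_op_def
  note bl = bounded_linear_coordinate_op[OF \<Omega>] bounded_linear_vector_op bounded_linear_component_op
  show ?thesis
  proof
    show "coordinate_op \<Omega> e p \<bullet> p' = p \<bullet> coordinate_op \<Omega> e p'" for p p' :: "('a, real) l2"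
      unfolding defs by (intro pointwise_op_adjoint bp) simp
    show "coordinate_op \<Omega> e q \<bullet> q' = q \<bullet> coordinate_op \<Omega> e q'" for q q' :: "('a, 'a) l2"
      unfolding defs by (intro pointwise_op_adjoint bp) simp
    have ee: "e \<bullet> e = 1" using e by (simp add: norm_eq_1)
    show "vector_op e p \<bullet> vector_op e p' = p \<bullet> p'" for p p'
      unfolding defs
      by (cases p; cases p') (simp add: pointwise_op_abs bp inner_abs_l2 sq ee mult.commute)
    show "coordinate_op \<Omega> e (vector_op e p) = vector_op e (coordinate_op \<Omega> e p)" for p
    proof (cases p)
      case (1 f)
      show ?thesis
        unfolding defs 1(2) pointwise_op_abs[OF bp(1) 1(1)] pointwise_op_abs[OF bp(2) 1(1)]
          pointwise_op_abs[OF bp(1) sq(2)[OF 1(1)]] pointwise_op_abs[OF bp(2) sq(1)[OF 1(1)]]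
        by (simp add: mult.commute)
    qed
    show "q \<bullet> vector_op e p = component_op e q \<bullet> p" for q p
      unfolding defs
      by (rule pointwise_op_adjoint[symmetric, OF bp(3,2)]) (simp add: mult.commute)
    show "(coordinate_op \<Omega> e p, coordinate_op \<Omega> e q + vector_op e p) \<in> H10_graph \<Omega>"
      if "(p, q) \<in> H10_graph \<Omega>" for p q
    proof -
      have "(coordinate_op \<Omega> e (fst z), coordinate_op \<Omega> e (snd z) + vector_op e (fst z)) \<in> H10_graph \<Omega>"
        if "z \<in> H10_graph \<Omega>" for z
        using that
      proof (rule H10_graph_induct)
        have "continuous_on UNIV (\<lambda>z. (coordinate_op \<Omega> e (fst z), coordinate_op \<Omega> e (snd z) + vector_op e (fst z)))"
          by (intro continuous_intros bl[THEN bounded_linear.continuous_on])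
        from closed_vimage[OF closed_H this]
        show "closed {z. (coordinate_op \<Omega> e (fst z), coordinate_op \<Omega> e (snd z) + vector_op e (fst z)) \<in> H10_graph \<Omega>}"
          by (simp add: vimage_def)
        fix \<phi> assume \<phi>: "\<phi> \<in> test_functions \<Omega>"
        note sq\<phi> = test_function_square_integrable[OF \<phi>]
        have t: "(\<lambda>x. (x \<bullet> e) * \<phi> x) \<in> test_functions \<Omega>"
          by (intro test_functions_mult \<phi> cont_diff_inner)
        \<comment> \<open>The cutoff is invisible on test functions, which vanish with their
          gradients outside \<Omega>; hence it does not disturb the Leibniz rule.\<close>
        have "(\<lambda>x. (indicator \<Omega> x * (x \<bullet> e)) *\<^sub>R \<phi> x) = (\<lambda>x. (x \<bullet> e) * \<phi> x)"
          using test_function_zero_outside(1)[OF \<phi>] by (auto simp: fun_eq_iff indicator_def)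
        moreover have "(\<lambda>x. (indicator \<Omega> x * (x \<bullet> e)) *\<^sub>R grad \<phi> x + \<phi> x *\<^sub>R e) = grad (\<lambda>x. (x \<bullet> e) * \<phi> x)"
        proof
          fix x
          have "(\<lambda>x. x \<bullet> e) differentiable at x" using cont_diff_inner[of "Suc 0" e] by simp
          then have "grad (\<lambda>x. (x \<bullet> e) * \<phi> x) x = (x \<bullet> e) *\<^sub>R grad \<phi> x + \<phi> x *\<^sub>R e"
            using test_function_differentiable[OF \<phi>] by (simp add: grad_mult grad_inner)
          then show "(indicator \<Omega> x * (x \<bullet> e)) *\<^sub>R grad \<phi> x + \<phi> x *\<^sub>R e = grad (\<lambda>x. (x \<bullet> e) * \<phi> x) x"
            using test_function_zero_outside[OF \<phi>, of x] by (auto simp: indicator_def)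
        qed
        moreover have "coordinate_op \<Omega> e (abs_l2 \<phi>) = abs_l2 (\<lambda>x. (indicator \<Omega> x * (x \<bullet> e)) *\<^sub>R \<phi> x)"
          unfolding defs by (rule pointwise_op_abs[OF bp(1) sq\<phi>(1)])
        moreover have "coordinate_op \<Omega> e (abs_l2 (grad \<phi>)) + vector_op e (abs_l2 \<phi>) =
            abs_l2 (\<lambda>x. (indicator \<Omega> x * (x \<bullet> e)) *\<^sub>R grad \<phi> x + \<phi> x *\<^sub>R e)"
          unfolding defs pointwise_op_abs[OF bp(1) sq\<phi>(2)] pointwise_op_abs[OF bp(2) sq\<phi>(1)]
          by (intro abs_l2_add sq sq\<phi>)
        ultimately show "(coordinate_op \<Omega> e (fst (abs_l2 \<phi>, abs_l2 (grad \<phi>))),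
            coordinate_op \<Omega> e (snd (abs_l2 \<phi>, abs_l2 (grad \<phi>))) + vector_op e (fst (abs_l2 \<phi>, abs_l2 (grad \<phi>))))
            \<in> H10_graph \<Omega>"
          using test_function_in_H10_graph[OF t] by (simp only: fst_conv snd_conv)
      qed
      from this[OF that] show ?thesis by simp
    qed
    show "component_op e q \<bullet> p' = - (p \<bullet> component_op e q')"
      if "(p, q) \<in> H10_graph \<Omega>" "(p', q') \<in> H10_graph \<Omega>" for p q p' q'
    proof -
      \<comment> \<open>Density is used in one argument at a time, with the other held
        fixed.\<close>
      have *: "component_op e (snd z) \<bullet> fst z' = - (fst z \<bullet> component_op e (snd z'))"
        if z: "z \<in> H10_graph \<Omega>" "z' \<in> H10_graph \<Omega>" for z z'
        using z(1)
      proof (rule H10_graph_induct)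
        show "closed {z. component_op e (snd z) \<bullet> fst z' = - (fst z \<bullet> component_op e (snd z'))}"
          by (intro closed_Collect_eq continuous_intros bl[THEN bounded_linear.continuous_on])
        fix \<phi> assume \<phi>: "\<phi> \<in> test_functions \<Omega>"
        let ?\<phi> = "(abs_l2 \<phi>, abs_l2 (grad \<phi>))"
        show "component_op e (snd ?\<phi>) \<bullet> fst z' = - (fst ?\<phi> \<bullet> component_op e (snd z'))"
          using z(2)
        proof (rule H10_graph_induct)
          show "closed {z'. component_op e (snd ?\<phi>) \<bullet> fst z' = - (fst ?\<phi> \<bullet> component_op e (snd z'))}"
            by (intro closed_Collect_eq continuous_intros bl[THEN bounded_linear.continuous_on])
          fix \<psi> assume \<psi>: "\<psi> \<in> test_functions \<Omega>"
          have m [measurable]: "f \<in> borel_measurable borel" "grad f \<in> borel_measurable borel"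
            if "f \<in> test_functions \<Omega>" for f
            using test_function_compactly_supported[OF that] by (auto intro: compactly_supported_measurable)
          have "(LINT x|lebesgue. (grad \<phi> x \<bullet> e) * \<psi> x) = - (LINT x|lebesgue. \<phi> x * (grad \<psi> x \<bullet> e))"
            using integration_by_parts[OF \<phi> \<psi>, of e] m[OF \<phi>] m[OF \<psi>]
            by (subst (1 2) integral_completion) auto
          then show "component_op e (snd ?\<phi>) \<bullet> fst (abs_l2 \<psi>, abs_l2 (grad \<psi>))
              = - (fst ?\<phi> \<bullet> component_op e (snd (abs_l2 \<psi>, abs_l2 (grad \<psi>))))"
            unfolding defs
            by (simp add: pointwise_op_abs bp sq inner_abs_l2 test_function_square_integrable[OF \<phi>]
              test_function_square_integrable[OF \<psi>])
        qed
      qed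
      from *[OF that] show ?thesis by simp
    qed
  qed
qed

text \<open>Pointwise Parseval, integrated. \<open>B\<close> is left general because Yang's
  inequality is summed over the standard axes and the gap inequality over rotated ones.\<close>

lemma sum_component_op_norm:
  fixes B :: "'a::euclidean_space set"
  assumes "finite B" and B: "\<And>v::'a. (\<Sum>e\<in>B. (v \<bullet> e)\<^sup>2) = (norm v)\<^sup>2"
  shows "(\<Sum>e\<in>B. (norm (component_op e q))\<^sup>2) = (norm q)\<^sup>2"
proof (cases q)
  case (1 f)
  note sq = square_integrable_pointwise[OF bounded_pointwise_component 1(1)]
  have "(\<Sum>e\<in>B. (norm (component_op e q))\<^sup>2) = (\<Sum>e\<in>B. LINT x|lebesgue. (f x \<bullet> e)\<^sup>2)"
    using 1 by (simp add: component_op_def pointwise_op_abs bounded_pointwise_component norm_abs_l2 sq)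
  also have "\<dots> = (LINT x|lebesgue. (\<Sum>e\<in>B. (f x \<bullet> e)\<^sup>2))"
    using sq by (intro Bochner_Integration.integral_sum[symmetric]) (simp add: square_integrable_def)
  also have "\<dots> = (norm q)\<^sup>2"
    using 1 by (simp add: B norm_abs_l2)
  finally show ?thesis .
qed

section \<open>Eigenspaces\<close>

definition extend_zero :: "'a set \<Rightarrow> ('a::euclidean_space \<Rightarrow> 'b::euclidean_space) \<Rightarrow> 'a \<Rightarrow> 'b"
  where "extend_zero \<Omega> u x = indicator \<Omega> x *\<^sub>R u x"

lemma open_sets_lebesgue: "open \<Omega> \<Longrightarrow> \<Omega> \<inter> space lebesgue \<in> sets lebesgue"
  by (simp add: borel_open sets_completionI_sets)

lemma extend_zero_eq: "(\<And>x. x \<notin> \<Omega> \<Longrightarrow> f x = 0) \<Longrightarrow> extend_zero \<Omega> f = f"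
  by (auto simp: extend_zero_def indicator_def fun_eq_iff)

lemma norm_extend_zero_square: "(norm (extend_zero \<Omega> u x))\<^sup>2 = indicator \<Omega> x *\<^sub>R (norm (u x))\<^sup>2"
  by (simp add: extend_zero_def indicator_def)

lemma L2_iff_square_integrable:
  assumes "open \<Omega>"
  shows "L2 \<Omega> u \<longleftrightarrow> square_integrable (extend_zero \<Omega> u)"
  unfolding L2_def square_integrable_def norm_extend_zero_square
    borel_measurable_restrict_space_iff[OF open_sets_lebesgue[OF assms]]
    integrable_restrict_space[OF open_sets_lebesgue[OF assms]]
  by (simp add: extend_zero_def[abs_def])

lemma square_integrable_extend_zero:
  assumes "open \<Omega>" "square_integrable f"
  shows "square_integrable (extend_zero \<Omega> f)"
proof (rule square_integrable_bound[OF _ assms(2), of _ 1])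
  have "\<Omega> \<in> sets lebesgue" using open_sets_lebesgue[OF assms(1)] by simp
  then show "extend_zero \<Omega> f \<in> borel_measurable lebesgue"
    using assms(2) unfolding extend_zero_def[abs_def] square_integrable_def
    by (intro borel_measurable_scaleR borel_measurable_indicator) auto
qed (auto simp: extend_zero_def indicator_def)

lemma inner_extend_zero:
  assumes \<Omega>: "open \<Omega>" and "square_integrable (extend_zero \<Omega> u)" "square_integrable (extend_zero \<Omega> w)"
  shows "abs_l2 (extend_zero \<Omega> u) \<bullet> abs_l2 (extend_zero \<Omega> w) = (LINT x|lebesgue_on \<Omega>. u x \<bullet> w x)"
proof -
  have "(LINT x|lebesgue_on \<Omega>. u x \<bullet> w x) = (LINT x|lebesgue. indicator \<Omega> x *\<^sub>R (u x \<bullet> w x))"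
    by (rule integral_restrict_space[OF open_sets_lebesgue[OF \<Omega>]])
  also have "\<dots> = (LINT x|lebesgue. extend_zero \<Omega> u x \<bullet> extend_zero \<Omega> w x)"
    by (intro Bochner_Integration.integral_cong) (auto simp: extend_zero_def indicator_def)
  finally show ?thesis using assms by (simp add: inner_abs_l2)
qed

lemma norm_diff_extend_zero:
  assumes \<Omega>: "open \<Omega>" and "square_integrable (extend_zero \<Omega> u)" "square_integrable (extend_zero \<Omega> w)"
  shows "(norm (abs_l2 (extend_zero \<Omega> u) - abs_l2 (extend_zero \<Omega> w)))\<^sup>2
    = (LINT x|lebesgue_on \<Omega>. (norm (u x - w x))\<^sup>2)"
proof -
  have d: "abs_l2 (extend_zero \<Omega> u) - abs_l2 (extend_zero \<Omega> w) = abs_l2 (extend_zero \<Omega> (\<lambda>x. u x - w x))"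
    unfolding abs_l2_diff[OF assms(2,3)] by (simp add: extend_zero_def[abs_def] scaleR_diff_right)
  have "square_integrable (extend_zero \<Omega> (\<lambda>x. u x - w x))"
    using square_integrable_diff[OF assms(2,3)] by (simp add: extend_zero_def[abs_def] scaleR_diff_right)
  then show ?thesis
    unfolding d using inner_extend_zero[OF \<Omega>, of "\<lambda>x. u x - w x" "\<lambda>x. u x - w x"]
    by (simp add: power2_norm_eq_inner)
qed

lemma extend_zero_test:
  assumes "\<phi> \<in> test_functions \<Omega>"
  shows "extend_zero \<Omega> \<phi> = \<phi>" "extend_zero \<Omega> (grad \<phi>) = grad \<phi>"
  using test_function_zero_outside[OF assms] by (auto intro!: extend_zero_eq)

lemma H10_imp_H10_graph:
  assumes \<Omega>: "open \<Omega>" and u: "H10 \<Omega> u G"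
  shows "(abs_l2 (extend_zero \<Omega> u), abs_l2 (extend_zero \<Omega> G)) \<in> H10_graph \<Omega>"
proof -
  have sq: "square_integrable (extend_zero \<Omega> u)" "square_integrable (extend_zero \<Omega> G)"
    using u L2_iff_square_integrable[OF \<Omega>] by (auto simp: H10_def)
  obtain \<phi> where \<phi>: "\<And>n. \<phi> n \<in> test_functions \<Omega>" and
    lim: "(\<lambda>n. (LINT x|lebesgue_on \<Omega>. (\<phi> n x - u x)\<^sup>2)
         + (LINT x|lebesgue_on \<Omega>. (norm (grad (\<phi> n) x - G x))\<^sup>2)) \<longlonglongrightarrow> 0"
    using u by (auto simp: H10_def)
  let ?a = "\<lambda>n. abs_l2 (\<phi> n) - abs_l2 (extend_zero \<Omega> u)"
  let ?b = "\<lambda>n. abs_l2 (grad (\<phi> n)) - abs_l2 (extend_zero \<Omega> G)"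
  note t = test_function_square_integrable[OF \<phi>] extend_zero_test[OF \<phi>]
  have "(norm (?a n))\<^sup>2 = (LINT x|lebesgue_on \<Omega>. (\<phi> n x - u x)\<^sup>2)" for n
    using norm_diff_extend_zero[OF \<Omega> _ sq(1), of "\<phi> n"] t by simp
  moreover have "(norm (?b n))\<^sup>2 = (LINT x|lebesgue_on \<Omega>. (norm (grad (\<phi> n) x - G x))\<^sup>2)" for n
    using norm_diff_extend_zero[OF \<Omega> _ sq(2), of "grad (\<phi> n)"] t by simp
  ultimately have lim': "(\<lambda>n. (norm (?a n))\<^sup>2 + (norm (?b n))\<^sup>2) \<longlonglongrightarrow> 0"
    using lim by simp
  have a2: "(\<lambda>n. (norm (?a n))\<^sup>2) \<longlonglongrightarrow> 0"
    by (rule Lim_null_comparison[OF _ lim']) simp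
  have b2: "(\<lambda>n. (norm (?b n))\<^sup>2) \<longlonglongrightarrow> 0"
    by (rule Lim_null_comparison[OF _ lim']) simp
  have "(\<lambda>n. abs_l2 (\<phi> n)) \<longlonglongrightarrow> abs_l2 (extend_zero \<Omega> u)"
    using tendsto_real_sqrt[OF a2] by (auto intro!: LIM_zero_cancel[OF tendsto_norm_zero_cancel])
  moreover have "(\<lambda>n. abs_l2 (grad (\<phi> n))) \<longlonglongrightarrow> abs_l2 (extend_zero \<Omega> G)"
    using tendsto_real_sqrt[OF b2] by (auto intro!: LIM_zero_cancel[OF tendsto_norm_zero_cancel])
  ultimately have "(\<lambda>n. (abs_l2 (\<phi> n), abs_l2 (grad (\<phi> n)))) \<longlonglongrightarrow> (abs_l2 (extend_zero \<Omega> u), abs_l2 (extend_zero \<Omega> G))"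
    by (rule tendsto_Pair)
  then show ?thesis
    by (intro closed_sequentially[OF _ test_function_in_H10_graph[OF \<phi>]]) (simp add: H10_graph_def)
qed

text \<open>Multiplication by the indicator of \<Omega> is bounded and fixes test functions, hence
  also their closure. A class in the graph can thus be read as a function on \<Omega> without
  loss.\<close>

lemma H10_graph_supported:
  assumes \<Omega>: "open \<Omega>" and z: "(p, q) \<in> H10_graph \<Omega>"
  shows "abs_l2 (extend_zero \<Omega> (rep_l2 p)) = p" "abs_l2 (extend_zero \<Omega> (rep_l2 q)) = q"
proof -
  have bp: "bounded_pointwise (\<lambda>x v. indicator \<Omega> x *\<^sub>R v :: 'b::euclidean_space)"
    unfolding bounded_pointwise_def
  proof (intro conjI allI ballI)
    show "\<exists>K. \<forall>x (v::'b). norm (indicator \<Omega> x *\<^sub>R v) \<le> K * norm v"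
      by (intro exI[of _ 1]) (auto simp: indicator_def)
    have "\<Omega> \<in> sets lebesgue" using open_sets_lebesgue[OF \<Omega>] by simp
    then show "(\<lambda>x. indicator \<Omega> x *\<^sub>R f x) \<in> borel_measurable lebesgue"
      if "f \<in> borel_measurable lebesgue" for f :: "'a \<Rightarrow> 'b"
      using that by (intro borel_measurable_scaleR borel_measurable_indicator)
  qed (auto intro!: linearI simp: algebra_simps)
  note bl = bounded_linear_pointwise_op[OF bp]
  have *: "pointwise_op (\<lambda>x v. indicator \<Omega> x *\<^sub>R v) (fst z) = fst z \<and>
      pointwise_op (\<lambda>x v. indicator \<Omega> x *\<^sub>R v) (snd z) = snd z" if "z \<in> H10_graph \<Omega>" for z
    using that
  proof (rule H10_graph_induct)
    show "closed {z::('a, real) l2 \<times> ('a, 'a) l2. pointwise_op (\<lambda>x v. indicator \<Omega> x *\<^sub>R v) (fst z) = fst z \<and>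
        pointwise_op (\<lambda>x v. indicator \<Omega> x *\<^sub>R v) (snd z) = snd z}"
      by (intro closed_Collect_conj closed_Collect_eq continuous_intros bl[THEN bounded_linear.continuous_on])
    fix \<phi> assume \<phi>: "\<phi> \<in> test_functions \<Omega>"
    note sq = test_function_square_integrable[OF \<phi>]
    show "pointwise_op (\<lambda>x v. indicator \<Omega> x *\<^sub>R v) (fst (abs_l2 \<phi>, abs_l2 (grad \<phi>))) = fst (abs_l2 \<phi>, abs_l2 (grad \<phi>)) \<and>
        pointwise_op (\<lambda>x v. indicator \<Omega> x *\<^sub>R v) (snd (abs_l2 \<phi>, abs_l2 (grad \<phi>))) = snd (abs_l2 \<phi>, abs_l2 (grad \<phi>))"
      unfolding fst_conv snd_conv pointwise_op_abs[OF bp sq(1)] pointwise_op_abs[OF bp sq(2)]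
      using extend_zero_test[OF \<phi>] by (simp add: extend_zero_def[abs_def])
  qed
  from *[OF z] show "abs_l2 (extend_zero \<Omega> (rep_l2 p)) = p" "abs_l2 (extend_zero \<Omega> (rep_l2 q)) = q"
    by (simp_all add: pointwise_op_def extend_zero_def[abs_def])
qed

context
  fixes \<Omega> :: "'a::euclidean_space set"
  assumes \<Omega>: "open \<Omega>" "bounded \<Omega>"
begin

interpretation gradient_graph "H10_graph \<Omega>"
  using \<Omega>(2) by (rule gradient_graph_H10_graph)

text \<open>The distributional equation is tested with test functions only; both sides depend
  continuously on the test pair, so it extends to the closure.\<close>

lemma eigenspace_imp_eigenpair:
  assumes "u \<in> eigenspace \<Omega> \<mu>"
  shows "square_integrable (extend_zero \<Omega> u)" "\<exists>q. eigenpair \<mu> (abs_l2 (extend_zero \<Omega> u)) q"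
proof -
  obtain G where G: "H10 \<Omega> u G" and weak: "\<And>\<phi>. \<phi> \<in> test_functions \<Omega> \<Longrightarrow>
      (LINT x|lebesgue_on \<Omega>. G x \<bullet> grad \<phi> x) = (LINT x|lebesgue_on \<Omega>. \<mu> * u x * \<phi> x)"
    using assms by (auto simp: eigenspace_def dirichlet_laplacian_def)
  have sq: "square_integrable (extend_zero \<Omega> u)" "square_integrable (extend_zero \<Omega> G)"
    using G L2_iff_square_integrable[OF \<Omega>(1)] by (auto simp: H10_def)
  show "square_integrable (extend_zero \<Omega> u)" by (rule sq)
  let ?p = "abs_l2 (extend_zero \<Omega> u)" and ?q = "abs_l2 (extend_zero \<Omega> G)"
  have "?q \<bullet> snd z = \<mu> * (?p \<bullet> fst z)" if "z \<in> H10_graph \<Omega>" for z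
    using that
  proof (rule H10_graph_induct)
    show "closed {z. ?q \<bullet> snd z = \<mu> * (?p \<bullet> fst z)}"
      by (intro closed_Collect_eq continuous_intros)
    fix \<phi> assume \<phi>: "\<phi> \<in> test_functions \<Omega>"
    note t = test_function_square_integrable[OF \<phi>] extend_zero_test[OF \<phi>]
    have "?q \<bullet> abs_l2 (grad \<phi>) = (LINT x|lebesgue_on \<Omega>. G x \<bullet> grad \<phi> x)"
      using inner_extend_zero[OF \<Omega>(1) sq(2), of "grad \<phi>"] t by simp
    also have "\<dots> = \<mu> * (LINT x|lebesgue_on \<Omega>. u x \<bullet> \<phi> x)"
      unfolding weak[OF \<phi>] by (simp add: mult.assoc)
    also have "\<dots> = \<mu> * (?p \<bullet> abs_l2 \<phi>)"
      using inner_extend_zero[OF \<Omega>(1) sq(1), of "\<phi>"] t by simp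
    finally show "?q \<bullet> snd (abs_l2 \<phi>, abs_l2 (grad \<phi>)) = \<mu> * (?p \<bullet> fst (abs_l2 \<phi>, abs_l2 (grad \<phi>)))"
      by simp
  qed
  then have "eigenpair \<mu> ?p ?q"
    unfolding eigenpair_def using H10_imp_H10_graph[OF \<Omega>(1) G] by force
  then show "\<exists>q. eigenpair \<mu> ?p q" by blast
qed

text \<open>The weak gradient required by \<open>H10\<close> comes from skewness of the directional
  derivatives on the graph, and the approximating sequence is what lying in a closure means. The
  equation itself is the special case of test functions.\<close>

lemma eigenpair_imp_eigenspace:
  assumes pq: "eigenpair \<mu> p q"
  shows "rep_l2 p \<in> eigenspace \<Omega> \<mu>" "abs_l2 (extend_zero \<Omega> (rep_l2 p)) = p"
proof -
  have H: "(p, q) \<in> H10_graph \<Omega>" using pq by (rule eigenpairD)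
  note supp = H10_graph_supported[OF \<Omega>(1) H]
  show "abs_l2 (extend_zero \<Omega> (rep_l2 p)) = p" by (rule supp)
  let ?u = "rep_l2 p" and ?G = "rep_l2 q"
  have sq: "square_integrable (extend_zero \<Omega> ?u)" "square_integrable (extend_zero \<Omega> ?G)"
    by (auto intro: square_integrable_extend_zero \<Omega>)
  have inner_p: "p \<bullet> abs_l2 f = (LINT x|lebesgue_on \<Omega>. ?u x \<bullet> f x)"
    if "square_integrable f" "extend_zero \<Omega> f = f" for f
    using inner_extend_zero[OF \<Omega>(1) sq(1), of f] that supp by simp
  have inner_q: "q \<bullet> abs_l2 f = (LINT x|lebesgue_on \<Omega>. ?G x \<bullet> f x)"
    if "square_integrable f" "extend_zero \<Omega> f = f" for f
    using inner_extend_zero[OF \<Omega>(1) sq(2), of f] that supp by simp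
  have "weak_gradient \<Omega> ?u ?G"
    unfolding weak_gradient_def
  proof (intro ballI)
    fix \<phi> and b :: 'a assume \<phi>: "\<phi> \<in> test_functions \<Omega>" and b: "b \<in> Basis"
    interpret coordinate_multiplication "H10_graph \<Omega>" "coordinate_op \<Omega> b" "coordinate_op \<Omega> b"
        "vector_op b" "component_op b"
      using \<Omega> b by (intro coordinate_multiplication_H10_graph) auto
    note t = test_function_square_integrable[OF \<phi>] test_function_zero_outside[OF \<phi>]
    have c: "component_op b (abs_l2 (grad \<phi>)) = abs_l2 (\<lambda>x. grad \<phi> x \<bullet> b)"
      unfolding component_op_def by (rule pointwise_op_abs[OF bounded_pointwise_component t(2)])
    have v: "vector_op b (abs_l2 \<phi>) = abs_l2 (\<lambda>x. \<phi> x *\<^sub>R b)"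
      unfolding vector_op_def by (rule pointwise_op_abs[OF bounded_pointwise_vector t(1)])
    have "p \<bullet> abs_l2 (\<lambda>x. grad \<phi> x \<bullet> b) = (LINT x|lebesgue_on \<Omega>. ?u x \<bullet> (grad \<phi> x \<bullet> b))"
      by (intro inner_p extend_zero_eq square_integrable_pointwise[OF bounded_pointwise_component] t)
        (simp add: t)
    moreover have "q \<bullet> abs_l2 (\<lambda>x. \<phi> x *\<^sub>R b) = (LINT x|lebesgue_on \<Omega>. ?G x \<bullet> (\<phi> x *\<^sub>R b))"
      by (intro inner_q extend_zero_eq square_integrable_pointwise[OF bounded_pointwise_vector] t)
        (simp add: t)
    moreover have "component_op b q \<bullet> abs_l2 \<phi> = - (p \<bullet> component_op b (abs_l2 (grad \<phi>)))"
      by (rule D_skew[OF H test_function_in_H10_graph[OF \<phi>]])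
    ultimately show "(LINT x|lebesgue_on \<Omega>. ?u x * partial_deriv \<phi> b x)
        = - (LINT x|lebesgue_on \<Omega>. (?G x \<bullet> b) * \<phi> x)"
      using V_adjoint[of q "abs_l2 \<phi>"] b by (simp add: c v grad_inner_Basis mult.commute[of "\<phi> _"])
  qed
  moreover obtain \<phi> where \<phi>: "\<And>n. \<phi> n \<in> test_functions \<Omega>"
    and lim: "(\<lambda>n. (abs_l2 (\<phi> n), abs_l2 (grad (\<phi> n)))) \<longlonglongrightarrow> (p, q)"
  proof -
    obtain z where z: "\<And>n. z n \<in> (\<lambda>\<phi>. (abs_l2 \<phi>, abs_l2 (grad \<phi>))) ` test_functions \<Omega>" and lim: "z \<longlonglongrightarrow> (p, q)"
      using H unfolding H10_graph_def closure_sequential by blast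
    from z obtain \<phi> where \<phi>: "\<And>n. \<phi> n \<in> test_functions \<Omega>"
      and "\<And>n. z n = (abs_l2 (\<phi> n), abs_l2 (grad (\<phi> n)))"
      unfolding image_iff by metis
    then have "z = (\<lambda>n. (abs_l2 (\<phi> n), abs_l2 (grad (\<phi> n))))" by blast
    then show ?thesis using that[OF \<phi>] lim by simp
  qed
  have "(\<lambda>n. (norm (abs_l2 (\<phi> n) - p))\<^sup>2 + (norm (abs_l2 (grad (\<phi> n)) - q))\<^sup>2) \<longlonglongrightarrow> (norm (p - p))\<^sup>2 + (norm (q - q))\<^sup>2"
    using tendsto_fst[OF lim] tendsto_snd[OF lim] by (intro tendsto_intros) auto
  moreover have "(norm (abs_l2 (\<phi> n) - p))\<^sup>2 = (LINT x|lebesgue_on \<Omega>. (\<phi> n x - ?u x)\<^sup>2)" for n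
    using norm_diff_extend_zero[OF \<Omega>(1) _ sq(1), of "\<phi> n"] test_function_square_integrable[OF \<phi>]
      extend_zero_test[OF \<phi>] supp by simp
  moreover have "(norm (abs_l2 (grad (\<phi> n)) - q))\<^sup>2 = (LINT x|lebesgue_on \<Omega>. (norm (grad (\<phi> n) x - ?G x))\<^sup>2)" for n
    using norm_diff_extend_zero[OF \<Omega>(1) _ sq(2), of "grad (\<phi> n)"] test_function_square_integrable[OF \<phi>]
      extend_zero_test[OF \<phi>] supp by simp
  ultimately have "H10 \<Omega> ?u ?G"
    unfolding H10_def using sq \<phi> by (auto simp: L2_iff_square_integrable[OF \<Omega>(1)])
  moreover have "(LINT x|lebesgue_on \<Omega>. ?G x \<bullet> grad \<phi> x) = (LINT x|lebesgue_on \<Omega>. \<mu> * ?u x * \<phi> x)"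
    if \<phi>: "\<phi> \<in> test_functions \<Omega>" for \<phi>
  proof -
    note t = test_function_square_integrable[OF \<phi>] extend_zero_test[OF \<phi>]
    have "q \<bullet> abs_l2 (grad \<phi>) = \<mu> * (p \<bullet> abs_l2 \<phi>)"
      by (rule eigenpairD(2)[OF pq test_function_in_H10_graph[OF \<phi>]])
    then show ?thesis using inner_p[of \<phi>] inner_q[of "grad \<phi>"] t by (simp add: mult.assoc)
  qed
  moreover have "L2 \<Omega> (\<lambda>x. \<mu> * ?u x)"
    using square_integrable_scaleR[OF sq(1), of \<mu>]
    by (simp add: L2_iff_square_integrable[OF \<Omega>(1)] extend_zero_def[abs_def] mult.left_commute)
  ultimately show "?u \<in> eigenspace \<Omega> \<mu>"
    unfolding eigenspace_def dirichlet_laplacian_def by blast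
qed

lemma eigenpair_span:
  assumes "\<And>i. i \<in> I \<Longrightarrow> \<exists>q. eigenpair \<mu> (a i) q" and "x \<in> span (a ` I)"
  shows "\<exists>q. eigenpair \<mu> x q"
proof -
  have "subspace {x. \<exists>q. eigenpair \<mu> x q}"
  proof (rule subspaceI; clarsimp)
    show "\<exists>q. eigenpair \<mu> 0 q"
      using subspace_0[OF subspace_H] by (intro exI[of _ 0]) (auto simp: eigenpair_def zero_prod_def)
    show "\<exists>q. eigenpair \<mu> (x + x') q" if "eigenpair \<mu> x q" "eigenpair \<mu> x' q'" for x x' q q'
      using eigenpairD[OF that(1)] eigenpairD[OF that(2)] by (intro exI[of _ "q + q'"])
        (auto simp: eigenpair_def[of \<mu> "x + x'"] H_add inner_add_left distrib_left)
    show "\<exists>q. eigenpair \<mu> (c *\<^sub>R x) q" if "eigenpair \<mu> x q" for c x q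
      using eigenpairD[OF that] by (intro exI[of _ "c *\<^sub>R q"])
        (auto simp: eigenpair_def[of \<mu> "c *\<^sub>R x"] H_scaleR)
  qed
  then show ?thesis using assms span_minimal[of "a ` I" "{x. \<exists>q. eigenpair \<mu> x q}"] by blast
qed

text \<open>Extension by zero turns almost everywhere relations on \<Omega> into linear relations
  between classes, so the given basis becomes a basis of weak eigenvectors, which is
  orthonormalised. The last conclusion, that no eigenvector is left over, is what the Rayleigh
  principle draws on; it has content even for an empty \<open>I\<close>.\<close>

lemma has_multiplicity_imp_orthonormal:
  assumes mult: "has_multiplicity \<Omega> \<mu> m" and I: "finite I" "card I = m"
  shows "\<exists>b. (\<forall>i\<in>I. \<exists>q. eigenpair \<mu> (b i) q) \<and>
    (\<forall>i\<in>I. \<forall>j\<in>I. b i \<bullet> b j = (if i = j then 1 else 0)) \<and>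
    (\<forall>w r. eigenpair \<mu> w r \<longrightarrow> (\<forall>i\<in>I. w \<bullet> b i = 0) \<longrightarrow> w = 0)"
proof -
  obtain u where u: "\<And>i. i < m \<Longrightarrow> u i \<in> eigenspace \<Omega> \<mu>"
    and indep: "\<And>c. (AE x in lebesgue_on \<Omega>. (\<Sum>i<m. c i * u i x) = 0) \<Longrightarrow> \<forall>i<m. c i = (0::real)"
    and span: "\<And>v. v \<in> eigenspace \<Omega> \<mu> \<Longrightarrow>
      \<exists>c::nat \<Rightarrow> real. AE x in lebesgue_on \<Omega>. v x = (\<Sum>i<m. c i * u i x)"
    using mult unfolding has_multiplicity_def by blast
  define a where "a i = abs_l2 (extend_zero \<Omega> (u i))" for i
  note sq = eigenspace_imp_eigenpair(1)[OF u]
  have comb: "square_integrable (extend_zero \<Omega> (\<lambda>x. \<Sum>i<m. c i * u i x)) \<and>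
      (\<Sum>i<m. c i *\<^sub>R a i) = abs_l2 (extend_zero \<Omega> (\<lambda>x. \<Sum>i<m. c i * u i x))" for c
  proof -
    have "(\<Sum>i<m. c i *\<^sub>R a i) = (\<Sum>i<m. abs_l2 (\<lambda>x. c i *\<^sub>R extend_zero \<Omega> (u i) x))"
      unfolding a_def by (intro sum.cong refl abs_l2_scaleR sq) auto
    moreover have "(\<lambda>x. \<Sum>i<m. c i *\<^sub>R extend_zero \<Omega> (u i) x) = extend_zero \<Omega> (\<lambda>x. \<Sum>i<m. c i * u i x)"
      by (simp add: extend_zero_def fun_eq_iff sum_distrib_left mult.left_commute)
    moreover have "square_integrable (\<lambda>x. c i *\<^sub>R extend_zero \<Omega> (u i) x)" if "i \<in> {..<m}" for i
      using that by (intro square_integrable_scaleR sq) simp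
    note abs_l2_sum[of "{..<m}" "\<lambda>i x. c i *\<^sub>R extend_zero \<Omega> (u i) x", OF this]
    ultimately show ?thesis by simp
  qed
  have AE_on: "(AE x in lebesgue_on \<Omega>. f x = g x) \<longleftrightarrow>
      (AE x in lebesgue. extend_zero \<Omega> f x = extend_zero \<Omega> g x)" for f g :: "'a \<Rightarrow> real"
    unfolding AE_restrict_space_iff[OF open_sets_lebesgue[OF \<Omega>(1)]]
    by (rule AE_cong) (auto simp: extend_zero_def indicator_def)
  have li: "\<forall>i<m. c i = 0" if c: "(\<Sum>i<m. c i *\<^sub>R a i) = 0" for c
  proof (rule indep)
    have "abs_l2 (extend_zero \<Omega> (\<lambda>x. \<Sum>i<m. c i * u i x)) = abs_l2 (\<lambda>x. 0)"
      using comb[of c] c by (simp add: abs_l2_zero)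
    then have "AE x in lebesgue. extend_zero \<Omega> (\<lambda>x. \<Sum>i<m. c i * u i x) x = 0"
      using comb[of c] by (subst (asm) abs_l2_eq_iff) auto
    then show "AE x in lebesgue_on \<Omega>. (\<Sum>i<m. c i * u i x) = 0"
      unfolding AE_on by (simp add: extend_zero_def[of \<Omega> "\<lambda>x. 0"])
  qed
  have "\<exists>b. (\<forall>i\<in>I. b i \<in> span (a ` {..<m})) \<and>
    (\<forall>i\<in>I. \<forall>j\<in>I. b i \<bullet> b j = (if i = j then 1 else 0)) \<and>
    (\<forall>w\<in>span (a ` {..<m}). (\<forall>i\<in>I. w \<bullet> b i = 0) \<longrightarrow> w = 0)"
    by (rule orthonormal_family_of_basis[OF _ I]) (rule li)
  then obtain b where b: "\<forall>i\<in>I. b i \<in> span (a ` {..<m})"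
    "\<forall>i\<in>I. \<forall>j\<in>I. b i \<bullet> b j = (if i = j then 1 else 0)"
    "\<forall>w\<in>span (a ` {..<m}). (\<forall>i\<in>I. w \<bullet> b i = 0) \<longrightarrow> w = 0"
    by (elim exE conjE) (rule that)
  show ?thesis
  proof (intro exI[of _ b] conjI ballI allI impI)
    have ea: "\<exists>q. eigenpair \<mu> (a i) q" if "i \<in> {..<m}" for i
      unfolding a_def using that by (intro eigenspace_imp_eigenpair(2) u) auto
    show "\<exists>q. eigenpair \<mu> (b i) q" if "i \<in> I" for i
      by (rule eigenpair_span[where a = a, OF ea bspec[OF b(1) that]])
    show "b i \<bullet> b j = (if i = j then 1 else 0)" if "i \<in> I" "j \<in> I" for i j
      using that b(2) by blast
    fix w r assume w: "eigenpair \<mu> w r" and ortho: "\<forall>i\<in>I. w \<bullet> b i = 0"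
    obtain c where "AE x in lebesgue_on \<Omega>. rep_l2 w x = (\<Sum>i<m. c i * u i x)"
      using span[OF eigenpair_imp_eigenspace(1)[OF w]] by blast
    then have "abs_l2 (extend_zero \<Omega> (rep_l2 w)) = abs_l2 (extend_zero \<Omega> (\<lambda>x. \<Sum>i<m. c i * u i x))"
      unfolding AE_on using comb[of c]
      by (subst abs_l2_eq_iff) (auto intro: square_integrable_extend_zero \<Omega>)
    then have "w = (\<Sum>i<m. c i *\<^sub>R a i)"
      using eigenpair_imp_eigenspace(2)[OF w] comb[of c] by simp
    then have "w \<in> span (a ` {..<m})"
      by (auto intro!: span_sum span_scale intro: span_base)
    then show "w = 0" using ortho b(3) by blast
  qed
qed

end

section \<open>The eigenvalue bound\<close>

text \<open>The vector is the first moment of the product of the two functions over \<Omega>.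
  Linearity in the axis \<open>e\<close> is what makes rotating the axes a problem of linear
  algebra.\<close>

lemma coordinate_op_inner_representation:
  fixes p p' :: "('a::euclidean_space, real) l2"
  assumes \<Omega>: "open \<Omega>" "bounded \<Omega>"
  obtains m where "\<And>e. coordinate_op \<Omega> e p \<bullet> p' = m \<bullet> e"
proof (cases p; cases p')
  fix f f' assume f: "square_integrable f" "p = abs_l2 f" and f': "square_integrable f'" "p' = abs_l2 f'"
  define F where "F e = (LINT x|lebesgue. (indicator \<Omega> x * (x \<bullet> e)) *\<^sub>R f x \<bullet> f' x)" for e
  note bp = bounded_pointwise_coordinate[OF \<Omega>]
  have F: "coordinate_op \<Omega> e p \<bullet> p' = F e" for e
    unfolding coordinate_op_def f(2) f'(2) pointwise_op_abs[OF bp f(1)] F_def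
    by (rule inner_abs_l2[OF square_integrable_pointwise[OF bp f(1)] f'(1)])
  have int: "integrable lebesgue (\<lambda>x. (indicator \<Omega> x * (x \<bullet> e)) *\<^sub>R f x \<bullet> f' x)" for e
    by (rule square_integrable_inner[OF square_integrable_pointwise[OF bp f(1)] f'(1)])
  have "linear F"
  proof (rule linearI)
    fix a b :: 'a and c :: real
    have "F (a + b) = (LINT x|lebesgue. (indicator \<Omega> x * (x \<bullet> a)) *\<^sub>R f x \<bullet> f' x
        + (indicator \<Omega> x * (x \<bullet> b)) *\<^sub>R f x \<bullet> f' x)"
      unfolding F_def by (simp add: inner_add_right algebra_simps)
    also have "\<dots> = F a + F b"
      unfolding F_def by (rule Bochner_Integration.integral_add[OF int int])
    finally show "F (a + b) = F a + F b" .
    have "F (c *\<^sub>R a) = (LINT x|lebesgue. c * ((indicator \<Omega> x * (x \<bullet> a)) *\<^sub>R f x \<bullet> f' x))"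
      unfolding F_def by (simp add: mult_ac)
    then show "F (c *\<^sub>R a) = c *\<^sub>R F a"
      by (simp add: F_def)
  qed
  have "F e = (\<Sum>b\<in>Basis. F b *\<^sub>R b) \<bullet> e" for e
  proof -
    have "F e = F (\<Sum>b\<in>Basis. (e \<bullet> b) *\<^sub>R b)" by (simp add: euclidean_representation)
    also have "\<dots> = (\<Sum>b\<in>Basis. (e \<bullet> b) * F b)"
      using \<open>linear F\<close> by (simp add: linear_sum linear_cmul)
    finally show ?thesis
      by (simp add: inner_sum_left inner_commute[of e] mult.commute)
  qed
  then show ?thesis using that F by metis
qed

lemma orthonormal_square_sum:
  fixes e :: "nat \<Rightarrow> 'a::euclidean_space"
  assumes on: "\<And>i j. i \<in> {1..DIM('a)} \<Longrightarrow> j \<in> {1..DIM('a)} \<Longrightarrow> e i \<bullet> e j = (if i = j then 1 else 0)"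
  shows "inj_on e {1..DIM('a)}" "(\<Sum>x\<in>e ` {1..DIM('a)}. (v \<bullet> x)\<^sup>2) = (norm v)\<^sup>2"
proof -
  let ?E = "e ` {1..DIM('a)}"
  show inj: "inj_on e {1..DIM('a)}"
    using on by (intro inj_onI) (metis zero_neq_one)
  have po: "pairwise orthogonal ?E"
    using on by (auto simp: pairwise_def orthogonal_def)
  have n1: "norm x = 1" if "x \<in> ?E" for x using that on by (auto simp: norm_eq_1)
  then have "0 \<notin> ?E" by force
  then have "dim ?E = DIM('a)"
    using pairwise_orthogonal_independent[OF po] card_image[OF inj] by (simp add: dim_eq_card_independent)
  then have "v \<in> span ?E" using dim_eq_full by blast
  then have "v = (\<Sum>x\<in>?E. (v \<bullet> x) *\<^sub>R x)"
    using orthonormal_basis_expand[OF po n1] by simp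
  then have "v \<bullet> v = v \<bullet> (\<Sum>x\<in>?E. (v \<bullet> x) *\<^sub>R x)" by simp
  then show "(\<Sum>x\<in>?E. (v \<bullet> x)\<^sup>2) = (norm v)\<^sup>2"
    unfolding power2_norm_eq_inner by (simp add: inner_sum_right power2_eq_square)
qed

text \<open>A QR decomposition: the basis is built from its last element downwards, since \<open>e i\<close> has
  to be orthogonal to \<open>i - 1\<close> given vectors and to the later \<open>DIM('a) - i\<close> basis elements.\<close>

lemma orthonormal_basis_flag:
  fixes m :: "nat \<Rightarrow> 'a::euclidean_space"
  obtains e where
    "\<And>i j. i \<in> {1..DIM('a)} \<Longrightarrow> j \<in> {1..DIM('a)} \<Longrightarrow> e i \<bullet> e j = (if i = j then 1 else 0)"
    "\<And>i j. i \<in> {1..DIM('a)} \<Longrightarrow> j \<in> {2..i} \<Longrightarrow> e i \<bullet> m j = 0"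
proof -
  let ?n = "DIM('a)"
  have "\<exists>e. (\<forall>i\<in>{?n - t<..?n}. \<forall>j\<in>{?n - t<..?n}. e i \<bullet> e j = (if i = j then 1 else 0)) \<and>
      (\<forall>i\<in>{?n - t<..?n}. \<forall>j\<in>{2..i}. e i \<bullet> m j = 0)" if "t \<le> ?n" for t
    using that
  proof (induction t)
    case (Suc t)
    then obtain e where e: "\<And>i j. i \<in> {?n - t<..?n} \<Longrightarrow> j \<in> {?n - t<..?n} \<Longrightarrow> e i \<bullet> e j = (if i = j then 1 else 0)"
      and em: "\<And>i j. i \<in> {?n - t<..?n} \<Longrightarrow> j \<in> {2..i} \<Longrightarrow> e i \<bullet> m j = 0"
      by (metis Suc_leD)
    define a where "a = ?n - t"
    have a: "1 \<le> a" "a \<le> ?n" using Suc.prems by (auto simp: a_def)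
    let ?S = "m ` {2..a} \<union> e ` {a<..?n}"
    \<comment> \<open>There are \<open>a - 1\<close> given vectors and \<open>DIM('a) - a\<close>
      later basis elements, one short of the dimension, so a direction orthogonal to all of them
      remains.\<close>
    have "card ?S \<le> card (m ` {2..a}) + card (e ` {a<..?n})" by (rule card_Un_le)
    also have "\<dots> \<le> card {2..a} + card {a<..?n}" by (intro add_mono card_image_le) auto
    also have "\<dots> < ?n" using a by simp
    finally have "dim ?S < ?n" using dim_le_card[of ?S ?S] by (simp add: span_superset)
    then obtain x where x: "x \<noteq> 0" "\<And>y. y \<in> span ?S \<Longrightarrow> orthogonal x y"
      by (rule orthogonal_to_subspace_exists) blast
    define y where "y = x /\<^sub>R norm x"
    have yS: "y \<bullet> s = 0" if "s \<in> ?S" for s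
      using x(2)[OF span_base[OF that]] by (simp add: y_def orthogonal_def)
    have ye: "y \<bullet> e j = 0" if "a < j" "j \<le> ?n" for j using that by (intro yS) auto
    then have ey: "e j \<bullet> y = 0" if "a < j" "j \<le> ?n" for j using that by (simp add: inner_commute)
    have ym: "y \<bullet> m j = 0" if "2 \<le> j" "j \<le> a" for j using that by (intro yS) auto
    have yy: "y \<bullet> y = 1" using x(1) by (simp add: y_def dot_square_norm power2_eq_square)
    have set: "{?n - Suc t<..?n} = insert a {a<..?n}" using Suc.prems by (auto simp: a_def)
    have "(\<forall>i\<in>insert a {a<..?n}. \<forall>j\<in>insert a {a<..?n}.
        (e(a := y)) i \<bullet> (e(a := y)) j = (if i = j then 1 else 0)) \<and>
      (\<forall>i\<in>insert a {a<..?n}. \<forall>j\<in>{2..i}. (e(a := y)) i \<bullet> m j = 0)"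
      using e em yy ye ey ym unfolding a_def[symmetric] by auto
    then show ?case unfolding set by blast
  qed simp
  from this[of ?n] obtain e where "\<forall>i\<in>{0<..?n}. \<forall>j\<in>{0<..?n}. e i \<bullet> e j = (if i = j then 1 else 0)"
    "\<forall>i\<in>{0<..?n}. \<forall>j\<in>{2..i}. e i \<bullet> m j = 0" by auto
  then show ?thesis by (intro that[of e]) auto
qed

theorem corollary3p2:
  fixes \<Omega> :: "'a::euclidean_space set" and ev :: "nat \<Rightarrow> real" and d :: real and k :: nat
  defines "d \<equiv> real DIM('a)"
  assumes "bounded_domain \<Omega>"
    and "dirichlet_eigenvalues \<Omega> ev"
    and "real k \<ge> (d + 1) * (1 + d / 2) / (1 + d / 4)"
  shows "eigenvalue_mean ev k / ev 1 \<le>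
    (d + 5) / 2 powr (2 / d) * ((d + 4) / ((d + 1) * (d + 2))) powr (1 + 2 / d) * real k powr (2 / d)"
proof -
  have \<Omega>: "open \<Omega>" "bounded \<Omega>" using assms(2) by (auto simp: bounded_domain_def)
  interpret gradient_graph "H10_graph \<Omega>" using \<Omega>(2) by (rule gradient_graph_H10_graph)
  \<comment> \<open>The positions at which \<mu> occurs. If \<mu> is no eigenvalue, the set is
    empty, and the last property of \<open>b\<close> below says that every weak eigenfunction for
    \<mu> is zero.\<close>
  define I where "I \<mu> = {k. 1 \<le> k \<and> ev k = \<mu>}" for \<mu>
  have mono: "mono_on {1..} ev" and fin: "finite (I \<mu>)"
    and mult: "has_multiplicity \<Omega> \<mu> (card (I \<mu>))" for \<mu>
    using assms(3) by (auto simp: dirichlet_eigenvalues_def I_def)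
  have evle: "ev i \<le> ev l" if "1 \<le> i" "i \<le> l" for i l
    using mono_onD[OF mono, of i l] that by simp
  have "\<forall>\<mu>. \<exists>b. (\<forall>i\<in>I \<mu>. \<exists>q. eigenpair \<mu> (b i) q) \<and>
      (\<forall>i\<in>I \<mu>. \<forall>j\<in>I \<mu>. b i \<bullet> b j = (if i = j then 1 else 0)) \<and>
      (\<forall>w r. eigenpair \<mu> w r \<longrightarrow> (\<forall>i\<in>I \<mu>. w \<bullet> b i = 0) \<longrightarrow> w = 0)"
    by (intro allI has_multiplicity_imp_orthonormal[OF \<Omega> mult fin refl])
  from choice[OF this] obtain b where b: "\<forall>\<mu>. (\<forall>i\<in>I \<mu>. \<exists>q. eigenpair \<mu> (b \<mu> i) q) \<and>
      (\<forall>i\<in>I \<mu>. \<forall>j\<in>I \<mu>. b \<mu> i \<bullet> b \<mu> j = (if i = j then 1 else 0)) \<and>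
      (\<forall>w r. eigenpair \<mu> w r \<longrightarrow> (\<forall>i\<in>I \<mu>. w \<bullet> b \<mu> i = 0) \<longrightarrow> w = 0)"
    by (elim exE) (rule that)
  have b1: "\<exists>q. eigenpair \<mu> (b \<mu> i) q" if "i \<in> I \<mu>" for \<mu> i
    by (rule bspec[OF conjunct1[OF spec[OF b]] that])
  have b2: "b \<mu> i \<bullet> b \<mu> j = (if i = j then 1 else 0)" if "i \<in> I \<mu>" "j \<in> I \<mu>" for \<mu> i j
    by (rule bspec[OF bspec[OF conjunct1[OF conjunct2[OF spec[OF b]]] that(1)] that(2)])
  have b3: "w = 0" if "eigenpair \<mu> w r" "\<forall>i\<in>I \<mu>. w \<bullet> b \<mu> i = 0" for \<mu> w r
    by (rule mp[OF mp[OF spec[OF spec[OF conjunct2[OF conjunct2[OF spec[OF b]]]]] that(1)] that(2)])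
  \<comment> \<open>The families are chosen per value and not per index, so that equal eigenvalues
    draw from one orthonormal family; different eigenvalues are orthogonal anyway.\<close>
  define p where "p i = b (ev i) i" for i
  have pI: "p i = b \<mu> i" if "i \<in> I \<mu>" for i \<mu> using that by (simp add: p_def I_def)
  have iI: "i \<in> I (ev i)" if "1 \<le> i" for i using that by (simp add: I_def)
  define q where "q i = (SOME q. eigenpair (ev i) (p i) q)" for i
  have eig: "eigenpair (ev i) (p i) (q i)" if "1 \<le> i" for i
  proof -
    have "\<exists>q. eigenpair (ev i) (p i) q" unfolding p_def by (rule b1[OF iI[OF that]])
    then show ?thesis unfolding q_def by (rule someI_ex)
  qed
  have on: "p i \<bullet> p j = (if i = j then 1 else 0)" if ij: "1 \<le> i" "1 \<le> j" for i j
  proof (cases "ev i = ev j")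
    case True
    then have "i \<in> I (ev i)" "j \<in> I (ev i)" using ij by (auto simp: I_def)
    then show ?thesis by (simp add: pI b2)
  next
    case False
    then show ?thesis using eigenpair_orthogonal[OF eig[OF ij(1)] eig[OF ij(2)]] by auto
  qed
  \<comment> \<open>By monotonicity an eigenvalue below \<open>ev (Suc n)\<close> occurs only at
    indices up to \<open>n\<close>. Its whole eigenspace is thus spanned by the first
    \<open>n\<close> eigenfunctions and contains nothing orthogonal to them but zero.\<close>
  have Rayleigh: "ev (Suc n) * (norm w)\<^sup>2 \<le> (norm r)\<^sup>2"
    if wr: "(w, r) \<in> H10_graph \<Omega>" "\<And>i. i \<in> {1..n} \<Longrightarrow> w \<bullet> p i = 0" for n w r
  proof (rule Rayleigh_lower_bound[where I = "{1..n}" and p = p and q = q and ev = ev, OF _ _ _ _ wr])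
    fix \<mu> w' r' assume \<mu>: "\<mu> < ev (Suc n)" and w': "eigenpair \<mu> w' r'" "\<And>i. i \<in> {1..n} \<Longrightarrow> w' \<bullet> p i = 0"
    have "w' \<bullet> b \<mu> i = 0" if i: "i \<in> I \<mu>" for i
    proof -
      have "i \<in> {1..n}"
        using i \<mu> evle[of "Suc n" i] by (cases "i \<le> n") (auto simp: I_def)
      then show ?thesis using w'(2) pI[OF i] by metis
    qed
    then show "w' = 0" by (intro b3[OF w'(1)] ballI)
  qed (use eig on in auto)
  have normq: "(norm (q i))\<^sup>2 = ev i" if "1 \<le> i" for i
    using eigenpairD(2)[OF eig[OF that] eigenpairD(1)[OF eig[OF that]]] on[OF that that]
    by (simp add: power2_norm_eq_inner)
  have Yang: "d * (\<Sum>i=1..n. (z - ev i)\<^sup>2) \<le> 4 * (\<Sum>i=1..n. (z - ev i) * ev i)"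
    if "1 \<le> n" "ev n \<le> z" "z \<le> ev (Suc n)" for n z
  proof -
    have "(\<Sum>i=1..n. (z - ev i)\<^sup>2) \<le> 4 * (\<Sum>i=1..n. (z - ev i) * (norm (component_op e (q i)))\<^sup>2)"
      if e: "e \<in> Basis" for e
    proof -
      interpret coordinate_multiplication "H10_graph \<Omega>" "coordinate_op \<Omega> e" "coordinate_op \<Omega> e"
          "vector_op e" "component_op e"
        using \<Omega> e by (intro coordinate_multiplication_H10_graph) auto
      show ?thesis
      proof (rule Yang_inequality[where p = p])
        fix w r assume wr: "(w, r) \<in> H10_graph \<Omega>" "\<And>i. i \<in> {1..n} \<Longrightarrow> w \<bullet> p i = 0"
        have "z * (norm w)\<^sup>2 \<le> ev (Suc n) * (norm w)\<^sup>2"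
          using \<open>z \<le> ev (Suc n)\<close> by (intro mult_right_mono) auto
        also have "\<dots> \<le> (norm r)\<^sup>2" by (rule Rayleigh[OF wr])
        finally show "z * (norm w)\<^sup>2 \<le> (norm r)\<^sup>2" .
      next
        show "ev i \<le> z" if "i \<in> {1..n}" for i
          using that evle[of i n] \<open>ev n \<le> z\<close> by auto
      qed (use eig on in auto)
    qed
    \<comment> \<open>Summation over the axes yields the factor \<open>d\<close> on the left and
      assembles the directional derivatives on the right into the full gradient, whose square norm
      is \<open>ev i\<close>.\<close>
    then have "(\<Sum>e\<in>(Basis::'a set). \<Sum>i=1..n. (z - ev i)\<^sup>2) \<le>
        (\<Sum>e\<in>Basis. 4 * (\<Sum>i=1..n. (z - ev i) * (norm (component_op e (q i)))\<^sup>2))"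
      by (rule sum_mono)
    also have "\<dots> = 4 * (\<Sum>i=1..n. (z - ev i) * (\<Sum>e\<in>Basis. (norm (component_op e (q i)))\<^sup>2))"
      unfolding sum_distrib_left by (rule sum.swap)
    also have "\<dots> = 4 * (\<Sum>i=1..n. (z - ev i) * ev i)"
    proof -
      have "(\<Sum>e\<in>Basis. (v \<bullet> e)\<^sup>2) = (norm v)\<^sup>2" for v :: 'a
        unfolding power2_norm_eq_inner euclidean_inner[of v v] by (simp add: power2_eq_square)
      then have "(\<Sum>e\<in>Basis. (norm (component_op e (q i)))\<^sup>2) = ev i" if "1 \<le> i" for i
        using sum_component_op_norm[of Basis "q i"] normq[OF that] by simp
      then show ?thesis by simp
    qed
    finally show ?thesis by (simp add: d_def)
  qed
  have gaps: "(\<Sum>a=1..DIM('a). ev (Suc a) - ev 1) \<le> 4 * ev 1"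
  proof -
    have "\<exists>m. \<forall>e. coordinate_op \<Omega> e (p 1) \<bullet> p j = m \<bullet> e" for j
      using coordinate_op_inner_representation[OF \<Omega>, of "p 1" "p j"] by metis
    then obtain m where m: "\<And>j e. coordinate_op \<Omega> e (p 1) \<bullet> p j = m j \<bullet> e" by metis
    \<comment> \<open>The axis \<open>e a\<close> is orthogonal to the moments \<open>m 2\<close>,
      ..., \<open>m a\<close>, which makes the trial function for \<open>e a\<close> orthogonal to
      \<open>p 2\<close>, ..., \<open>p a\<close>.\<close>
    obtain e where e: "\<And>i j. i \<in> {1..DIM('a)} \<Longrightarrow> j \<in> {1..DIM('a)} \<Longrightarrow> e i \<bullet> e j = (if i = j then 1 else 0)"
      and em: "\<And>i j. i \<in> {1..DIM('a)} \<Longrightarrow> j \<in> {2..i} \<Longrightarrow> e i \<bullet> m j = 0"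
      using orthonormal_basis_flag[of m] by blast
    have inj: "inj_on e {1..DIM('a)}"
      by (rule orthonormal_square_sum(1)) (rule e)
    have square_sum: "(\<Sum>x\<in>e ` {1..DIM('a)}. (v \<bullet> x)\<^sup>2) = (norm v)\<^sup>2" for v
      by (rule orthonormal_square_sum(2)) (rule e)
    have p1: "norm (p 1) = 1" using on[of 1 1] by (simp add: norm_eq_1)
    have "ev (Suc a) - ev 1 \<le> 4 * (norm (component_op (e a) (q 1)))\<^sup>2" if a: "a \<in> {1..DIM('a)}" for a
    proof -
      have "norm (e a) = 1" using e[OF a a] by (simp add: norm_eq_1)
      then interpret coordinate_multiplication "H10_graph \<Omega>" "coordinate_op \<Omega> (e a)" "coordinate_op \<Omega> (e a)"
          "vector_op (e a)" "component_op (e a)"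
        by (intro coordinate_multiplication_H10_graph \<Omega>)
      show ?thesis
      proof (rule first_gap_bound[OF eig[OF order_refl] p1])
        fix r
        let ?w = "coordinate_op \<Omega> (e a) (p 1) - (coordinate_op \<Omega> (e a) (p 1) \<bullet> p 1) *\<^sub>R p 1"
        assume "(?w, r) \<in> H10_graph \<Omega>"
        \<comment> \<open>For \<open>i = 1\<close> orthogonality is due to the subtracted
          projection, for the other indices to the rotation of the axes. So
          \<open>ev (Suc a)\<close> bounds the quotient.\<close>
        moreover have "?w \<bullet> p i = 0" if i: "i \<in> {1..a}" for i
        proof (cases "i = 1")
          case True
          then show ?thesis using on[of 1 1] by (simp add: inner_diff_left)
        next
          case False
          then have "coordinate_op \<Omega> (e a) (p 1) \<bullet> p i = 0"
            using em[OF a, of i] i m[of "e a" i] by (simp add: inner_commute)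
          then show ?thesis using on[of 1 i] i False by (simp add: inner_diff_left)
        qed
        ultimately show "ev (Suc a) * (norm ?w)\<^sup>2 \<le> (norm r)\<^sup>2" by (rule Rayleigh)
      qed
    qed
    then have "(\<Sum>a=1..DIM('a). ev (Suc a) - ev 1) \<le> (\<Sum>a=1..DIM('a). 4 * (norm (component_op (e a) (q 1)))\<^sup>2)"
      by (rule sum_mono)
    also have "\<dots> = 4 * (\<Sum>x\<in>e ` {1..DIM('a)}. (norm (component_op x (q 1)))\<^sup>2)"
      unfolding sum.reindex[OF inj] by (simp add: sum_distrib_left)
    also have "\<dots> = 4 * ev 1"
      using sum_component_op_norm[OF _ square_sum, of "q 1"] normq[of 1] by simp
    finally show ?thesis .
  qed
  have "0 \<le> ev 1" using normq[of 1] by (metis order_refl zero_le_power2)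
  show ?thesis
  \<comment> \<open>This case split takes the place of a proof that \<open>ev 1\<close> is positive:
    for \<open>ev 1 = 0\<close> the quotient is 0 by the convention on division, and the right-hand
    side is nonnegative.\<close>
  proof (cases "ev 1 = 0")
    case True
    then show ?thesis by (simp add: d_def)
  next
    case False
    then have "0 < ev 1" using \<open>0 \<le> ev 1\<close> by simp
    from first_mean_ratio_bound[OF _ mono this Yang[unfolded d_def] gaps assms(4)[unfolded d_def]]
    show ?thesis unfolding d_def eigenvalue_mean_def by simp
  qed
qed

end
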